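(* Let $G=A_\Gamma$ be a non-abelian right-angled Artin group and $X=X_\Gamma$ the natural CAT(0) cube complex on which $G$ acts. Then there is an infinite family $\{\gamma_i\}$ of segments in $\mathcal H(X)$ such that the homogeneous quasimorphisms $\{\widehat\varphi_{\gamma_i}\}$ are linearly independent in $\widetilde{\mathrm{QH}}(G)$.
   Context: For a simplicial graph $\Gamma$, $A_\Gamma$ has generating set $V(\Gamma)$ and relations $[v,w]=1$ for each edge $\{v,w\}$. $X_\Gamma$ is the universal cover of the standard non-positively curved cube complex $K(A_\Gamma,1)$: one vertex, one oriented loop per generator, and one $k$-dimensional torus for each complete subgraph of $\Gamma$ on $k$ vertices; $A_\Gamma$ acts on $X_\Gamma$ by deck transformations. A half-space $H$ of $X$ is the closure of a component of the complement of a hyperplane, $\overline H$ the complementary half-space; $\mathcal H(X)$ is the set of half-spaces ordered by inclusion and $\subset$ is strict. $H\pitchfork H'$ (transverse) means $H\cap H'$, $H\cap\overline{H'}$, $\overline H\cap H'$, $\overline H\cap\overline{H'}$ are all nonempty. $H, H'$ are tightly nested if one strictly contains the other and no third half-space lies properly between. For vertices $x,y$, $[x,y]=\{H: y\in H,\ x\in\overline H\}$. A segment $\gamma$ is a finite chain $H_1\supset\dots\supset H_n$ with consecutive half-spaces tightly nested; its inverse $\overline\gamma$ is $\overline H_n\supset\dots\supset\overline H_1$. Two segments $\gamma,\gamma'$ overlap if $\gamma\cap\gamma'\neq\emptyset$ or there are $H\in\gamma$, $H'\in\gamma'$ with $H\pitchfork H'$. $c_\gamma(x,y)$ is the maximal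 cardinality of a pairwise non-overlapping collection of $G$-translates of $\gamma$ contained in $[x,y]$, and $\omega_\gamma(x,y)=c_\gamma(x,y)-c_{\overline\gamma}(x,y)$. For $g\in G$ let $M_g$ be the full subcomplex spanned by vertices realizing $\min_x d(x,gx)$ ($d$ the combinatorial metric on vertices, $x$ ranging over vertices), $X_g$ its (combinatorial) convex hull, and choose a vertex $x_g\in X_g$. Put $\varphi_\gamma(g)=\omega_\gamma(x_g,gx_g)$. This is a quasimorphism, and its homogenization is $\widehat\varphi_\gamma(g)=\lim_{n\to\infty}\varphi_\gamma(g^n)/n$ (independent of the choices of $x_g$). A quasimorphism is a map $\varphi\colon G\to\mathbb R$ with $|\varphi(gh)-\varphi(g)-\varphi(h)|$ bounded; it is homogeneous if $\varphi(g^n)=n\varphi(g)$ for all $g\in G$, $n\in\mathbb Z$. $\widetilde{\mathrm{QH}}(G)$ is the real vector space of homogeneous quasimorphisms on $G$ modulo homomorphisms $G\to\mathbb R$. *)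

theory Defs
  imports Complex_Main "HOL-Algebra.Module"
begin

section \<open>Right-angled Artin groups\<close>

definition simplicial_graph :: "'v set \<Rightarrow> 'v set set \<Rightarrow> bool" where
  "simplicial_graph V E \<longleftrightarrow> (\<forall>e\<in>E. \<exists>v\<in>V. \<exists>w\<in>V. v \<noteq> w \<and> e = {v, w})"

text \<open>A word is a list of signed letters: \<open>(v, True)\<close> stands for the generator \<open>v\<close>
  and \<open>(v, False)\<close> for its inverse.\<close>

definition raag_words :: "'v set \<Rightarrow> ('v \<times> bool) list set" where
  "raag_words V = lists (V \<times> UNIV)"

inductive raag_eq :: "'v set \<Rightarrow> 'v set set \<Rightarrow> ('v \<times> bool) list \<Rightarrow> ('v \<times> bool) list \<Rightarrow> bool"
  for V :: "'v set" and E :: "'v set set" where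
  refl: "x \<in> raag_words V \<Longrightarrow> raag_eq V E x x"
| sym: "raag_eq V E x y \<Longrightarrow> raag_eq V E y x"
| trans: "raag_eq V E x y \<Longrightarrow> raag_eq V E y z \<Longrightarrow> raag_eq V E x z"
| cancel: "x \<in> raag_words V \<Longrightarrow> y \<in> raag_words V \<Longrightarrow> v \<in> V \<Longrightarrow>
    raag_eq V E (x @ [(v, b), (v, \<not> b)] @ y) (x @ y)"
| commutator: "x \<in> raag_words V \<Longrightarrow> y \<in> raag_words V \<Longrightarrow> v \<in> V \<Longrightarrow> w \<in> V \<Longrightarrow> {v, w} \<in> E \<Longrightarrow>
    raag_eq V E (x @ [(v, True), (w, True), (v, False), (w, False)] @ y) (x @ y)"

definition raag_rel :: "'v set \<Rightarrow> 'v set set \<Rightarrow> (('v \<times> bool) list \<times> ('v \<times> bool) list) set" where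
  "raag_rel V E = {(x, y). raag_eq V E x y}"

definition word_class :: "'v set \<Rightarrow> 'v set set \<Rightarrow> ('v \<times> bool) list \<Rightarrow> ('v \<times> bool) list set" where
  "word_class V E x = raag_rel V E `` {x}"

definition raag :: "'v set \<Rightarrow> 'v set set \<Rightarrow> ('v \<times> bool) list set monoid" where
  "raag V E =
    \<lparr>carrier = raag_words V // raag_rel V E,
     mult = (\<lambda>A B. \<Union>a\<in>A. \<Union>b\<in>B. word_class V E (a @ b)),
     one = word_class V E []\<rparr>"


section \<open>Cube complexes, hyperplanes and half-spaces\<close>

text \<open>A cube complex in which every cube is determined by its vertices (as is the case for
  CAT(0) cube complexes) is represented by the set of the vertex sets of its cubes.
  Subcomplexes and half-spaces are represented by their vertex sets.\<close>

definition verts :: "'a set set \<Rightarrow> 'a set" where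
  "verts X = \<Union>X"

definition edges :: "'a set set \<Rightarrow> 'a set set" where
  "edges X = {e \<in> X. card e = 2}"

definition adjacency :: "'a set set \<Rightarrow> ('a \<times> 'a) set" where
  "adjacency X = {(x, y). x \<noteq> y \<and> {x, y} \<in> edges X}"

definition cdist :: "'a set set \<Rightarrow> 'a \<Rightarrow> 'a \<Rightarrow> nat" where
  "cdist X x y = (LEAST n. (x, y) \<in> adjacency X ^^ n)"

text \<open>Two disjoint edges whose union is the vertex set of a cube are opposite edges of a square.
  A hyperplane is represented by the set of edges dual to it.\<close>

definition opposite :: "'a set set \<Rightarrow> ('a set \<times> 'a set) set" where
  "opposite X = {(e, f). e \<in> edges X \<and> f \<in> edges X \<and> e \<inter> f = {} \<and> e \<union> f \<in> X}"

text \<open>Since \<open>opposite X\<close> is symmetric, its reflexive transitive closure is the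
  equivalence relation it generates.\<close>

definition hyperplanes :: "'a set set \<Rightarrow> 'a set set set" where
  "hyperplanes X = edges X // (opposite X)\<^sup>*"

text \<open>The components of the complement of a hyperplane correspond to the connected components
  of the 1-skeleton after removal of the edges dual to it.\<close>

definition half_spaces :: "'a set set \<Rightarrow> 'a set set" where
  "half_spaces X =
    {{y. (x, y) \<in> {(u, w) \<in> adjacency X. {u, w} \<notin> h}\<^sup>*} | x h. x \<in> verts X \<and> h \<in> hyperplanes X}"

definition opp_half :: "'a set set \<Rightarrow> 'a set \<Rightarrow> 'a set" where
  "opp_half X H = verts X - H"

definition transverse :: "'a set set \<Rightarrow> 'a set \<Rightarrow> 'a set \<Rightarrow> bool" where
  "transverse X H H' \<longleftrightarrow>
     H \<inter> H' \<noteq> {} \<and> H \<inter> opp_half X H' \<noteq> {} \<and>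
     opp_half X H \<inter> H' \<noteq> {} \<and> opp_half X H \<inter> opp_half X H' \<noteq> {}"

definition tightly_nested :: "'a set set \<Rightarrow> 'a set \<Rightarrow> 'a set \<Rightarrow> bool" where
  "tightly_nested X H H' \<longleftrightarrow>
     (H' \<subset> H \<and> (\<nexists>K. K \<in> half_spaces X \<and> H' \<subset> K \<and> K \<subset> H)) \<or>
     (H \<subset> H' \<and> (\<nexists>K. K \<in> half_spaces X \<and> H \<subset> K \<and> K \<subset> H'))"

definition separators :: "'a set set \<Rightarrow> 'a \<Rightarrow> 'a \<Rightarrow> 'a set set" where
  "separators X x y = {H \<in> half_spaces X. y \<in> H \<and> x \<in> opp_half X H}"

definition comb_convex :: "'a set set \<Rightarrow> 'a set \<Rightarrow> bool" where
  "comb_convex X C \<longleftrightarrow> C \<subseteq> verts X \<and>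
     (\<forall>x\<in>C. \<forall>y\<in>C. \<forall>z\<in>verts X. cdist X x z + cdist X z y = cdist X x y \<longrightarrow> z \<in> C)"

definition comb_hull :: "'a set set \<Rightarrow> 'a set \<Rightarrow> 'a set" where
  "comb_hull X S = \<Inter>{C. comb_convex X C \<and> S \<subseteq> C}"


section \<open>Segments\<close>

definition segment :: "'a set set \<Rightarrow> 'a set list \<Rightarrow> bool" where
  "segment X \<gamma> \<longleftrightarrow> \<gamma> \<noteq> [] \<and> set \<gamma> \<subseteq> half_spaces X \<and>
     successively (\<lambda>H H'. H' \<subset> H \<and> tightly_nested X H H') \<gamma>"

definition inverse_segment :: "'a set set \<Rightarrow> 'a set list \<Rightarrow> 'a set list" where
  "inverse_segment X \<gamma> = rev (map (opp_half X) \<gamma>)"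

definition overlap :: "'a set set \<Rightarrow> 'a set list \<Rightarrow> 'a set list \<Rightarrow> bool" where
  "overlap X \<gamma> \<gamma>' \<longleftrightarrow>
     set \<gamma> \<inter> set \<gamma>' \<noteq> {} \<or> (\<exists>H\<in>set \<gamma>. \<exists>H'\<in>set \<gamma>'. transverse X H H')"


section \<open>Counting functions and quasimorphisms from an action\<close>

text \<open>In this section \<open>act\<close> is an action of the group \<open>G\<close> on the vertices of \<open>X\<close>
  by automorphisms of the cube complex.\<close>

definition translates :: "('g, 'm) monoid_scheme \<Rightarrow> ('g \<Rightarrow> 'a \<Rightarrow> 'a) \<Rightarrow> 'a set list \<Rightarrow> 'a set list set" where
  "translates G act \<gamma> = (\<lambda>g. map (\<lambda>H. act g ` H) \<gamma>) ` carrier G"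

definition seg_count ::
    "('g, 'm) monoid_scheme \<Rightarrow> ('g \<Rightarrow> 'a \<Rightarrow> 'a) \<Rightarrow> 'a set set \<Rightarrow> 'a set list \<Rightarrow> 'a \<Rightarrow> 'a \<Rightarrow> nat" where
  "seg_count G act X \<gamma> x y =
     Max {card C | C. finite C \<and> C \<subseteq> translates G act \<gamma> \<and>
            (\<forall>\<sigma>\<in>C. set \<sigma> \<subseteq> separators X x y) \<and>
            pairwise (\<lambda>\<sigma> \<tau>. \<not> overlap X \<sigma> \<tau>) C}"

definition seg_omega ::
    "('g, 'm) monoid_scheme \<Rightarrow> ('g \<Rightarrow> 'a \<Rightarrow> 'a) \<Rightarrow> 'a set set \<Rightarrow> 'a set list \<Rightarrow> 'a \<Rightarrow> 'a \<Rightarrow> real" where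
  "seg_omega G act X \<gamma> x y =
     real (seg_count G act X \<gamma> x y) - real (seg_count G act X (inverse_segment X \<gamma>) x y)"

definition min_set :: "('g \<Rightarrow> 'a \<Rightarrow> 'a) \<Rightarrow> 'a set set \<Rightarrow> 'g \<Rightarrow> 'a set" where
  "min_set act X g = {x \<in> verts X. \<forall>y\<in>verts X. cdist X x (act g x) \<le> cdist X y (act g y)}"

text \<open>\<open>base g\<close> is the chosen vertex \<open>x\<^sub>g\<close> of the hull of the minimal set of \<open>g\<close>.\<close>

definition base_choice ::
    "('g, 'm) monoid_scheme \<Rightarrow> ('g \<Rightarrow> 'a \<Rightarrow> 'a) \<Rightarrow> 'a set set \<Rightarrow> ('g \<Rightarrow> 'a) \<Rightarrow> bool" where
  "base_choice G act X base \<longleftrightarrow> (\<forall>g\<in>carrier G. base g \<in> comb_hull X (min_set act X g))"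

definition seg_qm ::
    "('g, 'm) monoid_scheme \<Rightarrow> ('g \<Rightarrow> 'a \<Rightarrow> 'a) \<Rightarrow> 'a set set \<Rightarrow> ('g \<Rightarrow> 'a) \<Rightarrow> 'a set list \<Rightarrow> 'g \<Rightarrow> real" where
  "seg_qm G act X base \<gamma> g = seg_omega G act X \<gamma> (base g) (act g (base g))"

definition homogenization :: "('g, 'm) monoid_scheme \<Rightarrow> ('g \<Rightarrow> real) \<Rightarrow> 'g \<Rightarrow> real" where
  "homogenization G \<phi> g = lim (\<lambda>n::nat. \<phi> (g [^]\<^bsub>G\<^esub> n) / real n)"


section \<open>The universal cover of the Salvetti complex\<close>

text \<open>Edge paths in \<open>K(A\<^sub>\<Gamma>, 1)\<close> based at its only vertex are words in the signed letters, and two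
  of them are homotopic iff they represent the same element of the group. So the vertices of the
  universal cover (homotopy classes of based edge paths) are the group elements, the group acts by
  left multiplication, and the lifts at \<open>g\<close> of the torus of a complete subgraph \<open>K\<close> are the cubes
  with vertices \<open>g s\<^sub>1 \<dots> s\<^sub>j\<close> for \<open>{s\<^sub>1, \<dots>, s\<^sub>j} \<subseteq> K\<close>.\<close>

definition clique :: "'v set \<Rightarrow> 'v set set \<Rightarrow> 'v set \<Rightarrow> bool" where
  "clique V E K \<longleftrightarrow> finite K \<and> K \<subseteq> V \<and> (\<forall>v\<in>K. \<forall>w\<in>K. v \<noteq> w \<longrightarrow> {v, w} \<in> E)"

definition raag_cube ::
    "'v set \<Rightarrow> 'v set set \<Rightarrow> ('v \<times> bool) list set \<Rightarrow> 'v set \<Rightarrow> ('v \<times> bool) list set set" where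
  "raag_cube V E g K =
     {g \<otimes>\<^bsub>raag V E\<^esub> word_class V E (map (\<lambda>v. (v, True)) vs) | vs. distinct vs \<and> set vs \<subseteq> K}"

definition raag_complex :: "'v set \<Rightarrow> 'v set set \<Rightarrow> ('v \<times> bool) list set set set" where
  "raag_complex V E = {raag_cube V E g K | g K. g \<in> carrier (raag V E) \<and> clique V E K}"


section \<open>Homogeneous quasimorphisms modulo homomorphisms\<close>

definition real_ring :: "real ring" where
  "real_ring = \<lparr>carrier = UNIV, mult = (*), one = 1, zero = 0, add = (+)\<rparr>"

definition quasimorphism :: "('g, 'm) monoid_scheme \<Rightarrow> ('g \<Rightarrow> real) \<Rightarrow> bool" where
  "quasimorphism G \<phi> \<longleftrightarrow>
     (\<exists>D. \<forall>g\<in>carrier G. \<forall>h\<in>carrier G. \<bar>\<phi> (g \<otimes>\<^bsub>G\<^esub> h) - \<phi> g - \<phi> h\<bar> \<le> D)"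

definition homogeneous :: "('g, 'm) monoid_scheme \<Rightarrow> ('g \<Rightarrow> real) \<Rightarrow> bool" where
  "homogeneous G \<phi> \<longleftrightarrow> (\<forall>g\<in>carrier G. \<forall>n::int. \<phi> (g [^]\<^bsub>G\<^esub> n) = of_int n * \<phi> g)"

definition hqm :: "('g, 'm) monoid_scheme \<Rightarrow> ('g \<Rightarrow> real) set" where
  "hqm G = {\<phi>. quasimorphism G \<phi> \<and> homogeneous G \<phi>}"

definition real_homs :: "('g, 'm) monoid_scheme \<Rightarrow> ('g \<Rightarrow> real) set" where
  "real_homs G = hom G (add_monoid real_ring)"

text \<open>The conditions above only concern values on \<open>carrier G\<close>. Functions that agree on
  \<open>carrier G\<close> differ by an element of \<open>real_homs G\<close>, so the values elsewhere disappear in the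
  quotient.\<close>

definition hqm_class :: "('g, 'm) monoid_scheme \<Rightarrow> ('g \<Rightarrow> real) \<Rightarrow> ('g \<Rightarrow> real) set" where
  "hqm_class G \<phi> = {\<psi> \<in> hqm G. (\<lambda>g. \<psi> g - \<phi> g) \<in> real_homs G}"

text \<open>The fields \<open>mult\<close> and \<open>one\<close> of a module record carry no meaning.\<close>

definition QH_tilde :: "('g, 'm) monoid_scheme \<Rightarrow> (real, ('g \<Rightarrow> real) set) module" where
  "QH_tilde G =
    \<lparr>carrier = hqm_class G ` hqm G,
     mult = undefined, one = undefined,
     zero = hqm_class G (\<lambda>g. 0),
     add = (\<lambda>A B. \<Union>\<phi>\<in>A. \<Union>\<psi>\<in>B. hqm_class G (\<lambda>g. \<phi> g + \<psi> g)),
     smult = (\<lambda>c A. \<Union>\<phi>\<in>A. hqm_class G (\<lambda>g. c * \<phi> g))\<rparr>"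

definition linearly_independent :: "(real, 'b, 'm) module_scheme \<Rightarrow> ('i \<Rightarrow> 'b) \<Rightarrow> bool" where
  "linearly_independent M v \<longleftrightarrow> range v \<subseteq> carrier M \<and>
     (\<forall>J a. finite J \<longrightarrow> (\<Oplus>\<^bsub>M\<^esub>j\<in>J. a j \<odot>\<^bsub>M\<^esub> v j) = \<zero>\<^bsub>M\<^esub> \<longrightarrow> (\<forall>j\<in>J. a j = 0))"


section \<open>Well-definedness of the notions above\<close>

lemma raag_eq_words: "raag_eq V E x y \<Longrightarrow> x \<in> raag_words V \<and> y \<in> raag_words V"
  by (induction rule: raag_eq.induct) (auto simp: raag_words_def)

lemma raag_eq_append:
  assumes "raag_eq V E x y" "p \<in> raag_words V" "q \<in> raag_words V"
  shows "raag_eq V E (p @ x @ q) (p @ y @ q)"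
  using assms
proof (induction rule: raag_eq.induct)
  case (refl x)
  then show ?case by (auto simp: raag_words_def intro!: raag_eq.refl)
next
  case (sym x y)
  then show ?case by (blast intro: raag_eq.sym)
next
  case (trans x y z)
  then show ?case by (blast intro: raag_eq.trans)
next
  case (cancel x y v b)
  then show ?case
    using raag_eq.cancel[of "p @ x" V "y @ q" v E b] by (auto simp: raag_words_def)
next
  case (commutator x y v w)
  then show ?case
    using raag_eq.commutator[of "p @ x" V "y @ q" v w E] by (auto simp: raag_words_def)
qed

lemma raag_eq_append2:
  assumes "raag_eq V E x x'" "raag_eq V E y y'"
  shows "raag_eq V E (x @ y) (x' @ y')"
proof -
  have w: "x \<in> raag_words V" "x' \<in> raag_words V" "y \<in> raag_words V" "y' \<in> raag_words V"
    using assms raag_eq_words by blast+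
  have n: "[] \<in> raag_words V" by (simp add: raag_words_def)
  show ?thesis
    using raag_eq_append[OF assms(1) n w(3)] raag_eq_append[OF assms(2) w(2) n]
    by (auto intro: raag_eq.trans)
qed

lemma equiv_raag_rel: "equiv (raag_words V) (raag_rel V E)"
proof (rule equivI)
  show "refl_on (raag_words V) (raag_rel V E)"
    by (auto simp: refl_on_def raag_rel_def intro: raag_eq.refl)
  show "raag_rel V E \<subseteq> raag_words V \<times> raag_words V"
    by (auto simp: raag_rel_def dest: raag_eq_words)
  show "sym (raag_rel V E)"
    by (auto simp: sym_def raag_rel_def intro: raag_eq.sym)
  show "trans (raag_rel V E)"
    unfolding trans_def raag_rel_def by (blast intro: raag_eq.trans)
qed

lemma word_class_eq_iff:
  assumes "x \<in> raag_words V" "y \<in> raag_words V"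
  shows "word_class V E x = word_class V E y \<longleftrightarrow> raag_eq V E x y"
  using eq_equiv_class_iff[OF equiv_raag_rel assms] by (simp add: word_class_def raag_rel_def)

lemma raag_carrier: "carrier (raag V E) = word_class V E ` raag_words V"
  by (auto simp: raag_def quotient_def word_class_def)

lemma raag_one: "\<one>\<^bsub>raag V E\<^esub> = word_class V E []"
  by (simp add: raag_def)

lemma raag_mult:
  assumes "x \<in> raag_words V" "y \<in> raag_words V"
  shows "word_class V E x \<otimes>\<^bsub>raag V E\<^esub> word_class V E y = word_class V E (x @ y)"
proof -
  have *: "word_class V E (a @ b) = word_class V E (x @ y)"
    if "a \<in> word_class V E x" "b \<in> word_class V E y" for a b
  proof -
    have e: "raag_eq V E (a @ b) (x @ y)"
      using that by (intro raag_eq_append2) (auto simp: word_class_def raag_rel_def intro: raag_eq.sym)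
    then show ?thesis using raag_eq_words[OF e] by (simp add: word_class_eq_iff)
  qed
  have "x \<in> word_class V E x" "y \<in> word_class V E y"
    using assms by (auto simp: word_class_def raag_rel_def intro: raag_eq.refl)
  then have "(\<Union>a\<in>word_class V E x. \<Union>b\<in>word_class V E y. word_class V E (a @ b)) = word_class V E (x @ y)"
    by (intro SUP_eq_const *) blast+
  then show ?thesis by (simp add: raag_def)
qed

lemma raag_words_append: "x @ y \<in> raag_words V \<longleftrightarrow> x \<in> raag_words V \<and> y \<in> raag_words V"
  by (auto simp: raag_words_def)

lemma raag_inverse_word:
  assumes "x \<in> raag_words V"
  shows "\<exists>y\<in>raag_words V. raag_eq V E (y @ x) []"
  using assms
proof (induction x)
  case Nil
  then show ?case by (intro bexI[of _ "[]"]) (auto intro: raag_eq.refl simp: raag_words_def)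
next
  case (Cons a x)
  obtain v b where a: "a = (v, b)" by (cases a)
  from Cons have x: "x \<in> raag_words V" and v: "v \<in> V" by (auto simp: raag_words_def a)
  then obtain y where y: "y \<in> raag_words V" "raag_eq V E (y @ x) []" using Cons by blast
  have "raag_eq V E (y @ [(v, \<not> b), (v, \<not> \<not> b)] @ x) (y @ x)"
    using x y v by (intro raag_eq.cancel) auto
  then have "raag_eq V E ((y @ [(v, \<not> b)]) @ a # x) []"
    using y(2) by (auto simp: a intro: raag_eq.trans)
  moreover have "y @ [(v, \<not> b)] \<in> raag_words V" using y v by (simp add: raag_words_def)
  ultimately show ?case by blast
qed

lemma group_raag: "group (raag V E)"
proof (rule groupI)
  fix A assume "A \<in> carrier (raag V E)"
  then obtain x where x: "x \<in> raag_words V" "A = word_class V E x" by (auto simp: raag_carrier)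
  obtain y where y: "y \<in> raag_words V" "raag_eq V E (y @ x) []"
    using raag_inverse_word[OF x(1)] by blast
  have "word_class V E (y @ x) = word_class V E []"
    using x y by (subst word_class_eq_iff) (auto simp: raag_words_def)
  then show "\<exists>B\<in>carrier (raag V E). B \<otimes>\<^bsub>raag V E\<^esub> A = \<one>\<^bsub>raag V E\<^esub>"
    using x y by (intro bexI[of _ "word_class V E y"]) (auto simp: raag_mult raag_one raag_carrier)
next
  show "\<one>\<^bsub>raag V E\<^esub> \<in> carrier (raag V E)"
    by (auto simp: raag_one raag_carrier raag_words_def)
next
  fix A assume "A \<in> carrier (raag V E)"
  then obtain x where x: "x \<in> raag_words V" "A = word_class V E x" by (auto simp: raag_carrier)
  then show "\<one>\<^bsub>raag V E\<^esub> \<otimes>\<^bsub>raag V E\<^esub> A = A"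
    using raag_mult[of "[]" V x E] by (simp add: raag_one raag_words_def)
qed (auto simp: raag_carrier raag_mult raag_words_append)

lemma verts_raag_complex_nonempty: "verts (raag_complex V E) \<noteq> {}"
proof -
  let ?e = "\<one>\<^bsub>raag V E\<^esub>"
  have "?e \<in> carrier (raag V E)" by (intro monoid.one_closed group.is_monoid group_raag)
  moreover have "clique V E {}" by (simp add: clique_def)
  ultimately have "raag_cube V E ?e {} \<in> raag_complex V E"
    unfolding raag_complex_def by blast
  moreover have "raag_cube V E ?e {} \<noteq> {}"
    by (auto simp: raag_cube_def)
  ultimately show ?thesis by (auto simp: verts_def)
qed

lemma base_choice_exists:
  assumes "verts X \<noteq> {}"
  shows "\<exists>base. base_choice G act X base"
proof -
  have "\<exists>x. x \<in> comb_hull X (min_set act X g)" for g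
  proof -
    obtain x where "x \<in> verts X" using assms by blast
    then obtain x where "x \<in> verts X" "\<forall>y. y \<in> verts X \<longrightarrow> cdist X x (act g x) \<le> cdist X y (act g y)"
      using ex_has_least_nat[of "\<lambda>x. x \<in> verts X" x "\<lambda>x. cdist X x (act g x)"] by blast
    then have "x \<in> comb_hull X (min_set act X g)" by (auto simp: min_set_def comb_hull_def)
    then show ?thesis ..
  qed
  then show ?thesis unfolding base_choice_def by metis
qed

lemma real_homs_iff:
  "f \<in> real_homs G \<longleftrightarrow> (\<forall>x\<in>carrier G. \<forall>y\<in>carrier G. f (x \<otimes>\<^bsub>G\<^esub> y) = f x + f y)"
  by (auto simp: real_homs_def hom_def real_ring_def)

lemma real_homs_add:
  "f \<in> real_homs G \<Longrightarrow> f' \<in> real_homs G \<Longrightarrow> (\<lambda>g. f g + f' g) \<in> real_homs G"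
  by (simp add: real_homs_iff)

lemma real_homs_scale: "f \<in> real_homs G \<Longrightarrow> (\<lambda>g. c * f g) \<in> real_homs G"
  by (simp add: real_homs_iff distrib_left)

lemma hqm_add:
  assumes "\<phi> \<in> hqm G" "\<psi> \<in> hqm G"
  shows "(\<lambda>g. \<phi> g + \<psi> g) \<in> hqm G"
proof -
  from assms obtain C D where
    "\<forall>g\<in>carrier G. \<forall>h\<in>carrier G. \<bar>\<phi> (g \<otimes>\<^bsub>G\<^esub> h) - \<phi> g - \<phi> h\<bar> \<le> C"
    "\<forall>g\<in>carrier G. \<forall>h\<in>carrier G. \<bar>\<psi> (g \<otimes>\<^bsub>G\<^esub> h) - \<psi> g - \<psi> h\<bar> \<le> D"
    unfolding hqm_def quasimorphism_def by blast
  then have "\<forall>g\<in>carrier G. \<forall>h\<in>carrier G.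
      \<bar>(\<phi> (g \<otimes>\<^bsub>G\<^esub> h) + \<psi> (g \<otimes>\<^bsub>G\<^esub> h)) - (\<phi> g + \<psi> g) - (\<phi> h + \<psi> h)\<bar> \<le> C + D"
    by (smt (verit))
  then show ?thesis
    using assms by (auto simp: hqm_def quasimorphism_def homogeneous_def distrib_left)
qed

lemma hqm_scale:
  assumes "\<phi> \<in> hqm G"
  shows "(\<lambda>g. c * \<phi> g) \<in> hqm G"
proof -
  from assms obtain C where
    C: "\<forall>g\<in>carrier G. \<forall>h\<in>carrier G. \<bar>\<phi> (g \<otimes>\<^bsub>G\<^esub> h) - \<phi> g - \<phi> h\<bar> \<le> C"
    unfolding hqm_def quasimorphism_def by blast
  have "\<bar>c * \<phi> (g \<otimes>\<^bsub>G\<^esub> h) - c * \<phi> g - c * \<phi> h\<bar> \<le> \<bar>c\<bar> * C"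
    if "g \<in> carrier G" "h \<in> carrier G" for g h
  proof -
    have "\<bar>c * \<phi> (g \<otimes>\<^bsub>G\<^esub> h) - c * \<phi> g - c * \<phi> h\<bar> = \<bar>c\<bar> * \<bar>\<phi> (g \<otimes>\<^bsub>G\<^esub> h) - \<phi> g - \<phi> h\<bar>"
      by (simp flip: abs_mult add: right_diff_distrib)
    also have "\<dots> \<le> \<bar>c\<bar> * C" using C that by (intro mult_left_mono) auto
    finally show ?thesis .
  qed
  then show ?thesis
    using assms by (auto simp: hqm_def quasimorphism_def homogeneous_def)
qed

lemma hqm_zero: "(\<lambda>g. 0) \<in> hqm G"
  by (auto simp: hqm_def quasimorphism_def homogeneous_def)

lemma hqm_class_eq_iff:
  assumes "\<phi> \<in> hqm G" "\<psi> \<in> hqm G"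
  shows "hqm_class G \<phi> = hqm_class G \<psi> \<longleftrightarrow> (\<lambda>g. \<phi> g - \<psi> g) \<in> real_homs G"
proof
  assume "hqm_class G \<phi> = hqm_class G \<psi>"
  moreover have "\<phi> \<in> hqm_class G \<phi>" using assms by (simp add: hqm_class_def real_homs_iff)
  ultimately show "(\<lambda>g. \<phi> g - \<psi> g) \<in> real_homs G" by (auto simp: hqm_class_def)
next
  assume "(\<lambda>g. \<phi> g - \<psi> g) \<in> real_homs G"
  then have "(\<lambda>g. \<chi> g - \<phi> g) \<in> real_homs G \<longleftrightarrow> (\<lambda>g. \<chi> g - \<psi> g) \<in> real_homs G" for \<chi>
    unfolding real_homs_iff by (smt (verit))
  then show "hqm_class G \<phi> = hqm_class G \<psi>" by (auto simp: hqm_class_def)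
qed

lemma QH_tilde_add:
  assumes "\<phi> \<in> hqm G" "\<psi> \<in> hqm G"
  shows "hqm_class G \<phi> \<oplus>\<^bsub>QH_tilde G\<^esub> hqm_class G \<psi> = hqm_class G (\<lambda>g. \<phi> g + \<psi> g)"
proof -
  have *: "hqm_class G (\<lambda>g. \<phi>' g + \<psi>' g) = hqm_class G (\<lambda>g. \<phi> g + \<psi> g)"
    if "\<phi>' \<in> hqm_class G \<phi>" "\<psi>' \<in> hqm_class G \<psi>" for \<phi>' \<psi>'
  proof -
    have "(\<lambda>g. (\<phi>' g - \<phi> g) + (\<psi>' g - \<psi> g)) \<in> real_homs G"
      using that by (intro real_homs_add) (auto simp: hqm_class_def)
    moreover have "(\<lambda>g. (\<phi>' g - \<phi> g) + (\<psi>' g - \<psi> g)) = (\<lambda>g. \<phi>' g + \<psi>' g - (\<phi> g + \<psi> g))"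
      by auto
    moreover have "\<phi>' \<in> hqm G" "\<psi>' \<in> hqm G" using that by (auto simp: hqm_class_def)
    ultimately show ?thesis using assms by (simp add: hqm_class_eq_iff hqm_add)
  qed
  have "\<phi> \<in> hqm_class G \<phi>" "\<psi> \<in> hqm_class G \<psi>"
    using assms by (simp_all add: hqm_class_def real_homs_iff)
  then have "(\<Union>\<phi>'\<in>hqm_class G \<phi>. \<Union>\<psi>'\<in>hqm_class G \<psi>. hqm_class G (\<lambda>g. \<phi>' g + \<psi>' g)) =
      hqm_class G (\<lambda>g. \<phi> g + \<psi> g)"
    by (intro SUP_eq_const *) blast+
  then show ?thesis by (simp add: QH_tilde_def)
qed

lemma QH_tilde_smult:
  assumes "\<phi> \<in> hqm G"
  shows "c \<odot>\<^bsub>QH_tilde G\<^esub> hqm_class G \<phi> = hqm_class G (\<lambda>g. c * \<phi> g)"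
proof -
  have *: "hqm_class G (\<lambda>g. c * \<phi>' g) = hqm_class G (\<lambda>g. c * \<phi> g)" if "\<phi>' \<in> hqm_class G \<phi>" for \<phi>'
  proof -
    have "(\<lambda>g. c * (\<phi>' g - \<phi> g)) \<in> real_homs G"
      using that by (intro real_homs_scale) (auto simp: hqm_class_def)
    moreover have "\<phi>' \<in> hqm G" using that by (auto simp: hqm_class_def)
    ultimately show ?thesis using assms by (simp add: hqm_class_eq_iff hqm_scale right_diff_distrib)
  qed
  have "\<phi> \<in> hqm_class G \<phi>" using assms by (simp add: hqm_class_def real_homs_iff)
  then have "(\<Union>\<phi>'\<in>hqm_class G \<phi>. hqm_class G (\<lambda>g. c * \<phi>' g)) = hqm_class G (\<lambda>g. c * \<phi> g)"
    by (intro SUP_eq_const *) blast+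
  then show ?thesis by (simp add: QH_tilde_def)
qed

lemma QH_tilde_carrier: "carrier (QH_tilde G) = hqm_class G ` hqm G"
  by (simp add: QH_tilde_def)

lemma QH_tilde_zero: "\<zero>\<^bsub>QH_tilde G\<^esub> = hqm_class G (\<lambda>g. 0)"
  by (simp add: QH_tilde_def)

lemma cring_real_ring: "cring real_ring"
proof (rule cringI)
  show "abelian_group real_ring"
    by (rule abelian_groupI) (auto simp: real_ring_def intro: exI[of _ "- _"])
  show "comm_monoid real_ring"
    by (rule comm_monoidI) (auto simp: real_ring_def)
qed (auto simp: real_ring_def distrib_right)

lemma module_QH_tilde: "module real_ring (QH_tilde G)"
proof (rule moduleI)
  show "cring real_ring" by (rule cring_real_ring)
  show "abelian_group (QH_tilde G)"
  proof (rule abelian_groupI)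
    fix A assume "A \<in> carrier (QH_tilde G)"
    then obtain \<phi> where \<phi>: "\<phi> \<in> hqm G" "A = hqm_class G \<phi>" by (auto simp: QH_tilde_carrier)
    have "(\<lambda>g. - 1 * \<phi> g) \<in> hqm G" using \<phi> by (intro hqm_scale)
    then show "\<exists>B\<in>carrier (QH_tilde G). B \<oplus>\<^bsub>QH_tilde G\<^esub> A = \<zero>\<^bsub>QH_tilde G\<^esub>"
      using \<phi> by (intro bexI[of _ "hqm_class G (\<lambda>g. - 1 * \<phi> g)"])
        (auto simp: QH_tilde_add QH_tilde_zero QH_tilde_carrier)
  qed (auto simp: QH_tilde_carrier QH_tilde_zero QH_tilde_add hqm_add hqm_zero add_ac)
next
  fix a b :: real and A B
  assume "A \<in> carrier (QH_tilde G)" "B \<in> carrier (QH_tilde G)"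
  then obtain \<phi> \<psi> where \<phi>: "\<phi> \<in> hqm G" "A = hqm_class G \<phi>" and \<psi>: "\<psi> \<in> hqm G" "B = hqm_class G \<psi>"
    by (auto simp: QH_tilde_carrier)
  note s = \<phi> \<psi> QH_tilde_carrier QH_tilde_smult QH_tilde_add hqm_add hqm_scale real_ring_def
  show "a \<odot>\<^bsub>QH_tilde G\<^esub> A \<in> carrier (QH_tilde G)" by (simp add: s)
  show "(a \<oplus>\<^bsub>real_ring\<^esub> b) \<odot>\<^bsub>QH_tilde G\<^esub> A = a \<odot>\<^bsub>QH_tilde G\<^esub> A \<oplus>\<^bsub>QH_tilde G\<^esub> b \<odot>\<^bsub>QH_tilde G\<^esub> A"
    by (simp add: s distrib_right)
  show "a \<odot>\<^bsub>QH_tilde G\<^esub> (A \<oplus>\<^bsub>QH_tilde G\<^esub> B) = a \<odot>\<^bsub>QH_tilde G\<^esub> A \<oplus>\<^bsub>QH_tilde G\<^esub> a \<odot>\<^bsub>QH_tilde G\<^esub> B"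
    by (simp add: s distrib_left)
  show "(a \<otimes>\<^bsub>real_ring\<^esub> b) \<odot>\<^bsub>QH_tilde G\<^esub> A = a \<odot>\<^bsub>QH_tilde G\<^esub> (b \<odot>\<^bsub>QH_tilde G\<^esub> A)"
    by (simp add: s mult.assoc)
  show "\<one>\<^bsub>real_ring\<^esub> \<odot>\<^bsub>QH_tilde G\<^esub> A = A" by (simp add: s)
qed

end

theory Submission
  imports Defs
begin

text \<open>Choose non-adjacent \<open>a, b\<close> and let \<open>\<gamma> j\<close> be the chain of half-spaces crossed by the path
  \<open>a\<^sup>j\<^sup>+\<^sup>1 b\<close> from the identity. Hyperplanes labelled \<open>a\<close> or \<open>b\<close> never cross, so the half-spaces with
  these labels that separate two vertices form a chain. As only the last half-space of \<open>\<gamma> j\<close> has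
  label \<open>b\<close>, distinct translates of \<open>\<gamma> j\<close> between two vertices do not overlap, and \<open>c\<^sub>\<gamma>(x, y)\<close> is simply
  the number of translates between \<open>x\<close> and \<open>y\<close>. In \<open>\<omega>(x, y) + \<omega>(y, z) + \<omega>(z, x)\<close> every translate
  cancels except those having one of the three vertices strictly between their ends, and there are
  at most \<open>6 (j + 2)\<close> of these. So \<open>g \<mapsto> \<omega>(1, g)\<close> is a quasimorphism; changing the base vertex
  conjugates \<open>g\<close>, which alters it by a bounded amount only and does not affect the homogenization.
  The \<open>j\<close>-th homogenization is \<open>1\<close> on \<open>a\<^sup>k b\<close> if \<open>j < k\<close> and \<open>0\<close> otherwise. If a combination \<open>f\<close> with
  coefficients \<open>c\<^sub>j\<close> is a homomorphism, then \<open>c\<^sub>k = f(a\<^sup>k\<^sup>+\<^sup>1 b) - f(a\<^sup>k b) = f(a)\<close> for all \<open>k\<close>, and this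
  vanishes as almost all \<open>c\<^sub>k\<close> do.\<close>

section \<open>The Cayley graph\<close>

text \<open>Half-spaces are components left after deleting a class of parallel edges, so even the
  two-sidedness of a hyperplane has to be established. The geometry rests on one form of simple
  connectivity: a rule updating a state along edges, consistent under backtracking and around
  squares, defines a function of the vertex. Integer states give exponents, Boolean states the sides
  of a hyperplane, and three states show that hyperplanes with equal or non-adjacent labels never
  cross. The shape of the words has two reasons. The final \<open>b\<close> marks one end of each
  chain; in a pure power of \<open>a\<close>, shifted copies share half-spaces, and finding a
  maximal non-overlapping collection becomes a packing problem. At least one \<open>a\<close> is
  required because counting single half-spaces labelled \<open>b\<close> with sign gives the
  exponent of \<open>b\<close>, a homomorphism. Half-spaces carry signed labels that translation
  preserves. Hence inverse chains never occur along positive words, and the values on powers of the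
  test elements are plain subword counts.\<close>

locale raag_graph =
  fixes V :: "'v set" and E :: "'v set set"
  assumes simplicial: "simplicial_graph V E"
begin

abbreviation "G \<equiv> raag V E"
abbreviation "X \<equiv> raag_complex V E"
abbreviation "cls \<equiv> word_class V E"
abbreviation letters :: "('v \<times> bool) set" where "letters \<equiv> V \<times> UNIV"

sublocale group G by (rule group_raag)

text \<open>Right multiplication by a letter follows an edge of the complex, while the group acts by
  left multiplication; associativity makes the two commute (\<open>mult_step\<close>).\<close>

definition step :: "('v \<times> bool) list set \<Rightarrow> 'v \<times> bool \<Rightarrow> ('v \<times> bool) list set" (infixl "\<cdot>" 75)
  where "g \<cdot> l = g \<otimes>\<^bsub>G\<^esub> cls [l]"

definition inv_letter :: "'v \<times> bool \<Rightarrow> 'v \<times> bool" where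
  "inv_letter l = (fst l, \<not> snd l)"

lemma inv_letter_simps [simp]: "inv_letter (v, b) = (v, \<not> b)" "inv_letter (inv_letter l) = l"
  by (auto simp: inv_letter_def)

lemma inv_letter_in [simp]: "inv_letter l \<in> letters \<longleftrightarrow> l \<in> letters"
  by (cases l) auto

lemma edgeD:
  assumes "{v, w} \<in> E"
  shows "v \<in> V" "w \<in> V" "v \<noteq> w"
proof -
  obtain a b where "a \<in> V" "b \<in> V" "a \<noteq> b" "{v, w} = {a, b}"
    using simplicial assms by (auto simp: simplicial_graph_def)
  then show "v \<in> V" "w \<in> V" "v \<noteq> w" by (auto simp: doubleton_eq_iff)
qed

lemma words_Nil [simp]: "[] \<in> raag_words V"
  and words_Cons [simp]: "l # w \<in> raag_words V \<longleftrightarrow> l \<in> letters \<and> w \<in> raag_words V"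
  by (auto simp: raag_words_def)

lemma cls_closed [simp]: "w \<in> raag_words V \<Longrightarrow> cls w \<in> carrier G"
  by (simp add: raag_carrier)

lemma carrierE:
  assumes "g \<in> carrier G" obtains w where "w \<in> raag_words V" "g = cls w"
  using assms by (auto simp: raag_carrier)

lemma step_closed [simp]: "g \<in> carrier G \<Longrightarrow> l \<in> letters \<Longrightarrow> g \<cdot> l \<in> carrier G"
  unfolding step_def by (intro m_closed cls_closed) auto

lemma mult_cls_Cons:
  assumes "g \<in> carrier G" "l \<in> letters" "w \<in> raag_words V"
  shows "g \<otimes>\<^bsub>G\<^esub> cls (l # w) = (g \<cdot> l) \<otimes>\<^bsub>G\<^esub> cls w"
proof -
  have "cls (l # w) = cls [l] \<otimes>\<^bsub>G\<^esub> cls w"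
    using assms raag_mult[of "[l]" V w E] by simp
  then show ?thesis using assms by (simp add: step_def m_assoc)
qed

lemma mult_cls_Nil [simp]: "g \<in> carrier G \<Longrightarrow> g \<otimes>\<^bsub>G\<^esub> cls [] = g"
  using r_one by (simp add: raag_one)

lemma mult_step:
  "h \<in> carrier G \<Longrightarrow> g \<in> carrier G \<Longrightarrow> l \<in> letters \<Longrightarrow> h \<otimes>\<^bsub>G\<^esub> (g \<cdot> l) = (h \<otimes>\<^bsub>G\<^esub> g) \<cdot> l"
  unfolding step_def by (simp add: m_assoc)

lemma step_eq_mult_cls:
  assumes "g \<in> carrier G" "w \<in> raag_words V" "w' \<in> raag_words V" "raag_eq V E w w'"
  shows "g \<otimes>\<^bsub>G\<^esub> cls w = g \<otimes>\<^bsub>G\<^esub> cls w'"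
  using assms by (simp add: word_class_eq_iff)

lemma step_inv [simp]:
  assumes "g \<in> carrier G" "l \<in> letters"
  shows "g \<cdot> l \<cdot> inv_letter l = g"
proof -
  obtain v b where l: "l = (v, b)" by (cases l)
  have "raag_eq V E ([] @ [(v, b), (v, \<not> b)] @ []) ([] @ [])"
    using assms by (intro raag_eq.cancel) (auto simp: l)
  then show ?thesis
    using assms step_eq_mult_cls[of g "[l, inv_letter l]" "[]"]
    by (simp add: mult_cls_Cons l)
qed

lemma step_inv' [simp]:
  assumes "g \<in> carrier G" "v \<in> V"
  shows "g \<cdot> (v, b) \<cdot> (v, \<not> b) = g" "g \<cdot> (v, False) \<cdot> (v, True) = g" "g \<cdot> (v, True) \<cdot> (v, False) = g"
  using step_inv[of g "(v, b)"] step_inv[of g "(v, True)"] step_inv[of g "(v, False)"] assms by auto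

lemma step_commute_True:
  assumes g: "g \<in> carrier G" and e: "{v, w} \<in> E"
  shows "g \<cdot> (v, True) \<cdot> (w, True) = g \<cdot> (w, True) \<cdot> (v, True)"
proof -
  note V = edgeD[OF e]
  let ?h = "g \<cdot> (w, True) \<cdot> (v, True)"
  have "raag_eq V E ([] @ [(v, True), (w, True), (v, False), (w, False)] @ []) ([] @ [])"
    using V e by (intro raag_eq.commutator) auto
  then have "g \<cdot> (v, True) \<cdot> (w, True) \<cdot> (v, False) \<cdot> (w, False) = g"
    using g V step_eq_mult_cls[of g "[(v, True), (w, True), (v, False), (w, False)]" "[]"]
    by (simp add: mult_cls_Cons)
  then have "g \<cdot> (v, True) \<cdot> (w, True) \<cdot> (v, False) \<cdot> (w, False) \<cdot> (w, True) \<cdot> (v, True) = ?h" by simp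
  then show ?thesis using g V by simp
qed

lemma step_cancel:
  assumes "g \<in> carrier G" "h \<in> carrier G" "l \<in> letters" "g \<cdot> l = h \<cdot> l"
  shows "g = h"
  using assms step_inv by metis

lemma step_commute:
  assumes g: "g \<in> carrier G" and e: "{v, w} \<in> E"
  shows "g \<cdot> (v, b) \<cdot> (w, c) = g \<cdot> (w, c) \<cdot> (v, b)"
proof -
  note V = edgeD[OF e]
  \<comment> \<open>A negative letter is treated by multiplying both sides by its inverse, which
    leaves a commutation with a positive letter.\<close>
  have one: "g \<cdot> (v, b) \<cdot> (w, True) = g \<cdot> (w, True) \<cdot> (v, b)"
    if g: "g \<in> carrier G" and e: "{v, w} \<in> E" for g v w b
  proof (cases b)
    case True
    then show ?thesis using step_commute_True[OF g e] by simp
  next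
    case False
    note V = edgeD[OF e]
    have "g \<cdot> (v, False) \<cdot> (w, True) \<cdot> (v, True) = g \<cdot> (w, True) \<cdot> (v, False) \<cdot> (v, True)"
      using g V step_commute_True[OF _ e, of "g \<cdot> (v, False)"] by simp
    then show ?thesis using False g V by (rule_tac step_cancel[of _ _ "(v, True)"]) auto
  qed
  show ?thesis
  proof (cases c)
    case True
    then show ?thesis using one[OF g e] by simp
  next
    case False
    have "g \<cdot> (v, b) \<cdot> (w, False) \<cdot> (w, True) = g \<cdot> (w, False) \<cdot> (v, b) \<cdot> (w, True)"
      using g V one[OF _ e, of "g \<cdot> (w, False)" b] by simp
    then show ?thesis using False g V by (rule_tac step_cancel[of _ _ "(w, True)"]) auto
  qed
qed

lemma step_commutator:
  assumes g: "g \<in> carrier G" and e: "{v, w} \<in> E"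
  shows "g \<cdot> (v, True) \<cdot> (w, True) \<cdot> (v, False) \<cdot> (w, False) = g"
proof -
  have "g \<cdot> (v, True) \<cdot> (w, True) = g \<cdot> (w, True) \<cdot> (v, True)" using assms by (rule step_commute)
  then show ?thesis using g edgeD[OF e] by simp
qed

lemma carrier_induct [consumes 1, case_names one step]:
  assumes "g \<in> carrier G" "P \<one>\<^bsub>G\<^esub>" "\<And>g l. g \<in> carrier G \<Longrightarrow> l \<in> letters \<Longrightarrow> P g \<Longrightarrow> P (g \<cdot> l)"
  shows "P g"
proof -
  obtain w where w: "w \<in> raag_words V" "g = cls w" using assms(1) by (rule carrierE)
  have "P (cls w)" using w(1)
  proof (induction w rule: rev_induct)
    case Nil
    then show ?case using assms(2) by (simp add: raag_one)
  next
    case (snoc l w)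
    then have "w \<in> raag_words V" "l \<in> letters" by (auto simp: raag_words_def)
    moreover have "cls (w @ [l]) = cls w \<cdot> l"
      using \<open>w \<in> raag_words V\<close> \<open>l \<in> letters\<close> by (simp add: step_def raag_mult)
    ultimately show ?case using snoc.IH assms(3) by simp
  qed
  then show ?thesis by (simp add: w(2))
qed

text \<open>A rule for updating a state along edges defines a function of the vertex once it is
  consistent on the two defining families of relations, as the complex is simply connected.\<close>

lemma lift_state:
  fixes t :: "('v \<times> bool) list set \<Rightarrow> 'v \<times> bool \<Rightarrow> 's \<Rightarrow> 's"
  assumes inv: "\<And>g l s. g \<in> carrier G \<Longrightarrow> l \<in> letters \<Longrightarrow> t (g \<cdot> l) (inv_letter l) (t g l s) = s"
    and comm: "\<And>g v w s. g \<in> carrier G \<Longrightarrow> {v, w} \<in> E \<Longrightarrow>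
      t (g \<cdot> (v, True)) (w, True) (t g (v, True) s) = t (g \<cdot> (w, True)) (v, True) (t g (w, True) s)"
  obtains S where "S \<one>\<^bsub>G\<^esub> = s\<^sub>0" "\<And>g l. g \<in> carrier G \<Longrightarrow> l \<in> letters \<Longrightarrow> S (g \<cdot> l) = t g l (S g)"
proof -
  \<comment> \<open>The rule \<open>t\<close> may depend on the current vertex, so reading a word
    carries the vertex along with the state.\<close>
  define run where "run = rec_list (\<lambda>g s. s) (\<lambda>l _ r g s. r (g \<cdot> l) (t g l s))"
  have run_simps [simp]: "run [] g s = s" "run (l # w) g s = run w (g \<cdot> l) (t g l s)" for l w g s
    by (simp_all add: run_def)
  have run_append: "run (x @ y) g s = run y (g \<otimes>\<^bsub>G\<^esub> cls x) (run x g s)"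
    if "x \<in> raag_words V" "g \<in> carrier G" for x y g s
    using that by (induction x arbitrary: g s) (auto simp: mult_cls_Cons)
  have run_cong: "run x g s = run y g s" if "raag_eq V E x y" "g \<in> carrier G" for x y g s
    using that
  proof (induction arbitrary: g s rule: raag_eq.induct)
    case (cancel x y v b)
    have "t (g \<cdot> (v, b)) (v, \<not> b) (t g (v, b) s) = s" if "g \<in> carrier G" for g s
      using inv[of g "(v, b)" s] cancel that by simp
    then show ?case using cancel by (simp add: run_append)
  next
    case (commutator x y v w)
    have "t (g \<cdot> (v, True) \<cdot> (w, True) \<cdot> (v, False)) (w, False)
        (t (g \<cdot> (v, True) \<cdot> (w, True)) (v, False) (t (g \<cdot> (v, True)) (w, True) (t g (v, True) s))) = s"
      if g: "g \<in> carrier G" for g s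
    proof -
      have V: "v \<in> V" "w \<in> V" using commutator by simp_all
      \<comment> \<open>\<open>comm\<close> exchanges the first two moves; the two inverse letters
        then undo them from the inside out.\<close>
      have e: "g \<cdot> (v, True) \<cdot> (w, True) = g \<cdot> (w, True) \<cdot> (v, True)"
        using g \<open>{v, w} \<in> E\<close> by (rule step_commute)
      have i1: "t (g \<cdot> (w, True) \<cdot> (v, True)) (v, False) (t (g \<cdot> (w, True)) (v, True) (t g (w, True) s)) = t g (w, True) s"
        using inv[of "g \<cdot> (w, True)" "(v, True)" "t g (w, True) s"] V g by simp
      have i2: "t (g \<cdot> (w, True)) (w, False) (t g (w, True) s) = s"
        using inv[of "g" "(w, True)" s] V g by simp
      show ?thesis
        unfolding comm[OF g \<open>{v, w} \<in> E\<close>] e i1 using i2 g V by simp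
    qed
    then show ?case using commutator
      by (simp add: run_append step_commutator)
  qed auto
  \<comment> \<open>Any word for \<open>g\<close> will do: by \<open>run_cong\<close> the result
    depends only on its class.\<close>
  define S where "S g = run (SOME w. w \<in> raag_words V \<and> cls w = g) \<one>\<^bsub>G\<^esub> s\<^sub>0" for g
  have S: "S (cls w) = run w \<one>\<^bsub>G\<^esub> s\<^sub>0" if w: "w \<in> raag_words V" for w
  proof -
    define w' where "w' = (SOME w'. w' \<in> raag_words V \<and> cls w' = cls w)"
    have "w' \<in> raag_words V \<and> cls w' = cls w"
      unfolding w'_def by (rule someI[where x = w]) (simp add: w)
    then have "raag_eq V E w' w" using w word_class_eq_iff[of w' V w E] by blast
    then have "run w' \<one>\<^bsub>G\<^esub> s\<^sub>0 = run w \<one>\<^bsub>G\<^esub> s\<^sub>0" by (rule run_cong) simp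
    then show ?thesis by (simp add: S_def w'_def)
  qed
  show ?thesis
  proof
    show "S \<one>\<^bsub>G\<^esub> = s\<^sub>0" using S[of "[]"] by (simp add: raag_one)
    show "S (g \<cdot> l) = t g l (S g)" if g: "g \<in> carrier G" and l: "l \<in> letters" for g l
    proof -
      obtain w where w: "w \<in> raag_words V" "g = cls w" using g by (rule carrierE)
      have "g \<cdot> l = cls (w @ [l])" using w l by (simp add: step_def raag_mult)
      moreover have "w @ [l] \<in> raag_words V" using w l by (simp add: raag_words_append)
      ultimately have "S (g \<cdot> l) = run (w @ [l]) \<one>\<^bsub>G\<^esub> s\<^sub>0" using S by simp
      also have "\<dots> = t (\<one>\<^bsub>G\<^esub> \<otimes>\<^bsub>G\<^esub> g) l (S g)" using w S by (simp add: run_append)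
      finally show ?thesis using g by simp
    qed
  qed
qed

text \<open>The exponent sum of the letters from \<open>A\<close>, fixed only up to an additive
  constant, since only differences matter. Singletons tell labels apart; \<open>UNIV\<close> gives a
  height function on the vertices.\<close>

definition expo :: "'v set \<Rightarrow> ('v \<times> bool) list set \<Rightarrow> int" where
  "expo A = (SOME f. \<forall>g\<in>carrier G. \<forall>v\<in>V. \<forall>b.
     f (g \<cdot> (v, b)) = f g + (if v \<in> A then (if b then 1 else - 1) else 0))"

lemma expo_step:
  assumes "g \<in> carrier G" "v \<in> V"
  shows "expo A (g \<cdot> (v, b)) = expo A g + (if v \<in> A then (if b then 1 else - 1) else 0)"
proof -
  let ?t = "\<lambda>(g :: ('v \<times> bool) list set) (l :: 'v \<times> bool) s :: int. s + (if fst l \<in> A then (if snd l then 1 else - 1) else 0)"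
  obtain S where "\<And>g l. g \<in> carrier G \<Longrightarrow> l \<in> letters \<Longrightarrow> S (g \<cdot> l) = ?t g l (S g)"
    by (rule lift_state[where t = ?t]) (auto simp: inv_letter_def)
  then have "\<exists>f :: _ \<Rightarrow> int. \<forall>g\<in>carrier G. \<forall>v\<in>V. \<forall>b.
      f (g \<cdot> (v, b)) = f g + (if v \<in> A then (if b then 1 else - 1) else 0)"
    by (intro exI[of _ S]) simp
  then have "\<forall>g\<in>carrier G. \<forall>v\<in>V. \<forall>b.
      expo A (g \<cdot> (v, b)) = expo A g + (if v \<in> A then (if b then 1 else - 1) else 0)"
    unfolding expo_def by (rule someI_ex)
  then show ?thesis using assms by blast
qed

lemma step_eq_iff:
  assumes "g \<in> carrier G" "v \<in> V" "w \<in> V"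
  shows "g \<cdot> (v, b) = g \<cdot> (w, c) \<longleftrightarrow> v = w \<and> b = c"
proof
  assume "g \<cdot> (v, b) = g \<cdot> (w, c)"
  then have "expo {v} (g \<cdot> (v, b)) = expo {v} (g \<cdot> (w, c))" by simp
  then show "v = w \<and> b = c" using assms by (auto simp: expo_step split: if_splits)
qed simp

lemma step_neq [simp]: "g \<in> carrier G \<Longrightarrow> l \<in> letters \<Longrightarrow> g \<cdot> l \<noteq> g"
  using expo_step[of g "fst l" UNIV "snd l"] by (cases l) (auto split: if_splits)

text \<open>The height \<open>expo UNIV\<close> rises by one along a positive letter, so an
  unordered edge knows its lower end and therefore its label.\<close>

lemma edge_eqD:
  assumes "g \<in> carrier G" "h \<in> carrier G" "v \<in> V" "w \<in> V"
    and eq: "{g, g \<cdot> (v, True)} = {h, h \<cdot> (w, True)}"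
  shows "g = h" "v = w"
proof -
  have "g = h"
  proof (rule ccontr)
    assume "g \<noteq> h"
    then have "g = h \<cdot> (w, True)" "g \<cdot> (v, True) = h" using eq by (auto simp: doubleton_eq_iff)
    then have "expo UNIV h = expo UNIV h + 1 + 1"
      using expo_step[of h w UNIV True] expo_step[of g v UNIV True] assms by simp
    then show False by simp
  qed
  then show "g = h" "v = w"
    using eq assms step_eq_iff[of g v w True True] step_neq[of h "(w, True)"]
    by (auto simp: doubleton_eq_iff)
qed

section \<open>Cubes and squares\<close>

abbreviation pos_word :: "'v list \<Rightarrow> ('v \<times> bool) list" where
  "pos_word \<equiv> map (\<lambda>v. (v, True))"

lemma expo_pos_word:
  assumes "g \<in> carrier G" "set vs \<subseteq> V"
  shows "expo A (g \<otimes>\<^bsub>G\<^esub> cls (pos_word vs)) = expo A g + int (length (filter (\<lambda>v. v \<in> A) vs))"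
  using assms
proof (induction vs arbitrary: g)
  case (Cons v vs)
  then have "pos_word vs \<in> raag_words V" by (auto simp: raag_words_def)
  then show ?case using Cons by (simp add: mult_cls_Cons expo_step)
qed simp

lemma cube_subset_carrier:
  assumes "g \<in> carrier G" "K \<subseteq> V"
  shows "raag_cube V E g K \<subseteq> carrier G"
proof
  fix x assume "x \<in> raag_cube V E g K"
  then obtain vs where "x = g \<otimes>\<^bsub>G\<^esub> cls (pos_word vs)" "set vs \<subseteq> K"
    by (auto simp: raag_cube_def)
  moreover have "pos_word vs \<in> raag_words V" using calculation assms by (auto simp: raag_words_def)
  ultimately show "x \<in> carrier G" using assms by simp
qed

text \<open>The exponents of the letters recover the subset of \<open>K\<close> that a vertex of the cube comes from.\<close>

lemma card_cube:
  assumes "g \<in> carrier G" "K \<subseteq> V" "finite K" "finite (raag_cube V E g K)"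
  shows "2 ^ card K \<le> card (raag_cube V E g K)"
proof -
  let ?F = "\<lambda>x. {v \<in> K. expo {v} x \<noteq> expo {v} g}"
  have "Pow K \<subseteq> ?F ` raag_cube V E g K"
  proof
    fix Q assume "Q \<in> Pow K"
    then have "finite Q" "Q \<subseteq> K" using assms finite_subset by auto
    then obtain vs where vs: "set vs = Q" "distinct vs" using finite_distinct_list by blast
    let ?x = "g \<otimes>\<^bsub>G\<^esub> cls (pos_word vs)"
    have "?x \<in> raag_cube V E g K" using vs \<open>Q \<subseteq> K\<close> by (auto simp: raag_cube_def)
    moreover have "?F ?x = Q"
      using vs \<open>Q \<subseteq> K\<close> assms by (auto simp: expo_pos_word filter_empty_conv)
    ultimately show "Q \<in> ?F ` raag_cube V E g K" by (intro image_eqI[of _ _ ?x]) auto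
  qed
  then have "card (Pow K) \<le> card (raag_cube V E g K)" using assms by (rule_tac surj_card_le)
  then show ?thesis using assms by (simp add: card_Pow)
qed

lemma cube_empty: "g \<in> carrier G \<Longrightarrow> raag_cube V E g {} = {g}"
  by (auto simp: raag_cube_def)

lemma cube_single:
  assumes "g \<in> carrier G" "v \<in> V"
  shows "raag_cube V E g {v} = {g, g \<cdot> (v, True)}"
proof -
  have *: "distinct vs \<and> set vs \<subseteq> {v} \<longleftrightarrow> vs = [] \<or> vs = [v]" for vs
    by (cases vs; cases "tl vs") auto
  have "raag_cube V E g {v} = (\<lambda>vs. g \<otimes>\<^bsub>G\<^esub> cls (pos_word vs)) ` {vs. distinct vs \<and> set vs \<subseteq> {v}}"
    unfolding raag_cube_def by blast
  also have "{vs. distinct vs \<and> set vs \<subseteq> {v}} = {[], [v]}" using * by blast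
  finally show ?thesis using assms by (simp add: step_def)
qed

lemma distinct_pair_cases:
  assumes "v \<noteq> w"
  shows "distinct vs \<and> set vs \<subseteq> {v, w} \<longleftrightarrow> vs \<in> {[], [v], [w], [v, w], [w, v]}"
proof
  assume *: "distinct vs \<and> set vs \<subseteq> {v, w}"
  then have "length vs \<le> card {v, w}" by (metis card_mono distinct_card finite.emptyI finite.insertI)
  then have "length vs \<le> 2" using assms by simp
  then consider "vs = []" | a where "vs = [a]" | a b where "vs = [a, b]"
    by (cases vs; cases "tl vs"; cases "tl (tl vs)") auto
  then show "vs \<in> {[], [v], [w], [v, w], [w, v]}" using * by cases auto
qed (use assms in auto)

lemma cube_pair:
  assumes "g \<in> carrier G" "{v, w} \<in> E"
  shows "raag_cube V E g {v, w} = {g, g \<cdot> (v, True), g \<cdot> (w, True), g \<cdot> (v, True) \<cdot> (w, True)}"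
proof -
  note V = edgeD[OF assms(2)]
  have "raag_cube V E g {v, w} = (\<lambda>vs. g \<otimes>\<^bsub>G\<^esub> cls (pos_word vs)) ` {vs. distinct vs \<and> set vs \<subseteq> {v, w}}"
    unfolding raag_cube_def by blast
  also have "{vs. distinct vs \<and> set vs \<subseteq> {v, w}} = {[], [v], [w], [v, w], [w, v]}"
    by (simp only: distinct_pair_cases[OF V(3)] Collect_mem_eq)
  finally show ?thesis
    using assms V step_commute[OF assms, of True True] by (simp add: mult_cls_Cons)
qed

lemma clique_subset: "clique V E K \<Longrightarrow> K \<subseteq> V" "clique V E K \<Longrightarrow> finite K"
  by (auto simp: clique_def)

lemma verts_eq: "verts X = carrier G"
proof
  show "verts X \<subseteq> carrier G"
    using cube_subset_carrier clique_subset unfolding verts_def raag_complex_def by blast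
  show "carrier G \<subseteq> verts X"
  proof
    fix g assume "g \<in> carrier G"
    moreover have "clique V E {}" by (simp add: clique_def)
    ultimately have "{g} \<in> X" unfolding raag_complex_def using cube_empty by blast
    then show "g \<in> verts X" by (auto simp: verts_def)
  qed
qed

lemma edgeI: "g \<in> carrier G \<Longrightarrow> l \<in> letters \<Longrightarrow> {g, g \<cdot> l} \<in> edges X"
proof -
  have *: "{g, g \<cdot> (v, True)} \<in> edges X" if "g \<in> carrier G" "v \<in> V" for g v
  proof -
    have "clique V E {v}" using that by (auto simp: clique_def)
    then have "{g, g \<cdot> (v, True)} \<in> X" unfolding raag_complex_def using cube_single that by blast
    then show ?thesis using that step_neq[of g "(v, True)", symmetric] by (simp add: edges_def card_insert_if)
  qed
  assume g: "g \<in> carrier G" and l: "l \<in> letters"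
  obtain v b where [simp]: "l = (v, b)" by (cases l)
  show ?thesis
  proof (cases b)
    case False
    then show ?thesis using *[of "g \<cdot> l" v] g l by (simp add: insert_commute)
  qed (use * g l in auto)
qed

text \<open>Cubes are known only through their vertex sets. Since a cube over \<open>K\<close> has
  at least \<open>2 ^ card K\<close> vertices, its cardinality bounds the size of \<open>K\<close>;
  the same argument identifies squares.\<close>

lemma edgeE:
  assumes "e \<in> edges X"
  obtains g v where "g \<in> carrier G" "v \<in> V" "e = {g, g \<cdot> (v, True)}"
proof -
  obtain g K where g: "g \<in> carrier G" and K: "clique V E K" and e: "e = raag_cube V E g K" and c: "card e = 2"
    using assms by (auto simp: edges_def raag_complex_def)
  have "finite e" using c card_ge_0_finite[of e] by simp
  then have "2 ^ card K \<le> (2 :: nat)" using card_cube[of g K] clique_subset[OF K] g e c by simp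
  then have "card K \<le> 1" using power_increasing_iff[of "2::nat" "card K" 1] by simp
  moreover have "K \<noteq> {}" using c g cube_empty by (auto simp: e)
  ultimately have "card K = 1" using clique_subset(2)[OF K] by (simp add: le_Suc_eq)
  then obtain v where "K = {v}" by (rule card_1_singletonE)
  then show ?thesis using that[of g v] g clique_subset[OF K] cube_single e by auto
qed

lemma squareE:
  assumes "s \<in> X" "card s = 4"
  obtains g v w where "g \<in> carrier G" "{v, w} \<in> E"
    "s = {g, g \<cdot> (v, True), g \<cdot> (w, True), g \<cdot> (v, True) \<cdot> (w, True)}"
proof -
  obtain g K where g: "g \<in> carrier G" and K: "clique V E K" and e: "s = raag_cube V E g K"
    using assms by (auto simp: raag_complex_def)
  have "finite s" using assms card_ge_0_finite[of s] by simp
  then have "2 ^ card K \<le> (2 ^ 2 :: nat)" using card_cube[of g K] clique_subset[OF K] g e assms by simp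
  then have "card K \<le> 2" using power_increasing_iff[of "2::nat" "card K" 2] by simp
  moreover have "card K \<noteq> 0"
    using assms(2) clique_subset[OF K] g cube_empty e by auto
  moreover have "card K \<noteq> 1"
  proof
    assume "card K = 1"
    then obtain v where "K = {v}" by (auto simp: card_1_singleton_iff)
    then have "s = {g, g \<cdot> (v, True)}" using cube_single clique_subset[OF K] g e by auto
    then show False using assms(2) card_insert_le_m1[of 2 "{g \<cdot> (v, True)}" g] by simp
  qed
  ultimately have "card K = 2" by linarith
  then obtain v w where "K = {v, w}" "v \<noteq> w" by (auto simp: card_2_iff)
  then have "{v, w} \<in> E" using K by (auto simp: clique_def)
  then show ?thesis using that[of g v w] g cube_pair e \<open>K = {v, w}\<close> by auto
qed

lemma adjacency_iff: "(x, y) \<in> adjacency X \<longleftrightarrow> x \<in> carrier G \<and> (\<exists>l\<in>letters. y = x \<cdot> l)"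
proof
  assume "(x, y) \<in> adjacency X"
  then have "x \<noteq> y" "{x, y} \<in> edges X" by (auto simp: adjacency_def)
  then obtain g v where g: "g \<in> carrier G" "v \<in> V" "{x, y} = {g, g \<cdot> (v, True)}" using edgeE by metis
  then consider "x = g" "y = g \<cdot> (v, True)" | "x = g \<cdot> (v, True)" "y = g" by (auto simp: doubleton_eq_iff)
  then show "x \<in> carrier G \<and> (\<exists>l\<in>letters. y = x \<cdot> l)"
  proof cases
    case 1
    then show ?thesis using g by auto
  next
    case 2
    then have "y = x \<cdot> (v, False)" using g by simp
    then show ?thesis using 2 g by (intro conjI bexI[of _ "(v, False)"]) simp_all
  qed
next
  assume "x \<in> carrier G \<and> (\<exists>l\<in>letters. y = x \<cdot> l)"
  then obtain l where l: "x \<in> carrier G" "l \<in> letters" "y = x \<cdot> l" by blast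
  then show "(x, y) \<in> adjacency X" using edgeI step_neq[OF l(1,2), symmetric] by (simp add: adjacency_def)
qed

lemma oppositeI:
  assumes g: "g \<in> carrier G" and e: "{v, w} \<in> E"
  shows "({g, g \<cdot> (v, b)}, {g \<cdot> (w, c), g \<cdot> (w, c) \<cdot> (v, b)}) \<in> opposite X"
proof -
  note V = edgeD[OF e]
  note [simp] = expo_step g V V(3)[symmetric]
  have sq: "{h, h \<cdot> (v, True), h \<cdot> (w, True), h \<cdot> (w, True) \<cdot> (v, True)} \<in> X" if "h \<in> carrier G" for h
  proof -
    have "clique V E {v, w}" using e V by (auto simp: clique_def insert_commute)
    then have "raag_cube V E h {v, w} \<in> X" unfolding raag_complex_def using that by blast
    then show ?thesis using cube_pair[OF that e] step_commute[OF that e, of True True] by simp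
  qed
  have "{g, g \<cdot> (v, b)} \<inter> {g \<cdot> (w, c), g \<cdot> (w, c) \<cdot> (v, b)} = {}"
  proof -
    have "expo {w} x \<noteq> expo {w} y" if "x \<in> {g, g \<cdot> (v, b)}" "y \<in> {g \<cdot> (w, c), g \<cdot> (w, c) \<cdot> (v, b)}" for x y
      using that by (auto split: if_splits)
    then show ?thesis by blast
  qed
  moreover have "{g, g \<cdot> (v, b)} \<union> {g \<cdot> (w, c), g \<cdot> (w, c) \<cdot> (v, b)} \<in> X"
  proof -
    have c: "g \<cdot> (v, False) \<cdot> (w, x) = g \<cdot> (w, x) \<cdot> (v, False)" for x by (rule step_commute[OF g e])
    \<comment> \<open>\<open>h\<close> is the lowest corner of the square, reached from
      \<open>g\<close> by following exactly those of the two letters that are negative.\<close>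
    have "\<exists>h\<in>carrier G. {g, g \<cdot> (v, b)} \<union> {g \<cdot> (w, c), g \<cdot> (w, c) \<cdot> (v, b)} =
        {h, h \<cdot> (v, True), h \<cdot> (w, True), h \<cdot> (w, True) \<cdot> (v, True)}"
    proof (cases b; cases c)
      assume "b" "c"
      then show ?thesis by (intro bexI[of _ g]) (simp_all add: insert_commute)
    next
      assume "b" "\<not> c"
      then show ?thesis by (intro bexI[of _ "g \<cdot> (w, False)"]) (simp_all add: insert_commute)
    next
      assume "\<not> b" "c"
      then show ?thesis by (intro bexI[of _ "g \<cdot> (v, False)"]) (simp_all add: insert_commute c)
    next
      assume "\<not> b" "\<not> c"
      moreover have "g \<cdot> (w, False) \<cdot> (v, False) \<cdot> (w, True) = g \<cdot> (v, False)"
        by (simp flip: c)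
      ultimately show ?thesis by (intro bexI[of _ "g \<cdot> (w, False) \<cdot> (v, False)"]) (simp_all add: insert_commute)
    qed
    then obtain h where h: "h \<in> carrier G" and eq: "{g, g \<cdot> (v, b)} \<union> {g \<cdot> (w, c), g \<cdot> (w, c) \<cdot> (v, b)} =
        {h, h \<cdot> (v, True), h \<cdot> (w, True), h \<cdot> (w, True) \<cdot> (v, True)}" by blast
    show ?thesis unfolding eq by (rule sq[OF h])
  qed
  moreover have "{g, g \<cdot> (v, b)} \<in> edges X" "{g \<cdot> (w, c), g \<cdot> (w, c) \<cdot> (v, b)} \<in> edges X"
    by (simp_all add: edgeI)
  ultimately show ?thesis unfolding opposite_def by (intro CollectI case_prodI conjI)
qed

text \<open>The first edge can be read upwards from its lower end, but the second may lie on either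
  side of it, which is why \<open>w\<close> keeps a sign \<open>c\<close>.\<close>

lemma oppositeD:
  assumes "(e, f) \<in> opposite X"
  obtains g v w c where "g \<in> carrier G" "{v, w} \<in> E" "e = {g, g \<cdot> (v, True)}"
    "f = {g \<cdot> (w, c), g \<cdot> (w, c) \<cdot> (v, True)}"
proof -
  have e: "e \<in> edges X" and f: "f \<in> edges X" and d: "e \<inter> f = {}" and u: "e \<union> f \<in> X"
    using assms by (auto simp: opposite_def)
  have "card e = 2" "card f = 2" using e f by (auto simp: edges_def)
  then have "finite e" "finite f" using card_ge_0_finite[of e] card_ge_0_finite[of f] by simp_all
  then have "card (e \<union> f) = 4" using \<open>card e = 2\<close> \<open>card f = 2\<close> card_Un_disjoint d by fastforce
  then obtain g v w where g: "g \<in> carrier G" and vw: "{v, w} \<in> E"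
    and s: "e \<union> f = {g, g \<cdot> (v, True), g \<cdot> (w, True), g \<cdot> (v, True) \<cdot> (w, True)}" using u by (metis squareE)
  note V = edgeD[OF vw]
  have wv: "{w, v} \<in> E" using vw by (simp add: insert_commute)
  define p q r t where "p = g" and "q = g \<cdot> (v, True)" and "r = g \<cdot> (w, True)"
    and "t = g \<cdot> (v, True) \<cdot> (w, True)"
  note pqrt = p_def q_def r_def t_def
  have "expo UNIV q = expo UNIV p + 1" "expo UNIV r = expo UNIV p + 1"
    "expo UNIV t = expo UNIV p + 2" "expo {v} q \<noteq> expo {v} r"
    using g V by (auto simp: expo_step pqrt)
  note lev = this
  then have dist: "p \<noteq> q" "p \<noteq> r" "p \<noteq> t" "q \<noteq> r" "q \<noteq> t" "r \<noteq> t" by auto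
  have f_eq: "f = {p, q, r, t} - e" using d s unfolding pqrt by blast
  obtain x z where x: "x \<in> carrier G" "z \<in> V" "e = {x, x \<cdot> (z, True)}" using e by (rule edgeE)
  define y where "y = x \<cdot> (z, True)"
  have "x \<in> {p, q, r, t}" "y \<in> {p, q, r, t}" using x s unfolding pqrt y_def by auto
  moreover have "expo UNIV y = expo UNIV x + 1" using x by (simp add: expo_step y_def)
  \<comment> \<open>The heights of \<open>p\<close>, \<open>q\<close>, \<open>r\<close>,
    \<open>t\<close> are 0, 1, 1, 2 relative to \<open>p\<close>. An edge raises the height by one,
    so neither diagonal is possible.\<close>
  ultimately consider "x = p" "y = q" | "x = p" "y = r" | "x = q" "y = t" | "x = r" "y = t"
    using lev by (elim insertE emptyE) auto
  then show ?thesis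
  proof cases
    case 1
    then have e: "e = {g, g \<cdot> (v, True)}" using x by (simp add: y_def pqrt)
    have "e = {p, q}" by (simp add: e pqrt)
    then have "f = {r, t}" using dist f_eq by auto
    then have "f = {g \<cdot> (w, True), g \<cdot> (w, True) \<cdot> (v, True)}"
      by (simp add: pqrt step_commute[OF g vw])
    then show ?thesis using that[OF g vw e] by blast
  next
    case 2
    then have e: "e = {g, g \<cdot> (w, True)}" using x by (simp add: y_def pqrt)
    have "e = {p, r}" by (simp add: e pqrt)
    then have "f = {q, t}" using dist f_eq by auto
    then have "f = {g \<cdot> (v, True), g \<cdot> (v, True) \<cdot> (w, True)}" by (simp add: pqrt)
    then show ?thesis using that[OF g wv e] by blast
  next
    case 3
    then have e: "e = {g \<cdot> (v, True), g \<cdot> (v, True) \<cdot> (w, True)}" using x by (simp add: y_def pqrt)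
    have "e = {q, t}" by (simp add: e pqrt)
    then have "f = {p, r}" using dist f_eq by auto
    then have "f = {g, g \<cdot> (w, True)}" by (simp add: pqrt)
    then show ?thesis using that[OF _ wv e, of False] g V by simp
  next
    case 4
    then have e: "e = {g \<cdot> (w, True), g \<cdot> (w, True) \<cdot> (v, True)}"
      using x by (simp add: y_def pqrt step_commute[OF g vw])
    have "e = {r, t}" by (simp add: e pqrt step_commute[OF g vw])
    then have "f = {p, q}" using dist f_eq by auto
    then have "f = {g, g \<cdot> (v, True)}" by (simp add: pqrt)
    then show ?thesis using that[OF _ vw e, of False] g V by simp
  qed
qed

section \<open>Hyperplanes and half-spaces\<close>

definition hyp :: "('v \<times> bool) list set set \<Rightarrow> ('v \<times> bool) list set set set" where
  "hyp e = (opposite X)\<^sup>* `` {e}"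

definition avoiding :: "('v \<times> bool) list set set set \<Rightarrow> (('v \<times> bool) list set \<times> ('v \<times> bool) list set) set" where
  "avoiding h = {(u, w) \<in> adjacency X. {u, w} \<notin> h}"

definition component :: "('v \<times> bool) list set set set \<Rightarrow> ('v \<times> bool) list set \<Rightarrow> ('v \<times> bool) list set set" where
  "component h x = {y. (x, y) \<in> (avoiding h)\<^sup>*}"

text \<open>The half-space entered by crossing the edge from \<open>g\<close> along
  \<open>l\<close>. All half-spaces arise this way, and \<open>l\<close> serves as a signed label of
  the half-space.\<close>

definition half :: "('v \<times> bool) list set \<Rightarrow> 'v \<times> bool \<Rightarrow> ('v \<times> bool) list set set" where
  "half g l = component (hyp {g, g \<cdot> l}) (g \<cdot> l)"

lemma sym_opposite: "sym (opposite X)"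
  by (auto simp: opposite_def sym_def Int_commute Un_commute)

lemma hyp_self [simp]: "e \<in> hyp e"
  by (simp add: hyp_def)

lemma hyp_eq:
  assumes "f \<in> hyp e"
  shows "hyp f = hyp e"
proof -
  have "(e, f) \<in> (opposite X)\<^sup>*" using assms by (simp add: hyp_def)
  moreover from this have "(f, e) \<in> (opposite X)\<^sup>*" by (rule symD[OF sym_rtrancl[OF sym_opposite]])
  ultimately show ?thesis unfolding hyp_def by (auto intro: rtrancl_trans)
qed

lemma opposite_hyp:
  assumes "(e, f) \<in> opposite X"
  shows "e \<in> hyp d \<longleftrightarrow> f \<in> hyp d"
proof -
  have "(f, e) \<in> opposite X" using assms sym_opposite by (rule_tac symD)
  then show ?thesis using assms unfolding hyp_def by (auto intro: rtrancl_into_rtrancl)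
qed

lemma hyp_label:
  assumes "g \<in> carrier G" "v \<in> V" "f \<in> hyp {g, g \<cdot> (v, True)}"
  shows "\<exists>k\<in>carrier G. f = {k, k \<cdot> (v, True)}"
proof -
  have "({g, g \<cdot> (v, True)}, f) \<in> (opposite X)\<^sup>*" using assms by (simp add: hyp_def)
  then show ?thesis
  proof (induction rule: rtrancl_induct)
    case (step e f)
    then obtain k where k: "k \<in> carrier G" "e = {k, k \<cdot> (v, True)}" by blast
    obtain g' v' w c where *: "g' \<in> carrier G" "{v', w} \<in> E" "e = {g', g' \<cdot> (v', True)}"
      "f = {g' \<cdot> (w, c), g' \<cdot> (w, c) \<cdot> (v', True)}" using step.hyps(2) by (rule oppositeD)
    have "v' = v" using edge_eqD[of g' k v' v] * k assms edgeD[OF *(2)] by simp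
    then show ?case using * edgeD[OF *(2)] by (intro bexI[of _ "g' \<cdot> (w, c)"]) simp_all
  qed (use assms in blast)
qed

lemma edge_in_hyp_label:
  assumes "g \<in> carrier G" "v \<in> V" "x \<in> carrier G" "w \<in> V"
    and "{x, x \<cdot> (w, c)} \<in> hyp {g, g \<cdot> (v, True)}"
  shows "w = v"
proof -
  obtain k where k: "k \<in> carrier G" "{x, x \<cdot> (w, c)} = {k, k \<cdot> (v, True)}"
    using hyp_label[OF assms(1,2,5)] by blast
  show ?thesis
  proof (cases c)
    case True
    then show ?thesis using edge_eqD[of x k w v] k assms by simp
  next
    case False
    then have "{x \<cdot> (w, c), x \<cdot> (w, c) \<cdot> (w, True)} = {k, k \<cdot> (v, True)}"
      using k assms by (simp add: insert_commute)
    then show ?thesis using edge_eqD[of "x \<cdot> (w, c)" k w v] k assms by simp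
  qed
qed

lemma avoiding_step:
  assumes "x \<in> carrier G" "l \<in> letters" "{x, x \<cdot> l} \<notin> h"
  shows "(x, x \<cdot> l) \<in> avoiding h"
  using assms by (auto simp: avoiding_def adjacency_iff)

lemma sym_avoiding: "sym (avoiding h)"
  by (auto simp: avoiding_def sym_def adjacency_def insert_commute)

text \<open>Moving a dual edge across a square carries lower end to lower end and upper end to upper
  end along edges with another label \<open>w\<close>. All edges of \<open>h\<close> are labelled
  \<open>v\<close>, so these moves avoid \<open>h\<close>.\<close>

lemma hyp_ends_connected:
  assumes g: "g \<in> carrier G" and v: "v \<in> V" and h: "h = hyp {g, g \<cdot> (v, True)}" and "f \<in> h"
  shows "\<exists>k\<in>carrier G. f = {k, k \<cdot> (v, True)} \<and>
    (g, k) \<in> (avoiding h)\<^sup>* \<and> (g \<cdot> (v, True), k \<cdot> (v, True)) \<in> (avoiding h)\<^sup>*"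
proof -
  have "({g, g \<cdot> (v, True)}, f) \<in> (opposite X)\<^sup>*" using assms by (simp add: hyp_def)
  then show ?thesis
  proof (induction rule: rtrancl_induct)
    case (step e f)
    then obtain k where k: "k \<in> carrier G" "e = {k, k \<cdot> (v, True)}"
      "(g, k) \<in> (avoiding h)\<^sup>*" "(g \<cdot> (v, True), k \<cdot> (v, True)) \<in> (avoiding h)\<^sup>*" by blast
    obtain g' v' w c where *: "g' \<in> carrier G" "{v', w} \<in> E" "e = {g', g' \<cdot> (v', True)}"
      "f = {g' \<cdot> (w, c), g' \<cdot> (w, c) \<cdot> (v', True)}" using step.hyps(2) by (rule oppositeD)
    note V = edgeD[OF *(2)]
    have [simp]: "v' = v" "g' = k" using edge_eqD[of g' k v' v] * k v V by simp_all
    have w: "{x, x \<cdot> (w, c)} \<notin> h" if "x \<in> carrier G" for x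
      using edge_in_hyp_label[OF g v that V(2)] V(3) by (auto simp: h)
    have "(k, k \<cdot> (w, c)) \<in> avoiding h"
      using w k V by (intro avoiding_step) simp_all
    moreover have "(k \<cdot> (v, True), k \<cdot> (w, c) \<cdot> (v, True)) \<in> avoiding h"
      using avoiding_step[of "k \<cdot> (v, True)" "(w, c)" h] w[of "k \<cdot> (v, True)"] k V v
        step_commute[OF k(1), of v w True c] * by simp
    ultimately show ?case
      using k * V by (intro bexI[of _ "k \<cdot> (w, c)"]) (simp_all add: rtrancl_into_rtrancl)
  qed (use assms in blast)
qed

text \<open>The colour records the parity of crossings of \<open>h\<close>. It is well defined
  because opposite edges of a square are either both dual to \<open>h\<close> or both not.\<close>

lemma lift_hyp:
  assumes "h = hyp d"
  obtains col where "\<And>x l. x \<in> carrier G \<Longrightarrow> l \<in> letters \<Longrightarrow> col (x \<cdot> l) = (col x \<noteq> ({x, x \<cdot> l} \<in> h))"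
proof -
  note result = that
  show ?thesis
  proof (rule lift_state[where t = "\<lambda>g l s. s \<noteq> ({g, g \<cdot> l} \<in> h)" and s\<^sub>0 = True])
    show thesis if "\<And>g l. g \<in> carrier G \<Longrightarrow> l \<in> letters \<Longrightarrow> S (g \<cdot> l) = (S g \<noteq> ({g, g \<cdot> l} \<in> h))" for S
      using that by (rule result)
    show "((s \<noteq> ({g, g \<cdot> l} \<in> h)) \<noteq> ({g \<cdot> l, g \<cdot> l \<cdot> inv_letter l} \<in> h)) = s"
      if "g \<in> carrier G" "l \<in> letters" for g l s
      using step_inv[OF that] by (auto simp: insert_commute)
    show "((s \<noteq> ({g, g \<cdot> (v, True)} \<in> h)) \<noteq> ({g \<cdot> (v, True), g \<cdot> (v, True) \<cdot> (w, True)} \<in> h)) =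
        ((s \<noteq> ({g, g \<cdot> (w, True)} \<in> h)) \<noteq> ({g \<cdot> (w, True), g \<cdot> (w, True) \<cdot> (v, True)} \<in> h))"
      if g: "g \<in> carrier G" and e: "{v, w} \<in> E" for g v w s
    proof -
      have e': "{w, v} \<in> E" using e by (simp add: insert_commute)
      show ?thesis
        using opposite_hyp[OF oppositeI[OF g e, of True True], of d]
          opposite_hyp[OF oppositeI[OF g e', of True True], of d] unfolding assms by blast
    qed
  qed
qed

definition sides :: "('v \<times> bool) list set set set \<Rightarrow> (('v \<times> bool) list set \<Rightarrow> bool) \<Rightarrow> bool" where
  "sides h col \<longleftrightarrow>
     (\<forall>x\<in>carrier G. \<forall>l\<in>letters. col (x \<cdot> l) = (col x \<noteq> ({x, x \<cdot> l} \<in> h))) \<and>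
     (\<forall>x\<in>carrier G. component h x = {y \<in> carrier G. col y = col x})"

lemma sides_step: "sides h col \<Longrightarrow> x \<in> carrier G \<Longrightarrow> l \<in> letters \<Longrightarrow> col (x \<cdot> l) = (col x \<noteq> ({x, x \<cdot> l} \<in> h))"
  and sides_component: "sides h col \<Longrightarrow> x \<in> carrier G \<Longrightarrow> component h x = {y \<in> carrier G. col y = col x}"
  unfolding sides_def by blast+

text \<open>The parity colouring separates at least two components. There are no more: an edge
  crossing \<open>h\<close> ends at an end of a dual edge, which \<open>hyp_ends_connected\<close>
  joins to \<open>g\<close> or to its neighbour, so every vertex is joined to one of these
  two.\<close>

lemma two_sides:
  assumes g: "g \<in> carrier G" and v: "v \<in> V" and h: "h = hyp {g, g \<cdot> (v, True)}"
  obtains col where "sides h col" "\<not> col g" "col (g \<cdot> (v, True))"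
proof -
  let ?gv = "g \<cdot> (v, True)"
  obtain S where S: "\<And>x l. x \<in> carrier G \<Longrightarrow> l \<in> letters \<Longrightarrow> S (x \<cdot> l) = (S x \<noteq> ({x, x \<cdot> l} \<in> h))"
    using lift_hyp[OF h] by blast
  define col where "col x = (S x \<noteq> S g)" for x
  have col: "col (x \<cdot> l) = (col x \<noteq> ({x, x \<cdot> l} \<in> h))" if "x \<in> carrier G" "l \<in> letters" for x l
    using S[OF that] by (auto simp: col_def)
  have "\<not> col g" by (simp add: col_def)
  moreover have "col ?gv" using col[of g "(v, True)"] g v \<open>\<not> col g\<close> by (simp add: h)
  moreover have "component h x = {y \<in> carrier G. col y = col x}" if x: "x \<in> carrier G" for x
  proof -
    have comp: "y \<in> carrier G \<and> col y = col x" if "(x, y) \<in> (avoiding h)\<^sup>*" "x \<in> carrier G" for x y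
      using that
    proof (induction rule: rtrancl_induct)
      case (step y z)
      then obtain l where "l \<in> letters" "z = y \<cdot> l" "{y, y \<cdot> l} \<notin> h"
        by (auto simp: avoiding_def adjacency_iff)
      then show ?case using step col[of y l] by auto
    qed simp
    have sym: "(y, x) \<in> (avoiding h)\<^sup>*" if "(x, y) \<in> (avoiding h)\<^sup>*" for x y
      using sym_rtrancl[OF sym_avoiding] that by (rule symD)
    define P where "P y \<longleftrightarrow> (g, y) \<in> (avoiding h)\<^sup>* \<or> (?gv, y) \<in> (avoiding h)\<^sup>*" for y
    have P_step: "P (y \<cdot> l)" if "P y" "y \<in> carrier G" "l \<in> letters" for y l
    proof (cases "{y, y \<cdot> l} \<in> h")
      case True
      then obtain k where k: "k \<in> carrier G" "{y, y \<cdot> l} = {k, k \<cdot> (v, True)}"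
        "(g, k) \<in> (avoiding h)\<^sup>*" "(?gv, k \<cdot> (v, True)) \<in> (avoiding h)\<^sup>*"
        using hyp_ends_connected[OF g v h True] by blast
      then have "y \<cdot> l = k \<or> y \<cdot> l = k \<cdot> (v, True)" by (auto simp: doubleton_eq_iff)
      then show ?thesis using k unfolding P_def by auto
    next
      case False
      then have "(y, y \<cdot> l) \<in> avoiding h" using that by (intro avoiding_step)
      then show ?thesis using that unfolding P_def by (auto intro: rtrancl_into_rtrancl)
    qed
    have P_iff: "P (y \<cdot> l) \<longleftrightarrow> P y" if "y \<in> carrier G" "l \<in> letters" for y l
      using P_step[of y l] P_step[of "y \<cdot> l" "inv_letter l"] that by auto
    have "P y \<longleftrightarrow> P \<one>\<^bsub>G\<^esub>" if "y \<in> carrier G" for y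
      using that by (induction rule: carrier_induct) (simp_all add: P_iff)
    moreover have "P g" by (simp add: P_def)
    ultimately have P: "P y" if "y \<in> carrier G" for y using that g by blast
    have "(x, y) \<in> (avoiding h)\<^sup>*" if y: "y \<in> carrier G" "col y = col x" for y
    proof -
      have "(if col z then ?gv else g, z) \<in> (avoiding h)\<^sup>*" if "z \<in> carrier G" for z
        using P[OF that] comp[of g z] comp[of ?gv z] g v \<open>\<not> col g\<close> \<open>col ?gv\<close> unfolding P_def by auto
      note root = this
      show ?thesis using sym[OF root[OF x]] root[OF y(1)] unfolding y(2) by (rule rtrancl_trans)
    qed
    then show ?thesis unfolding component_def using comp x by (intro Collect_cong iffI) fast+
  qed
  ultimately have "sides h col" using col by (simp add: sides_def)
  then show ?thesis using \<open>\<not> col g\<close> \<open>col ?gv\<close> by (rule that)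
qed

lemma half_sides:
  assumes g: "g \<in> carrier G" and l: "l \<in> letters"
  obtains col where "sides (hyp {g, g \<cdot> l}) col" "\<not> col g" "col (g \<cdot> l)"
    "half g l = {y \<in> carrier G. col y}"
proof -
  define h where "h = hyp {g, g \<cdot> l}"
  have gl: "g \<cdot> l \<in> carrier G" using g l by simp
  have "\<exists>col. sides h col \<and> \<not> col g \<and> col (g \<cdot> l)"
  proof (cases "snd l")
    case True
    then have l': "l = (fst l, True)" by (simp add: prod_eq_iff)
    then have "h = hyp {g, g \<cdot> (fst l, True)}" by (simp add: h_def)
    moreover have "fst l \<in> V" using l by auto
    ultimately obtain col where "sides h col" "\<not> col g" "col (g \<cdot> (fst l, True))"
      using g by (rule_tac two_sides)
    then show ?thesis using l' by auto
  next
    case False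
    have v: "fst l \<in> V" using l by auto
    have eq: "g = g \<cdot> l \<cdot> (fst l, True)" using step_inv[OF g l] False by (simp add: inv_letter_def)
    then have "h = hyp {g \<cdot> l, g \<cdot> l \<cdot> (fst l, True)}" by (simp add: h_def insert_commute)
    then obtain col where col: "sides h col" "\<not> col (g \<cdot> l)" "col (g \<cdot> l \<cdot> (fst l, True))"
      using gl v by (rule_tac two_sides)
    have "sides h (\<lambda>x. \<not> col x)" using col(1) unfolding sides_def by simp
    then show ?thesis using col(2,3) eq by auto
  qed
  then obtain col where col: "sides h col" "\<not> col g" "col (g \<cdot> l)" by blast
  have "half g l = {y \<in> carrier G. col y}"
    using sides_component[OF col(1) gl] col(3) by (simp add: half_def h_def)
  then show ?thesis using that col unfolding h_def by blast
qed

lemma half_subset: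
  assumes "g \<in> carrier G" "l \<in> letters"
  shows "half g l \<subseteq> carrier G"
proof -
  obtain col where col: "sides (hyp {g, g \<cdot> l}) col" "\<not> col g" "col (g \<cdot> l)"
    and h: "half g l = {y \<in> carrier G. col y}"
    using half_sides[OF assms] .
  then show ?thesis by blast
qed

lemma half_ends:
  assumes "g \<in> carrier G" "l \<in> letters"
  shows "g \<notin> half g l" "g \<cdot> l \<in> half g l"
proof -
  obtain col where col: "sides (hyp {g, g \<cdot> l}) col" "\<not> col g" "col (g \<cdot> l)"
    and h: "half g l = {y \<in> carrier G. col y}"
    using half_sides[OF assms] .
  then show "g \<notin> half g l" "g \<cdot> l \<in> half g l" using assms by simp_all
qed

lemma half_step_iff:
  assumes "g \<in> carrier G" "l \<in> letters" "x \<in> carrier G" "m \<in> letters"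
  shows "(x \<cdot> m \<in> half g l) \<noteq> (x \<in> half g l) \<longleftrightarrow> {x, x \<cdot> m} \<in> hyp {g, g \<cdot> l}"
proof -
  obtain col where col: "sides (hyp {g, g \<cdot> l}) col" "\<not> col g" "col (g \<cdot> l)"
    and h: "half g l = {y \<in> carrier G. col y}"
    using half_sides[OF assms(1,2)] .
  show ?thesis unfolding h using sides_step[OF col(1) assms(3,4)] assms by auto
qed

lemma half_same_hyp:
  assumes g: "g \<in> carrier G" "l \<in> letters" and x: "x \<in> carrier G" "m \<in> letters"
    and e: "{x, x \<cdot> m} \<in> hyp {g, g \<cdot> l}"
  shows "half x m = (if x \<in> half g l then carrier G - half g l else half g l)"
proof -
  obtain col where col: "sides (hyp {g, g \<cdot> l}) col" "\<not> col g" "col (g \<cdot> l)"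
    and h: "half g l = {y \<in> carrier G. col y}"
    using half_sides[OF g] .
  have "half x m = component (hyp {g, g \<cdot> l}) (x \<cdot> m)" using hyp_eq[OF e] by (simp add: half_def)
  also have "\<dots> = {y \<in> carrier G. col y = (\<not> col x)}"
    using sides_component[OF col(1), of "x \<cdot> m"] sides_step[OF col(1) x] x e by simp
  finally show ?thesis unfolding h using x by auto
qed

text \<open>A half-space can be entered only through its own hyperplane, so any edge leading into it
  names it. Chains along paths are analysed through this fact.\<close>

lemma cross_half:
  assumes "g \<in> carrier G" "l \<in> letters" "x \<in> carrier G" "m \<in> letters"
    and "x \<notin> half g l" "x \<cdot> m \<in> half g l"
  shows "half x m = half g l"
  using assms half_step_iff[OF assms(1-4)] half_same_hyp[OF assms(1-4)] by auto

lemma half_opp: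
  assumes "g \<in> carrier G" "l \<in> letters"
  shows "opp_half X (half g l) = half (g \<cdot> l) (inv_letter l)"
proof -
  have "{g \<cdot> l, g \<cdot> l \<cdot> inv_letter l} \<in> hyp {g, g \<cdot> l}" using assms by (simp add: insert_commute)
  then show ?thesis
    using half_same_hyp[OF assms, of "g \<cdot> l" "inv_letter l"] assms half_ends(2)[OF assms]
    by (simp add: opp_half_def verts_eq)
qed

lemma half_in_half_spaces:
  assumes "g \<in> carrier G" "l \<in> letters"
  shows "half g l \<in> half_spaces X"
proof -
  have "hyp {g, g \<cdot> l} \<in> hyperplanes X"
    using edgeI[OF assms] by (auto simp: hyperplanes_def hyp_def quotient_def)
  then show ?thesis
    unfolding half_spaces_def half_def component_def avoiding_def using assms verts_eq
    by (intro CollectI exI[of _ "g \<cdot> l"] exI[of _ "hyp {g, g \<cdot> l}"] conjI) auto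
qed

lemma half_spacesE:
  assumes "H \<in> half_spaces X"
  obtains g l where "g \<in> carrier G" "l \<in> letters" "H = half g l"
proof -
  obtain x h where x: "x \<in> carrier G" and h: "h \<in> hyperplanes X" and H: "H = component h x"
    using assms by (auto simp: half_spaces_def component_def avoiding_def verts_eq)
  obtain e where e: "e \<in> edges X" "h = hyp e"
    using h by (auto simp: hyperplanes_def quotient_def hyp_def)
  obtain g v where g: "g \<in> carrier G" and v: "v \<in> V" and ev: "e = {g, g \<cdot> (v, True)}" using e(1) by (rule edgeE)
  have h': "h = hyp {g, g \<cdot> (v, True)}" using e ev by simp
  obtain col where col: "sides h col" "\<not> col g" "col (g \<cdot> (v, True))"
    using two_sides[OF g v h'] .
  show ?thesis
  proof (cases "col x")
    case True
    then have "H = half g (v, True)" using col sides_component[OF col(1)] x g v by (simp add: H half_def flip: h')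
    then show ?thesis using that[of g "(v, True)"] g v by simp
  next
    case False
    have "h = hyp {g \<cdot> (v, True), g}" using h' by (simp add: insert_commute)
    then have "H = half (g \<cdot> (v, True)) (v, False)" using False col sides_component[OF col(1)] x g v by (simp add: H half_def)
    then show ?thesis using that[of "g \<cdot> (v, True)" "(v, False)"] g v by simp
  qed
qed

text \<open>Parallel edges share label and orientation, so a hyperplane is crossed positively from
  one side only. With opposite signs, \<open>x \<cdot> m\<close> would be joined to \<open>g\<close>
  without crossing the hyperplane and so lie outside the half-space it is supposed to be in.\<close>

lemma half_label:
  assumes g: "g \<in> carrier G" "l \<in> letters" and x: "x \<in> carrier G" "m \<in> letters"
    and eq: "half g l = half x m"
  shows "l = m"
proof -
  have *: "fst m = fst l \<and> (snd l \<longrightarrow> snd m)"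
    if g: "g \<in> carrier G" "l \<in> letters" and x: "x \<in> carrier G" "m \<in> letters"
      and eq: "half g l = half x m" for g l x m
  proof -
    obtain v b w c where [simp]: "l = (v, b)" "m = (w, c)" by (cases l; cases m)
    let ?g = "if b then g else g \<cdot> l"
    have V: "v \<in> V" "w \<in> V" using g x by simp_all
    have "{x, x \<cdot> m} \<in> hyp {g, g \<cdot> l}" using half_step_iff[OF g x] half_ends[OF x] eq by auto
    moreover have "{g, g \<cdot> l} = {?g, ?g \<cdot> (v, True)}" using g by (auto simp: insert_commute)
    ultimately have xh: "{x, x \<cdot> m} \<in> hyp {?g, ?g \<cdot> (v, True)}" by simp
    have "?g \<in> carrier G" using g by simp
    then have wv: "w = v" using edge_in_hyp_label[OF _ V(1) x(1) V(2)] xh by simp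
    have "c" if b: "b"
    proof (rule ccontr)
      assume c: "\<not> c"
      have xh: "{x, x \<cdot> m} \<in> hyp {g, g \<cdot> (v, True)}" using xh b by simp
      obtain k where k: "k \<in> carrier G" "{x, x \<cdot> m} = {k, k \<cdot> (v, True)}"
        "(g, k) \<in> (avoiding (hyp {g, g \<cdot> (v, True)}))\<^sup>*"
        using hyp_ends_connected[OF g(1) V(1) HOL.refl xh] by blast
      have "{x, x \<cdot> m} = {x \<cdot> m, x \<cdot> m \<cdot> (v, True)}" using c x wv by (simp add: insert_commute)
      then have "k = x \<cdot> m" using edge_eqD(1)[of k "x \<cdot> m" v v] k x V wv by simp
      moreover obtain col where col: "sides (hyp {g, g \<cdot> l}) col" "\<not> col g" "col (g \<cdot> l)"
    and h: "half g l = {y \<in> carrier G. col y}"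
        using half_sides[OF g] .
      moreover have "k \<in> component (hyp {g, g \<cdot> l}) g" using k(3) b by (simp add: component_def)
      ultimately have "x \<cdot> m \<notin> half g l" unfolding h using sides_component[OF col(1) g(1)] by simp
      then show False using eq half_ends[OF x] by simp
    qed
    then show ?thesis using wv by simp
  qed
  show ?thesis using *[OF assms] *[OF x g eq[symmetric]] by (auto simp: prod_eq_iff)
qed

section \<open>Transversality and tight nesting\<close>

lemma mult_inv_cancel [simp]:
  assumes "k \<in> carrier G" "x \<in> carrier G"
  shows "inv\<^bsub>G\<^esub> k \<otimes>\<^bsub>G\<^esub> (k \<otimes>\<^bsub>G\<^esub> x) = x" "k \<otimes>\<^bsub>G\<^esub> (inv\<^bsub>G\<^esub> k \<otimes>\<^bsub>G\<^esub> x) = x"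
  using assms by (simp_all flip: m_assoc)

lemma lift_state_at:
  fixes t :: "('v \<times> bool) list set \<Rightarrow> 'v \<times> bool \<Rightarrow> 's \<Rightarrow> 's"
  assumes x\<^sub>0: "x\<^sub>0 \<in> carrier G"
    and inv: "\<And>g l s. g \<in> carrier G \<Longrightarrow> l \<in> letters \<Longrightarrow> t (g \<cdot> l) (inv_letter l) (t g l s) = s"
    and comm: "\<And>g v w s. g \<in> carrier G \<Longrightarrow> {v, w} \<in> E \<Longrightarrow>
      t (g \<cdot> (v, True)) (w, True) (t g (v, True) s) = t (g \<cdot> (w, True)) (v, True) (t g (w, True) s)"
  shows "\<exists>S. S x\<^sub>0 = s\<^sub>0 \<and> (\<forall>g\<in>carrier G. \<forall>l\<in>letters. S (g \<cdot> l) = t g l (S g))"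
proof (rule lift_state[where t = "\<lambda>g. t (x\<^sub>0 \<otimes>\<^bsub>G\<^esub> g)" and s\<^sub>0 = s\<^sub>0])
  show "t (x\<^sub>0 \<otimes>\<^bsub>G\<^esub> (g \<cdot> l)) (inv_letter l) (t (x\<^sub>0 \<otimes>\<^bsub>G\<^esub> g) l s) = s"
    if "g \<in> carrier G" "l \<in> letters" for g l s
    using inv[of "x\<^sub>0 \<otimes>\<^bsub>G\<^esub> g" l s] that x\<^sub>0 by (simp add: mult_step)
  show "t (x\<^sub>0 \<otimes>\<^bsub>G\<^esub> (g \<cdot> (v, True))) (w, True) (t (x\<^sub>0 \<otimes>\<^bsub>G\<^esub> g) (v, True) s) =
      t (x\<^sub>0 \<otimes>\<^bsub>G\<^esub> (g \<cdot> (w, True))) (v, True) (t (x\<^sub>0 \<otimes>\<^bsub>G\<^esub> g) (w, True) s)"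
    if "g \<in> carrier G" "{v, w} \<in> E" for g v w s
    using comm[of "x\<^sub>0 \<otimes>\<^bsub>G\<^esub> g" v w s] that x\<^sub>0 edgeD[OF that(2)] by (simp add: mult_step)
  fix S assume S: "S \<one>\<^bsub>G\<^esub> = s\<^sub>0"
    "\<And>g l. g \<in> carrier G \<Longrightarrow> l \<in> letters \<Longrightarrow> S (g \<cdot> l) = t (x\<^sub>0 \<otimes>\<^bsub>G\<^esub> g) l (S g)"
  define S' where "S' x = S (inv\<^bsub>G\<^esub> x\<^sub>0 \<otimes>\<^bsub>G\<^esub> x)" for x
  have "S' x\<^sub>0 = s\<^sub>0" using x\<^sub>0 S(1) by (simp add: S'_def)
  moreover have "S' (g \<cdot> l) = t g l (S' g)" if "g \<in> carrier G" "l \<in> letters" for g l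
    using S(2)[of "inv\<^bsub>G\<^esub> x\<^sub>0 \<otimes>\<^bsub>G\<^esub> g" l] that x\<^sub>0 by (simp add: mult_step S'_def)
  ultimately show ?thesis by blast
qed

lemma hyp_same_label:
  assumes "g \<in> carrier G" "l \<in> letters" "x \<in> carrier G" "m \<in> letters"
    and "{x, x \<cdot> m} \<in> hyp {g, g \<cdot> l}"
  shows "fst m = fst l"
proof (cases "x \<in> half g l")
  case False
  then have "half x m = half g l" using half_same_hyp[OF assms] by simp
  then show ?thesis using half_label[OF assms(3,4,1,2)] by simp
next
  case True
  then have "half x m = half (g \<cdot> l) (inv_letter l)"
    using half_same_hyp[OF assms] half_opp[OF assms(1,2)] by (simp add: opp_half_def verts_eq)
  then have "m = inv_letter l" using half_label[of "g \<cdot> l" "inv_letter l" x m] assms by simp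
  then show ?thesis by (simp add: inv_letter_def)
qed

lemma same_side_connected:
  assumes g: "g \<in> carrier G" "l \<in> letters" and x: "x \<in> carrier G" "y \<in> carrier G"
    and "x \<in> half g l \<longleftrightarrow> y \<in> half g l"
  shows "(x, y) \<in> (avoiding (hyp {g, g \<cdot> l}))\<^sup>*"
proof -
  obtain col where col: "sides (hyp {g, g \<cdot> l}) col" "\<not> col g" "col (g \<cdot> l)"
    and h: "half g l = {y \<in> carrier G. col y}"
    using half_sides[OF g] .
  have "y \<in> component (hyp {g, g \<cdot> l}) x"
    using sides_component[OF col(1) x(1)] assms h by auto
  then show ?thesis by (simp add: component_def)
qed

lemma same_side_induct:
  assumes g: "g \<in> carrier G" "l \<in> letters" and x: "x \<in> carrier G" "y \<in> carrier G"
    and side: "x \<in> half g l \<longleftrightarrow> y \<in> half g l" and "P x"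
    and step: "\<And>z m. z \<in> carrier G \<Longrightarrow> m \<in> letters \<Longrightarrow> {z, z \<cdot> m} \<notin> hyp {g, g \<cdot> l} \<Longrightarrow> P z \<Longrightarrow> P (z \<cdot> m)"
  shows "P y"
proof -
  have "(x, y) \<in> (avoiding (hyp {g, g \<cdot> l}))\<^sup>*" using g x side by (rule same_side_connected)
  then show ?thesis
  proof (induction rule: rtrancl_induct)
    case (step y z)
    then show ?case using assms(7) by (auto simp: avoiding_def adjacency_iff)
  qed (rule \<open>P x\<close>)
qed

text \<open>Two distinct hyperplanes that share no square act on the states \<open>0, 1, 2\<close> as the
  transpositions \<open>(0 1)\<close> and \<open>(1 2)\<close>: crossing one and then the other, in either order,
  leads from state \<open>1\<close> to different states, so one quadrant is empty.\<close>

lemma not_transverse: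
  assumes g: "g \<in> carrier G" "l \<in> letters" and x: "x \<in> carrier G" "m \<in> letters"
    and lab: "fst l = fst m \<or> {fst l, fst m} \<notin> E"
  shows "\<not> transverse X (half g l) (half x m)"
proof
  define H where "H = half g l"
  define H' where "H' = half x m"
  define h where "h = hyp {g, g \<cdot> l}"
  define h' where "h' = hyp {x, x \<cdot> m}"
  assume "transverse X (half g l) (half x m)"
  then obtain p q r s where
    pq: "p \<in> carrier G" "p \<notin> H" "p \<notin> H'" "q \<in> carrier G" "q \<in> H" "q \<notin> H'"
      "r \<in> carrier G" "r \<notin> H" "r \<in> H'" "s \<in> carrier G" "s \<in> H" "s \<in> H'"
    unfolding transverse_def opp_half_def verts_eq H_def H'_def
    using half_subset[OF g] half_subset[OF x] by blast
  show False
  proof (cases "h = h'")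
    case True
    then have "H' = (if x \<in> H then carrier G - H else H)"
      using half_same_hyp[OF g x] unfolding h_def h'_def H_def H'_def by simp
    then show False using pq by (auto split: if_splits)
  next
    case False
    have disj: "e \<notin> h'" if "e \<in> h" for e
      using that False hyp_eq unfolding h_def h'_def by blast
    have lab_h: "a = fst l" if "{y, y \<cdot> (a, b)} \<in> h" "y \<in> carrier G" "a \<in> V" for y a b
      using hyp_same_label[OF g that(2), of "(a, b)"] that by (simp add: h_def)
    have lab_h': "a = fst m" if "{y, y \<cdot> (a, b)} \<in> h'" "y \<in> carrier G" "a \<in> V" for y a b
      using hyp_same_label[OF x that(2), of "(a, b)"] that by (simp add: h'_def)
    define t where "t y n k = (if {y, y \<cdot> n} \<in> h then (if k = 0 then 1 else if k = 1 then 0 else k)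
      else if {y, y \<cdot> n} \<in> h' then (if k = 1 then 2 else if k = 2 then 1 else k) else k)"
      for y n and k :: nat
    have t_inv: "t (y \<cdot> n) (inv_letter n) (t y n k) = k" if "y \<in> carrier G" "n \<in> letters" for y n k
      using that by (simp add: t_def insert_commute)
    have t_comm: "t (y \<cdot> (a, True)) (b, True) (t y (a, True) k) = t (y \<cdot> (b, True)) (a, True) (t y (b, True) k)"
      if y: "y \<in> carrier G" and e: "{a, b} \<in> E" for y a b k
    proof -
      note V = edgeD[OF e]
      have e': "{b, a} \<in> E" using e by (simp add: insert_commute)
      have "{y \<cdot> (a, True), y \<cdot> (a, True) \<cdot> (b, True)} \<in> hyp d \<longleftrightarrow> {y, y \<cdot> (b, True)} \<in> hyp d"
        "{y \<cdot> (b, True), y \<cdot> (b, True) \<cdot> (a, True)} \<in> hyp d \<longleftrightarrow> {y, y \<cdot> (a, True)} \<in> hyp d" for d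
        using opposite_hyp[OF oppositeI[OF y e, of True True], of d]
          opposite_hyp[OF oppositeI[OF y e', of True True], of d] by simp_all
      then have opp: "{y \<cdot> (a, True), y \<cdot> (a, True) \<cdot> (b, True)} \<in> h \<longleftrightarrow> {y, y \<cdot> (b, True)} \<in> h"
        "{y \<cdot> (b, True), y \<cdot> (b, True) \<cdot> (a, True)} \<in> h \<longleftrightarrow> {y, y \<cdot> (a, True)} \<in> h"
        "{y \<cdot> (a, True), y \<cdot> (a, True) \<cdot> (b, True)} \<in> h' \<longleftrightarrow> {y, y \<cdot> (b, True)} \<in> h'"
        "{y \<cdot> (b, True), y \<cdot> (b, True) \<cdot> (a, True)} \<in> h' \<longleftrightarrow> {y, y \<cdot> (a, True)} \<in> h'"
        unfolding h_def h'_def by blast+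
      \<comment> \<open>The sides of a square have distinct adjacent labels, whereas edges of
        \<open>h\<close> and \<open>h'\<close> are labelled \<open>fst l\<close> and
        \<open>fst m\<close>. So at most one of the two moves changes the state.\<close>
      have "\<not> ({y, y \<cdot> (a, True)} \<in> h \<union> h' \<and> {y, y \<cdot> (b, True)} \<in> h \<union> h')"
        using lab e e' V lab_h[OF _ y V(1)] lab_h'[OF _ y V(1)] lab_h[OF _ y V(2)] lab_h'[OF _ y V(2)]
        by auto
      then show ?thesis unfolding t_def opp by auto
    qed
    have "\<exists>S. S p = 1 \<and> (\<forall>y\<in>carrier G. \<forall>n\<in>letters. S (y \<cdot> n) = t y n (S y))"
      using pq(1) t_inv t_comm by (rule lift_state_at)
    then obtain S where S_p: "S p = 1" and "\<forall>y\<in>carrier G. \<forall>n\<in>letters. S (y \<cdot> n) = t y n (S y)" by blast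
    then have S: "S (y \<cdot> n) = t y n (S y)" if "y \<in> carrier G" "n \<in> letters" for y n using that by blast
    have H: "(y \<cdot> n \<in> H) \<noteq> (y \<in> H) \<longleftrightarrow> {y, y \<cdot> n} \<in> h" if "y \<in> carrier G" "n \<in> letters" for y n
      using half_step_iff[OF g that] by (simp add: H_def h_def)
    have H': "(y \<cdot> n \<in> H') \<noteq> (y \<in> H') \<longleftrightarrow> {y, y \<cdot> n} \<in> h'" if "y \<in> carrier G" "n \<in> letters" for y n
      using half_step_iff[OF x that] by (simp add: H'_def h'_def)
    \<comment> \<open>Each of the four walks stays on one side of one hyperplane, so only the other
      one acts. From \<open>p\<close> to \<open>q\<close> this leads from 1 to 0, which crossing
      \<open>h'\<close> fixes on the way to \<open>s\<close>; from \<open>p\<close> to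
      \<open>r\<close> it leads from 1 to 2, which crossing \<open>h\<close> fixes on the way to
      \<open>s\<close>.\<close>
    have "S q = (if q \<in> H then 0 else 1)"
    proof (rule same_side_induct[OF x pq(1,4)])
      show "p \<in> half x m \<longleftrightarrow> q \<in> half x m" using pq by (simp add: H'_def)
      show "S (z \<cdot> n) = (if z \<cdot> n \<in> H then 0 else 1)" if "z \<in> carrier G" "n \<in> letters"
        "{z, z \<cdot> n} \<notin> hyp {x, x \<cdot> m}" "S z = (if z \<in> H then 0 else 1)" for z n
        using that S H[OF that(1,2)] by (auto simp: t_def h'_def)
    qed (use S_p pq in simp)
    then have S_q: "S q = 0" using pq by simp
    have "S r = (if r \<in> H' then 2 else 1)"
    proof (rule same_side_induct[OF g pq(1,7)])
      show "p \<in> half g l \<longleftrightarrow> r \<in> half g l" using pq by (simp add: H_def)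
      show "S (z \<cdot> n) = (if z \<cdot> n \<in> H' then 2 else 1)" if "z \<in> carrier G" "n \<in> letters"
        "{z, z \<cdot> n} \<notin> hyp {g, g \<cdot> l}" "S z = (if z \<in> H' then 2 else 1)" for z n
        using that S H'[OF that(1,2)] by (auto simp: t_def h_def)
    qed (use S_p pq in simp)
    then have S_r: "S r = 2" using pq by simp
    have "S s = 0"
    proof (rule same_side_induct[OF g pq(4,10)])
      show "q \<in> half g l \<longleftrightarrow> s \<in> half g l" using pq by (simp add: H_def)
      show "S (z \<cdot> n) = 0" if "z \<in> carrier G" "n \<in> letters"
        "{z, z \<cdot> n} \<notin> hyp {g, g \<cdot> l}" "S z = 0" for z n
        using that S by (simp add: t_def h_def)
    qed (rule S_q)
    moreover have "S s = 2"
    proof (rule same_side_induct[OF x pq(7,10)])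
      show "r \<in> half x m \<longleftrightarrow> s \<in> half x m" using pq by (simp add: H'_def)
      show "S (z \<cdot> n) = 2" if "z \<in> carrier G" "n \<in> letters"
        "{z, z \<cdot> n} \<notin> hyp {x, x \<cdot> m}" "S z = 2" for z n
        using that S by (simp add: t_def h'_def)
    qed (rule S_r)
    ultimately show False by simp
  qed
qed

text \<open>One quadrant is empty by \<open>not_transverse\<close>. The points \<open>p\<close> and
  \<open>q\<close> rule out the outer and the inner one, and emptiness of either remaining quadrant
  is an inclusion.\<close>

lemma half_comparable:
  assumes g: "g \<in> carrier G" "l \<in> letters" and x: "x \<in> carrier G" "m \<in> letters"
    and lab: "fst l = fst m \<or> {fst l, fst m} \<notin> E"
    and p: "p \<in> carrier G" "p \<notin> half g l" "p \<notin> half x m" and q: "q \<in> half g l" "q \<in> half x m"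
  shows "half g l \<subseteq> half x m \<or> half x m \<subseteq> half g l"
  using not_transverse[OF g x lab] p q half_subset[OF g] half_subset[OF x]
  unfolding transverse_def opp_half_def verts_eq by blast

text \<open>The vertices \<open>g\<close>, \<open>g \<cdot> l\<close>,
  \<open>g \<cdot> l \<cdot> m\<close> occupy three quadrants as long as the path does not
  backtrack, so non-transversality empties the fourth.\<close>

lemma half_nested:
  assumes g: "g \<in> carrier G" and l: "l \<in> letters" and m: "m \<in> letters"
    and lab: "fst l = fst m \<or> {fst l, fst m} \<notin> E" and ne: "m \<noteq> inv_letter l"
  shows "half (g \<cdot> l) m \<subset> half g l" "tightly_nested X (half g l) (half (g \<cdot> l) m)"
proof -
  let ?x = "g \<cdot> l"
  have x: "?x \<in> carrier G" "?x \<cdot> m \<in> carrier G" using g l m by simp_all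
  have n1: "g \<notin> half ?x m"
  proof
    assume "g \<in> half ?x m"
    then have "half ?x (inv_letter l) = half ?x m"
      using cross_half[of ?x m ?x "inv_letter l"] half_ends[of ?x m] x g l m by simp
    then show False using half_label[of ?x "inv_letter l" ?x m] x l m ne by simp
  qed
  have n2: "?x \<cdot> m \<in> half g l"
  proof (rule ccontr)
    assume *: "?x \<cdot> m \<notin> half g l"
    then have "{?x, ?x \<cdot> m} \<in> hyp {g, ?x}"
      using half_step_iff[OF g l x(1) m] half_ends[OF g l] by simp
    then have "half ?x m = opp_half X (half g l)"
      using half_same_hyp[OF g l x(1) m] half_ends[OF g l] by (simp add: opp_half_def verts_eq)
    then show False using half_opp[OF g l] half_label[of ?x m ?x "inv_letter l"] x l m ne by simp
  qed
  note ends = half_ends[OF g l] half_ends[OF x(1) m]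
  have "half ?x m \<subseteq> half g l"
    using not_transverse[OF g l x(1) m lab] n1 n2 ends g x half_subset[OF g l] half_subset[OF x(1) m]
    unfolding transverse_def opp_half_def verts_eq by blast
  then show sub: "half ?x m \<subset> half g l" using ends by blast
  \<comment> \<open>A half-space strictly between would be entered by the two-edge path at one of
    its edges, and would then be the half-space named by that edge.\<close>
  have "\<not> (K \<in> half_spaces X \<and> half ?x m \<subset> K \<and> K \<subset> half g l)" for K
  proof
    assume K: "K \<in> half_spaces X \<and> half ?x m \<subset> K \<and> K \<subset> half g l"
    then have "K \<in> half_spaces X" by simp
    then obtain k n where k: "k \<in> carrier G" "n \<in> letters" "K = half k n" by (rule half_spacesE)
    have "g \<notin> K" "?x \<cdot> m \<in> K" using K ends by auto
    show False
    proof (cases "?x \<in> K")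
      case True
      then have "half g l = K" using cross_half[OF k(1,2) g l] k(3) \<open>g \<notin> K\<close> by simp
      then show False using K by simp
    next
      case False
      then have "half ?x m = K" using cross_half[OF k(1,2) x(1) m] k(3) \<open>?x \<cdot> m \<in> K\<close> by simp
      then show False using K by simp
    qed
  qed
  then show "tightly_nested X (half g l) (half ?x m)" using sub by (auto simp: tightly_nested_def)
qed

section \<open>Half-spaces along an edge path\<close>

fun halves :: "('v \<times> bool) list set \<Rightarrow> ('v \<times> bool) list \<Rightarrow> ('v \<times> bool) list set set list" where
  "halves g [] = []"
| "halves g (l # w) = half g l # halves (g \<cdot> l) w"

lemma length_halves [simp]: "length (halves g w) = length w"
  by (induction w arbitrary: g) auto

lemma halves_append:
  assumes "g \<in> carrier G" "w \<in> raag_words V"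
  shows "halves g (w @ w') = halves g w @ halves (g \<otimes>\<^bsub>G\<^esub> cls w) w'"
  using assms by (induction w arbitrary: g) (auto simp: mult_cls_Cons)

lemma nth_halves:
  assumes "g \<in> carrier G" "w \<in> raag_words V" "i < length w"
  shows "halves g w ! i = half (g \<otimes>\<^bsub>G\<^esub> cls (take i w)) (w ! i)"
  using assms
proof (induction w arbitrary: g i)
  case (Cons l w)
  have "take j w \<in> raag_words V" for j using Cons.prems by (auto simp: raag_words_def dest: in_set_takeD)
  then show ?case using Cons by (cases i) (simp_all add: mult_cls_Cons)
qed simp

lemma set_halves:
  assumes "g \<in> carrier G" "w \<in> raag_words V" "H \<in> set (halves g w)"
  shows "\<exists>x l. x \<in> carrier G \<and> l \<in> set w \<and> l \<in> letters \<and> H = half x l"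
  using assms
proof (induction w arbitrary: g)
  case (Cons l w)
  show ?case
  proof (cases "H = half g l")
    case False
    then show ?thesis using Cons.IH[of "g \<cdot> l"] Cons.prems by auto
  qed (use Cons.prems in auto)
qed simp

text \<open>A separating half-space must be entered somewhere along the path. The inclusion may be
  strict, since a path can leave a half-space again.\<close>

lemma separators_subset_halves:
  assumes "g \<in> carrier G" "w \<in> raag_words V"
  shows "separators X g (g \<otimes>\<^bsub>G\<^esub> cls w) \<subseteq> set (halves g w)"
  using assms
proof (induction w arbitrary: g)
  case Nil
  then show ?case by (auto simp: separators_def opp_half_def)
next
  case (Cons l w)
  then have l: "l \<in> letters" and w: "w \<in> raag_words V" by auto
  show ?case
  proof
    fix H assume H: "H \<in> separators X g (g \<otimes>\<^bsub>G\<^esub> cls (l # w))"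
    then have H': "H \<in> half_spaces X" "g \<notin> H" "(g \<cdot> l) \<otimes>\<^bsub>G\<^esub> cls w \<in> H"
      using Cons.prems l w by (auto simp: separators_def opp_half_def mult_cls_Cons)
    obtain k n where k: "k \<in> carrier G" "n \<in> letters" "H = half k n" using H'(1) by (rule half_spacesE)
    show "H \<in> set (halves g (l # w))"
    proof (cases "g \<cdot> l \<in> H")
      case True
      then have "half g l = H" using cross_half[OF k(1,2), of g l] H' k Cons.prems by simp
      then show ?thesis by simp
    next
      case False
      then have "H \<in> separators X (g \<cdot> l) ((g \<cdot> l) \<otimes>\<^bsub>G\<^esub> cls w)"
        using H' Cons.prems l by (simp add: separators_def opp_half_def verts_eq)
      then show ?thesis using Cons.IH[of "g \<cdot> l"] Cons.prems l w by auto
    qed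
  qed
qed

lemma finite_separators:
  assumes "x \<in> carrier G" "y \<in> carrier G"
  shows "finite (separators X x y)"
proof -
  obtain w where w: "w \<in> raag_words V" "inv\<^bsub>G\<^esub> x \<otimes>\<^bsub>G\<^esub> y = cls w"
    using assms by (meson carrierE inv_closed m_closed)
  then have "y = x \<otimes>\<^bsub>G\<^esub> cls w" using assms by (simp flip: w(2))
  then show ?thesis using separators_subset_halves[OF assms(1) w(1)] finite_subset by blast
qed

section \<open>Left translation of half-spaces\<close>

abbreviation act :: "('v \<times> bool) list set \<Rightarrow> ('v \<times> bool) list set \<Rightarrow> ('v \<times> bool) list set" where
  "act \<equiv> (\<lambda>g x. g \<otimes>\<^bsub>G\<^esub> x)"

lemma opposite_translate:
  assumes k: "k \<in> carrier G" and "(e, f) \<in> opposite X"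
  shows "(act k ` e, act k ` f) \<in> opposite X"
  using assms(2)
proof (rule oppositeD)
  fix g v w c
  assume *: "g \<in> carrier G" "{v, w} \<in> E" "e = {g, g \<cdot> (v, True)}" "f = {g \<cdot> (w, c), g \<cdot> (w, c) \<cdot> (v, True)}"
  then show ?thesis
    using oppositeI[of "act k g" v w True c] edgeD[OF *(2)] k by (simp add: mult_step)
qed

lemma hyp_translate:
  assumes k: "k \<in> carrier G" and "f \<in> hyp e"
  shows "act k ` f \<in> hyp (act k ` e)"
proof -
  have "(e, f) \<in> (opposite X)\<^sup>*" using assms by (simp add: hyp_def)
  then have "(act k ` e, act k ` f) \<in> (opposite X)\<^sup>*"
    by (induction rule: rtrancl_induct) (auto intro: rtrancl_into_rtrancl opposite_translate[OF k])
  then show ?thesis by (simp add: hyp_def)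
qed

lemma half_translate_subset:
  assumes k: "k \<in> carrier G" and g: "g \<in> carrier G" and l: "l \<in> letters"
  shows "act k ` half g l \<subseteq> half (act k g) l"
proof
  fix z assume "z \<in> act k ` half g l"
  then obtain y where y: "y \<in> half g l" "z = act k y" by blast
  have kg: "act k g \<in> carrier G" using k g by simp
  have "y \<in> carrier G" using y half_subset[OF g l] by blast
  have "act k y \<in> half (act k g) l"
  proof (rule same_side_induct[OF g l _ \<open>y \<in> carrier G\<close>, where P = "\<lambda>y. act k y \<in> half (act k g) l"])
    show "g \<cdot> l \<in> carrier G" using g l by simp
    show "g \<cdot> l \<in> half g l \<longleftrightarrow> y \<in> half g l" using y half_ends[OF g l] by simp
    show "act k (g \<cdot> l) \<in> half (act k g) l" using half_ends[OF kg l] k g l by (simp add: mult_step)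
    fix x m assume x: "x \<in> carrier G" "m \<in> letters" "{x, x \<cdot> m} \<notin> hyp {g, g \<cdot> l}"
      "act k x \<in> half (act k g) l"
    have "{act k x, act k x \<cdot> m} \<notin> hyp {act k g, act k g \<cdot> l}"
    proof
      assume "{act k x, act k x \<cdot> m} \<in> hyp {act k g, act k g \<cdot> l}"
      \<comment> \<open>\<open>hyp_translate\<close> transports membership forwards only;
        translating by the inverse gives the converse.\<close>
      from hyp_translate[OF inv_closed[OF k] this] show False
        using x k g l by (simp flip: mult_step)
    qed
    then show "act k (x \<cdot> m) \<in> half (act k g) l"
      using half_step_iff[OF kg l, of "act k x" m] x k by (simp add: mult_step)
  qed
  then show "z \<in> half (act k g) l" using y by simp
qed

lemma half_translate:
  assumes k: "k \<in> carrier G" and g: "g \<in> carrier G" and l: "l \<in> letters"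
  shows "act k ` half g l = half (act k g) l"
proof
  show "half (act k g) l \<subseteq> act k ` half g l"
  proof
    fix y assume y: "y \<in> half (act k g) l"
    have "y \<in> carrier G" using y half_subset[of "act k g" l] k g l by auto
    moreover have "act (inv\<^bsub>G\<^esub> k) y \<in> half g l"
      using half_translate_subset[of "inv\<^bsub>G\<^esub> k" "act k g" l] y k g l by auto
    ultimately show "y \<in> act k ` half g l" using k by (intro image_eqI[of _ _ "act (inv\<^bsub>G\<^esub> k) y"]) simp_all
  qed
qed (rule half_translate_subset[OF assms])

lemma halves_translate:
  assumes "k \<in> carrier G" "g \<in> carrier G" "w \<in> raag_words V"
  shows "map (\<lambda>H. act k ` H) (halves g w) = halves (act k g) w"
  using assms by (induction w arbitrary: g) (auto simp: half_translate mult_step)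

end

section \<open>Counting tight chains of nested sets\<close>

text \<open>What the counting needs of half-spaces, stated for plain sets. Comparability is required
  only for sets separating a common pair of points. \<open>last_marked\<close> abstracts the role of
  the final letter \<open>b\<close>.\<close>

locale segment_family =
  fixes \<Omega> :: "'a set" and \<H> :: "'a set set" and \<S> :: "'a set list set" and n :: nat
  assumes pos: "0 < n"
    and len: "\<sigma> \<in> \<S> \<Longrightarrow> length \<sigma> = n"
    and members: "\<sigma> \<in> \<S> \<Longrightarrow> set \<sigma> \<subseteq> \<H>"
    and nested: "\<sigma> \<in> \<S> \<Longrightarrow> Suc i < n \<Longrightarrow> \<sigma> ! Suc i \<subset> \<sigma> ! i"
    and tight: "\<sigma> \<in> \<S> \<Longrightarrow> Suc i < n \<Longrightarrow> K \<in> \<H> \<Longrightarrow> \<sigma> ! Suc i \<subset> K \<Longrightarrow> K \<subset> \<sigma> ! i \<Longrightarrow> False"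
    and comparable: "\<sigma> \<in> \<S> \<Longrightarrow> \<tau> \<in> \<S> \<Longrightarrow> H \<in> set \<sigma> \<Longrightarrow> K \<in> set \<tau> \<Longrightarrow> x \<in> \<Omega> \<Longrightarrow>
      x \<notin> H \<Longrightarrow> x \<notin> K \<Longrightarrow> y \<in> H \<Longrightarrow> y \<in> K \<Longrightarrow> H \<subseteq> K \<or> K \<subseteq> H"
    and finite_between: "x \<in> \<Omega> \<Longrightarrow> y \<in> \<Omega> \<Longrightarrow> finite {H \<in> \<H>. x \<notin> H \<and> y \<in> H}"
    and last_marked: "\<sigma> \<in> \<S> \<Longrightarrow> \<tau> \<in> \<S> \<Longrightarrow> j < n \<Longrightarrow> \<sigma> ! (n - 1) = \<tau> ! j \<Longrightarrow> j = n - 1"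
begin

definition between :: "'a \<Rightarrow> 'a \<Rightarrow> 'a set list set" where
  "between x y = {\<sigma> \<in> \<S>. \<forall>H\<in>set \<sigma>. x \<notin> H \<and> y \<in> H}"

definition omega :: "'a \<Rightarrow> 'a \<Rightarrow> real" where
  "omega x y = real (card (between x y)) - real (card (between y x))"

lemma omega_swap: "omega y x = - omega x y"
  by (simp add: omega_def)

lemma finite_between_segments:
  assumes "x \<in> \<Omega>" "y \<in> \<Omega>"
  shows "finite (between x y)"
proof -
  have "between x y \<subseteq> {\<sigma>. set \<sigma> \<subseteq> {H \<in> \<H>. x \<notin> H \<and> y \<in> H} \<and> length \<sigma> = n}"
    using members len unfolding between_def by blast
  then show ?thesis using finite_lists_length_eq[OF finite_between[OF assms]] finite_subset by blast
qed

lemma betweenD: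
  assumes "\<sigma> \<in> between x y" "i < n"
  shows "\<sigma> \<in> \<S>" "\<sigma> ! i \<in> set \<sigma>" "\<sigma> ! i \<in> \<H>" "x \<notin> \<sigma> ! i" "y \<in> \<sigma> ! i"
proof -
  show \<sigma>: "\<sigma> \<in> \<S>" using assms by (simp add: between_def)
  show "\<sigma> ! i \<in> set \<sigma>" using len[OF \<sigma>] assms by simp
  then show "\<sigma> ! i \<in> \<H>" "x \<notin> \<sigma> ! i" "y \<in> \<sigma> ! i"
    using members[OF \<sigma>] assms(1) by (auto simp: between_def)
qed

lemma between_comparable:
  assumes "x \<in> \<Omega>" "\<sigma> \<in> between x y" "\<tau> \<in> between x y" "i < n" "j < n"
  shows "\<sigma> ! i \<subseteq> \<tau> ! j \<or> \<tau> ! j \<subseteq> \<sigma> ! i"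
  using comparable[of \<sigma> \<tau> "\<sigma> ! i" "\<tau> ! j" x y] betweenD[OF assms(2,4)] betweenD[OF assms(3,5)] assms(1)
  by simp

text \<open>Both next entries separate \<open>x\<close> from \<open>y\<close>, hence are comparable.
  If one contained the other strictly, it would sit strictly between two consecutive entries of the
  other chain, against tightness.\<close>

lemma align_down:
  assumes x: "x \<in> \<Omega>" and \<sigma>: "\<sigma> \<in> between x y" and \<tau>: "\<tau> \<in> between x y"
    and i: "Suc i < n" and j: "Suc j < n" and eq: "\<sigma> ! i = \<tau> ! j"
  shows "\<sigma> ! Suc i = \<tau> ! Suc j"
proof -
  note S = betweenD(1)[OF \<sigma> i] betweenD(1)[OF \<tau> j]
  have "\<not> \<sigma> ! Suc i \<subset> \<tau> ! Suc j"
    using tight[OF S(1) i betweenD(3)[OF \<tau> j]] nested[OF S(2) j] eq by auto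
  moreover have "\<not> \<tau> ! Suc j \<subset> \<sigma> ! Suc i"
    using tight[OF S(2) j betweenD(3)[OF \<sigma> i]] nested[OF S(1) i] eq by auto
  ultimately show ?thesis using between_comparable[OF x \<sigma> \<tau> i j] by blast
qed

lemma align_up:
  assumes x: "x \<in> \<Omega>" and \<sigma>: "\<sigma> \<in> between x y" and \<tau>: "\<tau> \<in> between x y"
    and i: "Suc i < n" and j: "Suc j < n" and eq: "\<sigma> ! Suc i = \<tau> ! Suc j"
  shows "\<sigma> ! i = \<tau> ! j"
proof -
  have i': "i < n" and j': "j < n" using i j by auto
  note S = betweenD(1)[OF \<sigma> i] betweenD(1)[OF \<tau> j]
  have "\<not> \<sigma> ! i \<subset> \<tau> ! j"
    using tight[OF S(2) j betweenD(3)[OF \<sigma> i']] nested[OF S(1) i] eq by auto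
  moreover have "\<not> \<tau> ! j \<subset> \<sigma> ! i"
    using tight[OF S(1) i betweenD(3)[OF \<tau> j']] nested[OF S(2) j] eq by auto
  ultimately show ?thesis using between_comparable[OF x \<sigma> \<tau> i' j'] by blast
qed

lemma align_down_add:
  assumes "x \<in> \<Omega>" "\<sigma> \<in> between x y" "\<tau> \<in> between x y" "\<sigma> ! i = \<tau> ! j" "i + k < n" "j + k < n"
  shows "\<sigma> ! (i + k) = \<tau> ! (j + k)"
  using assms(5,6)
proof (induction k)
  case (Suc k)
  then show ?case using align_down[OF assms(1-3), of "i + k" "j + k"] by simp
qed (use assms(4) in simp)

lemma align_up_add:
  assumes "x \<in> \<Omega>" "\<sigma> \<in> between x y" "\<tau> \<in> between x y" "\<sigma> ! (i + k) = \<tau> ! (j + k)" "i + k < n" "j + k < n"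
  shows "\<sigma> ! i = \<tau> ! j"
  using assms(4-6)
proof (induction k)
  case (Suc k)
  then show ?case using align_up[OF assms(1-3), of "i + k" "j + k"] by simp
qed simp

lemma eq_if_common_entry:
  assumes x: "x \<in> \<Omega>" and \<sigma>: "\<sigma> \<in> between x y" and \<tau>: "\<tau> \<in> between x y" and i: "i < n" and eq: "\<sigma> ! i = \<tau> ! i"
  shows "\<sigma> = \<tau>"
proof (rule nth_equalityI)
  note S = betweenD(1)[OF \<sigma> i] betweenD(1)[OF \<tau> i]
  show "length \<sigma> = length \<tau>" using S len by simp
  fix k assume "k < length \<sigma>"
  then have k: "k < n" using S len by simp
  have "\<sigma> ! 0 = \<tau> ! 0" using align_up_add[OF x \<sigma> \<tau>, of 0 i 0] eq i by simp
  then show "\<sigma> ! k = \<tau> ! k" using align_down_add[OF x \<sigma> \<tau>, of 0 0 k] k by simp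
qed

text \<open>Chains with a common entry agree from there on down, so they end together because only last
  entries can equal a last entry; hence the entry has the same index in both.\<close>

lemma between_disjoint:
  assumes x: "x \<in> \<Omega>" and \<sigma>: "\<sigma> \<in> between x y" and \<tau>: "\<tau> \<in> between x y" and "\<sigma> \<noteq> \<tau>"
  shows "set \<sigma> \<inter> set \<tau> = {}"
proof (rule ccontr)
  have le: "i \<le> j" if "\<sigma> ! i = \<tau> ! j" "i < n" "j < n" "\<sigma> \<in> between x y" "\<tau> \<in> between x y" for i j \<sigma> \<tau>
  proof (rule ccontr)
    assume "\<not> i \<le> j"
    \<comment> \<open>\<open>k\<close> is the number of entries of \<open>\<sigma>\<close> below
      index \<open>i\<close>. Descending \<open>k\<close> places in both chains reaches the last
      entry of \<open>\<sigma>\<close>, but an earlier one of \<open>\<tau>\<close>.\<close>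
    moreover obtain k where k: "i + k = n - 1" using \<open>i < n\<close> by (metis Suc_pred' le_add_diff_inverse less_Suc_eq_le pos)
    ultimately have jk: "j + k < n - 1" "j + k < n" by simp_all
    have "\<sigma> ! (n - 1) = \<tau> ! (j + k)"
      using align_down_add[OF x that(4,5,1), of k] k jk by simp
    then show False
      using last_marked[of \<sigma> \<tau> "j + k"] betweenD(1)[OF that(4,2)] betweenD(1)[OF that(5,2)] jk by simp
  qed
  note S = betweenD(1)[OF \<sigma> pos] betweenD(1)[OF \<tau> pos]
  assume "set \<sigma> \<inter> set \<tau> \<noteq> {}"
  then obtain H where "H \<in> set \<sigma>" "H \<in> set \<tau>" by blast
  then obtain i j where ij: "i < n" "j < n" "\<sigma> ! i = \<tau> ! j"
    using len[OF S(1)] len[OF S(2)] unfolding in_set_conv_nth by metis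
  then have "i = j" using le[OF ij(3,1,2) \<sigma> \<tau>] le[OF ij(3)[symmetric] ij(2,1) \<tau> \<sigma>] by simp
  then show False using eq_if_common_entry[OF x \<sigma> \<tau> ij(1)] ij \<open>\<sigma> \<noteq> \<tau>\<close> by simp
qed

lemma antimono_nth:
  assumes "\<sigma> \<in> \<S>" "i \<le> j" "j < n"
  shows "\<sigma> ! j \<subseteq> \<sigma> ! i"
  using assms(2,3)
proof (induction rule: dec_induct)
  case (step k)
  then show ?case using nested[OF assms(1), of k] by auto
qed simp

section \<open>Chains cut by a third vertex\<close>

definition cut :: "'a \<Rightarrow> 'a \<Rightarrow> 'a \<Rightarrow> 'a set list set" where
  "cut x y z = {\<sigma> \<in> between x y. z \<in> \<sigma> ! 0 \<and> z \<notin> \<sigma> ! (n - 1)}"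

text \<open>A chain cut by \<open>z\<close> is determined by the index of its smallest entry containing \<open>z\<close>.\<close>

lemma card_cut:
  assumes x: "x \<in> \<Omega>" and y: "y \<in> \<Omega>"
  shows "card (cut x y z) \<le> n"
proof -
  have "\<exists>i. Suc i < n \<and> z \<in> \<sigma> ! i \<and> z \<notin> \<sigma> ! Suc i" if "\<sigma> \<in> cut x y z" for \<sigma>
  proof (rule ccontr)
    assume none: "\<not> (\<exists>i. Suc i < n \<and> z \<in> \<sigma> ! i \<and> z \<notin> \<sigma> ! Suc i)"
    have "z \<in> \<sigma> ! k" if "k < n" for k
      using that
    proof (induction k)
      case (Suc k)
      then show ?case using none by auto
    qed (use \<open>\<sigma> \<in> cut x y z\<close> in \<open>simp add: cut_def\<close>)
    then show False using that pos by (simp add: cut_def)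
  qed
  then obtain f where f: "\<And>\<sigma>. \<sigma> \<in> cut x y z \<Longrightarrow> Suc (f \<sigma>) < n \<and> z \<in> \<sigma> ! f \<sigma> \<and> z \<notin> \<sigma> ! Suc (f \<sigma>)"
    by metis
  have "inj_on f (cut x y z)"
  proof (rule inj_onI)
    fix \<sigma> \<tau> assume \<sigma>: "\<sigma> \<in> cut x y z" and \<tau>: "\<tau> \<in> cut x y z" and eq: "f \<sigma> = f \<tau>"
    then have b: "\<sigma> \<in> between x y" "\<tau> \<in> between x y" by (auto simp: cut_def)
    \<comment> \<open>A strictly smaller candidate still contains \<open>z\<close>, which the next
      entry of the first chain does not, so it would violate tightness there. Hence the smallest
      entry containing \<open>z\<close> is the same set in all cut chains, and only its index
      varies.\<close>
    have no: "\<not> \<tau>' ! f \<tau>' \<subset> \<sigma>' ! f \<sigma>'"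
      if c: "\<sigma>' \<in> cut x y z" "\<tau>' \<in> cut x y z" and b: "\<sigma>' \<in> between x y" "\<tau>' \<in> between x y" for \<sigma>' \<tau>'
    proof
      assume less: "\<tau>' ! f \<tau>' \<subset> \<sigma>' ! f \<sigma>'"
      have i: "Suc (f \<sigma>') < n" "f \<tau>' < n" using f[OF c(1)] f[OF c(2)] by auto
      have "\<sigma>' ! Suc (f \<sigma>') \<subset> \<tau>' ! f \<tau>'"
        using between_comparable[OF x b i] f[OF c(1)] f[OF c(2)] by blast
      then show False using tight[OF betweenD(1)[OF b(1) i(1)] i(1) betweenD(3)[OF b(2) i(2)]] less by blast
    qed
    have i: "f \<sigma> < n" "f \<tau> < n" using f[OF \<sigma>] f[OF \<tau>] by auto
    have "\<sigma> ! f \<sigma> = \<tau> ! f \<tau>"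
      using no[OF \<sigma> \<tau> b] no[OF \<tau> \<sigma> b(2,1)] between_comparable[OF x b i] by blast
    then show "\<sigma> = \<tau>" using eq_if_common_entry[OF x b i(1)] eq by simp
  qed
  moreover have "f ` cut x y z \<subseteq> {..<n}" using f by force
  ultimately show ?thesis using card_inj_on_le[of f "cut x y z" "{..<n}"] by simp
qed

text \<open>The entries decrease, so it is enough to test \<open>z\<close> at the two ends: outside
  the largest it is outside all, inside the smallest it is inside all, and otherwise it cuts the
  chain.\<close>

lemma card_between:
  assumes x: "x \<in> \<Omega>" and y: "y \<in> \<Omega>"
  shows "card (between x y) =
    card (between x y \<inter> between z y) + card (between x y \<inter> between x z) + card (cut x y z)"
proof -
  let ?A = "between x y \<inter> between z y" and ?B = "between x y \<inter> between x z"
  have fin: "finite ?A" "finite ?B" "finite (cut x y z)"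
    using finite_between_segments[OF assms] by (auto simp: cut_def)
  have "between x y = (?A \<union> ?B) \<union> cut x y z"
  proof (intro equalityI subsetI)
    fix \<sigma> assume \<sigma>: "\<sigma> \<in> between x y"
    note S = betweenD(1)[OF \<sigma> pos]
    consider "z \<notin> \<sigma> ! 0" | "z \<in> \<sigma> ! (n - 1)" | "z \<in> \<sigma> ! 0" "z \<notin> \<sigma> ! (n - 1)" by blast
    then show "\<sigma> \<in> (?A \<union> ?B) \<union> cut x y z"
    proof cases
      case 1
      then have "\<forall>H\<in>set \<sigma>. z \<notin> H"
        using antimono_nth[OF S, of 0] len[OF S] by (fastforce simp: in_set_conv_nth)
      then show ?thesis using \<sigma> by (auto simp: between_def)
    next
      case 2
      have "z \<in> \<sigma> ! i" if "i < n" for i 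
      proof -
        have "i \<le> n - 1" "n - 1 < n" using that by linarith+
        then show ?thesis using antimono_nth[OF S, of i "n - 1"] 2 by blast
      qed
      then have "\<forall>H\<in>set \<sigma>. z \<in> H" using len[OF S] by (auto simp: in_set_conv_nth)
      then show ?thesis using \<sigma> by (auto simp: between_def)
    next
      case 3
      then show ?thesis using \<sigma> by (simp add: cut_def)
    qed
  qed (auto simp: cut_def)
  moreover have "?A \<inter> ?B = {}"
    using betweenD(4,5)[OF _ pos] by blast
  moreover have "(?A \<union> ?B) \<inter> cut x y z = {}"
  proof -
    have "z \<notin> \<sigma> ! 0" if "\<sigma> \<in> between z y" for \<sigma> using betweenD(4)[OF that pos] .
    moreover have "z \<in> \<sigma> ! (n - 1)" if "\<sigma> \<in> between x z" for \<sigma> using betweenD(5)[OF that] pos by simp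
    ultimately show ?thesis by (auto simp: cut_def)
  qed
  ultimately show ?thesis using fin card_Un_disjoint by (metis finite_UnI)
qed

text \<open>Each uncut contribution is an intersection appearing once with each sign. Of the six cut
  terms three are positive and three negative, each between 0 and \<open>n\<close>, so the bound is
  \<open>3 * n\<close> and not \<open>6 * n\<close>.\<close>

lemma omega_cocycle:
  assumes "x \<in> \<Omega>" "y \<in> \<Omega>" "z \<in> \<Omega>"
  shows "\<bar>omega x y + omega y z + omega z x\<bar> \<le> 3 * real n"
proof -
  have c: "real (card (cut x y z)) \<le> n" if "x \<in> \<Omega>" "y \<in> \<Omega>" for x y z
    using card_cut[OF that] by simp
  note comm = Int_commute[of "between x z" "between x y"] Int_commute[of "between y z" "between y x"]
    Int_commute[of "between z x" "between z y"] Int_commute[of "between y x" "between z x"]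
    Int_commute[of "between x y" "between z y"] Int_commute[of "between x z" "between y z"]
  have "omega x y + omega y z + omega z x =
      (real (card (cut x y z)) + real (card (cut y z x)) + real (card (cut z x y))) -
      (real (card (cut y x z)) + real (card (cut z y x)) + real (card (cut x z y)))"
    unfolding omega_def card_between[OF assms(1,2), of z] card_between[OF assms(2,3), of x]
      card_between[OF assms(3,1), of y] card_between[OF assms(2,1), of z]
      card_between[OF assms(3,2), of x] card_between[OF assms(1,3), of y] comm
    by simp
  then show ?thesis
    using c[OF assms(1,2), of z] c[OF assms(2,3), of x] c[OF assms(3,1), of y]
      c[OF assms(2,1), of z] c[OF assms(3,2), of x] c[OF assms(1,3), of y] by linarith
qed

end

section \<open>Segments along positive words in two non-adjacent generators\<close>

locale raag_pair = raag_graph V E for V :: "'v set" and E :: "'v set set" +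
  fixes a b :: 'v
  assumes a: "a \<in> V" and b: "b \<in> V" and ab: "a \<noteq> b" and not_edge: "{a, b} \<notin> E"
begin

abbreviation ab_letters :: "('v \<times> bool) set" where
  "ab_letters \<equiv> {(a, True), (b, True)}"

lemma ab_letters_in: "l \<in> ab_letters \<Longrightarrow> l \<in> letters"
  using a b by auto

lemma ab_words: "set w \<subseteq> ab_letters \<Longrightarrow> w \<in> raag_words V"
  using a b by (auto simp: raag_words_def)

lemma ab_label: "l \<in> ab_letters \<Longrightarrow> m \<in> ab_letters \<Longrightarrow> fst l = fst m \<or> {fst l, fst m} \<notin> E"
  using not_edge by (auto simp: insert_commute)

lemma mult_take_Suc:
  assumes "g \<in> carrier G" "w \<in> raag_words V" "i < length w"
  shows "g \<otimes>\<^bsub>G\<^esub> cls (take (Suc i) w) = (g \<otimes>\<^bsub>G\<^esub> cls (take i w)) \<cdot> (w ! i)"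
proof -
  have "take i w \<in> raag_words V" "[w ! i] \<in> raag_words V"
    using assms by (auto simp: raag_words_def dest: in_set_takeD)
  then show ?thesis
    using assms by (simp add: take_Suc_conv_app_nth step_def m_assoc flip: raag_mult)
qed

lemma mult_take_closed:
  "g \<in> carrier G \<Longrightarrow> set w \<subseteq> ab_letters \<Longrightarrow> g \<otimes>\<^bsub>G\<^esub> cls (take i w) \<in> carrier G"
  using ab_words[of "take i w"] set_take_subset[of i w] by simp

lemma nth_halves_ab:
  assumes "g \<in> carrier G" "set w \<subseteq> ab_letters" "i < length w"
  shows "halves g w ! i = half (g \<otimes>\<^bsub>G\<^esub> cls (take i w)) (w ! i)"
    and "w ! i \<in> ab_letters" and "w ! i \<in> letters"
proof -
  show "halves g w ! i = half (g \<otimes>\<^bsub>G\<^esub> cls (take i w)) (w ! i)"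
    using nth_halves assms ab_words by simp
  show "w ! i \<in> ab_letters" using assms nth_mem[of i w] by blast
  then show "w ! i \<in> letters" by (rule ab_letters_in)
qed

lemma halves_nested:
  assumes g: "g \<in> carrier G" and w: "set w \<subseteq> ab_letters" and i: "Suc i < length w"
  shows "halves g w ! Suc i \<subset> halves g w ! i"
    and "tightly_nested X (halves g w ! i) (halves g w ! Suc i)"
proof -
  define x where "x = g \<otimes>\<^bsub>G\<^esub> cls (take i w)"
  have x: "x \<in> carrier G" unfolding x_def using g w by (rule mult_take_closed)
  have l: "w ! i \<in> ab_letters" "w ! Suc i \<in> ab_letters"
    using w i nth_mem[of i w] nth_mem[of "Suc i" w] Suc_lessD[OF i] by blast+
  have "halves g w ! i = half x (w ! i)"
    using nth_halves[OF g ab_words[OF w], of i] i by (simp add: x_def)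
  moreover have "halves g w ! Suc i = half (x \<cdot> (w ! i)) (w ! Suc i)"
    using nth_halves[OF g ab_words[OF w] i] mult_take_Suc[OF g ab_words[OF w], of i] i by (simp add: x_def)
  moreover have "w ! Suc i \<noteq> inv_letter (w ! i)" using l by auto
  ultimately show "halves g w ! Suc i \<subset> halves g w ! i"
    "tightly_nested X (halves g w ! i) (halves g w ! Suc i)"
    using half_nested[OF x ab_letters_in ab_letters_in ab_label] l by simp_all
qed

lemma set_halves_ab:
  assumes "g \<in> carrier G" "set w \<subseteq> ab_letters" "H \<in> set (halves g w)"
  obtains x l where "x \<in> carrier G" "l \<in> ab_letters" "l \<in> letters" "H = half x l"
  using set_halves[OF assms(1) ab_words[OF assms(2)] assms(3)] assms(2) by blast

definition word :: "nat \<Rightarrow> ('v \<times> bool) list" where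
  "word j = replicate (Suc j) (a, True) @ [(b, True)]"

lemma length_word [simp]: "length (word j) = j + 2"
  by (simp add: word_def)

lemma set_word: "set (word j) \<subseteq> ab_letters"
  by (auto simp: word_def)

lemma nth_word: "i < j + 2 \<Longrightarrow> word j ! i = (if i = Suc j then (b, True) else (a, True))"
  by (auto simp: word_def nth_append simp del: replicate_Suc)

definition \<gamma> :: "nat \<Rightarrow> ('v \<times> bool) list set set list" where
  "\<gamma> j = halves \<one>\<^bsub>G\<^esub> (word j)"

lemma segment_\<gamma>: "segment X (\<gamma> j)"
proof -
  have "length (\<gamma> j) = j + 2" by (simp add: \<gamma>_def)
  then have "\<gamma> j \<noteq> []" by auto
  moreover have "set (\<gamma> j) \<subseteq> half_spaces X"
    unfolding \<gamma>_def using set_halves_ab[OF one_closed set_word] half_in_half_spaces by (metis subsetI)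
  ultimately show ?thesis
    using halves_nested[OF one_closed set_word, of _ j]
    by (simp add: segment_def successively_conv_nth \<gamma>_def)
qed

definition family :: "nat \<Rightarrow> ('v \<times> bool) list set set list set" where
  "family j = {halves g (word j) | g. g \<in> carrier G}"

lemma translates_\<gamma>: "translates G act (\<gamma> j) = family j"
proof -
  have "map (\<lambda>H. act g ` H) (\<gamma> j) = halves g (word j)" if "g \<in> carrier G" for g
    using halves_translate[OF that one_closed ab_words[OF set_word]] that by (simp add: \<gamma>_def)
  then show ?thesis unfolding translates_def family_def by force
qed

sublocale fam: segment_family "carrier G" "half_spaces X" "family j" "j + 2" for j
proof
  show "0 < j + 2" by simp
  fix \<sigma> assume "\<sigma> \<in> family j"
  then obtain g where g: "g \<in> carrier G" and \<sigma>: "\<sigma> = halves g (word j)" by (auto simp: family_def)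
  show "length \<sigma> = j + 2" by (simp add: \<sigma>)
  show "set \<sigma> \<subseteq> half_spaces X"
    unfolding \<sigma> using set_halves_ab[OF g set_word] half_in_half_spaces by (metis subsetI)
  show nest: "\<sigma> ! Suc i \<subset> \<sigma> ! i" if "Suc i < j + 2" for i
    unfolding \<sigma> using halves_nested(1)[OF g set_word, of i j] that by simp
  show False if "Suc i < j + 2" "K \<in> half_spaces X" "\<sigma> ! Suc i \<subset> K" "K \<subset> \<sigma> ! i" for i K
    using halves_nested(2)[OF g set_word, of i j] nest[OF that(1)] that
    unfolding \<sigma> tightly_nested_def by auto
  fix \<tau> assume "\<tau> \<in> family j"
  then obtain g' where g': "g' \<in> carrier G" and \<tau>: "\<tau> = halves g' (word j)" by (auto simp: family_def)
  show "H \<subseteq> K \<or> K \<subseteq> H" if H: "H \<in> set \<sigma>" and K: "K \<in> set \<tau>" and "x \<in> carrier G"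
    "x \<notin> H" "x \<notin> K" "y \<in> H" "y \<in> K" for H K x y
  proof -
    obtain p l where p: "p \<in> carrier G" "l \<in> ab_letters" "l \<in> letters" "H = half p l"
      using set_halves_ab[OF g set_word] H unfolding \<sigma> .
    obtain q m where q: "q \<in> carrier G" "m \<in> ab_letters" "m \<in> letters" "K = half q m"
      using set_halves_ab[OF g' set_word] K unfolding \<tau> .
    show ?thesis
      using half_comparable[OF p(1,3) q(1,3) ab_label[OF p(2) q(2)]] that p q by simp
  qed
  \<comment> \<open>Equal half-spaces have equal labels, and the label \<open>b\<close> occurs in
    the word at the last position alone.\<close>
  show "i = j + 2 - 1" if "i < j + 2" "\<sigma> ! (j + 2 - 1) = \<tau> ! i" for i
  proof -
    have k: "Suc j < length (word j)" "i < length (word j)" using that(1) by simp_all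
    note g = mult_take_closed[OF g set_word, of "Suc j" j] mult_take_closed[OF g' set_word, of i j]
      nth_halves_ab[OF g set_word k(1)] nth_halves_ab[OF g' set_word k(2)]
    have "half (g \<otimes>\<^bsub>G\<^esub> cls (take (Suc j) (word j))) (word j ! Suc j) =
        half (g' \<otimes>\<^bsub>G\<^esub> cls (take i (word j))) (word j ! i)"
      using that(2) unfolding \<sigma> \<tau> by (simp flip: g(3,6))
    then have "word j ! Suc j = word j ! i" by (rule half_label[OF g(1,5,2,8)])
    then show ?thesis using that(1) ab by (simp add: nth_word split: if_splits)
  qed
next
  fix x y assume "x \<in> carrier G" "y \<in> carrier G"
  then show "finite {H \<in> half_spaces X. x \<notin> H \<and> y \<in> H}"
    using finite_separators[of x y] by (simp add: separators_def opp_half_def verts_eq conj_commute)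
qed

section \<open>Counting translates of a segment and of its inverse\<close>

lemma separators_iff:
  "x \<in> carrier G \<Longrightarrow> H \<in> separators X x y \<longleftrightarrow> H \<in> half_spaces X \<and> x \<notin> H \<and> y \<in> H"
  by (auto simp: separators_def opp_half_def verts_eq)

lemma between_eq:
  "x \<in> carrier G \<Longrightarrow> fam.between j x y = {\<sigma> \<in> family j. set \<sigma> \<subseteq> separators X x y}"
  unfolding fam.between_def using fam.members[of _ j]
  by (intro Collect_cong) (auto simp: separators_iff subset_iff)

lemma half_spaces_subset: "H \<in> half_spaces X \<Longrightarrow> H \<subseteq> carrier G"
  by (erule half_spacesE) (simp add: half_subset)

lemma family_subsets: "\<sigma> \<in> family j \<Longrightarrow> H \<in> set \<sigma> \<Longrightarrow> H \<subseteq> carrier G"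
  using fam.members[of \<sigma> j] half_spaces_subset by (meson subsetD)

lemma family_not_transverse:
  assumes "\<sigma> \<in> family j" "\<tau> \<in> family j" "H \<in> set \<sigma>" "K \<in> set \<tau>"
  shows "\<not> transverse X H K"
proof -
  obtain g g' where g: "g \<in> carrier G" "\<sigma> = halves g (word j)" "g' \<in> carrier G" "\<tau> = halves g' (word j)"
    using assms by (auto simp: family_def)
  obtain p l where p: "p \<in> carrier G" "l \<in> ab_letters" "l \<in> letters" "H = half p l"
    using set_halves_ab[OF g(1) set_word] assms(3) unfolding g .
  obtain q m where q: "q \<in> carrier G" "m \<in> ab_letters" "m \<in> letters" "K = half q m"
    using set_halves_ab[OF g(3) set_word] assms(4) unfolding g .
  show ?thesis using not_transverse[OF p(1,3) q(1,3) ab_label[OF p(2) q(2)]] p q by simp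
qed

lemma not_overlap:
  assumes "x \<in> carrier G" "\<sigma> \<in> fam.between j x y" "\<tau> \<in> fam.between j x y" "\<sigma> \<noteq> \<tau>"
  shows "\<not> overlap X \<sigma> \<tau>"
proof -
  have "\<sigma> \<in> family j" "\<tau> \<in> family j" using assms by (auto simp: fam.between_def)
  then show ?thesis
    using fam.between_disjoint[OF assms] family_not_transverse unfolding overlap_def by blast
qed

text \<open>If no two admissible translates overlap, the set of all of them is the largest
  collection. Its finiteness bounds the cardinalities under \<open>Max\<close>.\<close>

lemma seg_count_eq_card:
  assumes T: "T = {\<sigma> \<in> translates G act \<sigma>\<^sub>0. set \<sigma> \<subseteq> separators X x y}" and "finite T"
    and "pairwise (\<lambda>\<sigma> \<tau>. \<not> overlap X \<sigma> \<tau>) T"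
  shows "seg_count G act X \<sigma>\<^sub>0 x y = card T"
  unfolding seg_count_def
proof (rule Max_eqI)
  let ?S = "{card C |C. finite C \<and> C \<subseteq> translates G act \<sigma>\<^sub>0 \<and>
    (\<forall>\<sigma>\<in>C. set \<sigma> \<subseteq> separators X x y) \<and> pairwise (\<lambda>\<sigma> \<tau>. \<not> overlap X \<sigma> \<tau>) C}"
  have "C \<subseteq> T" if "C \<subseteq> translates G act \<sigma>\<^sub>0" "\<forall>\<sigma>\<in>C. set \<sigma> \<subseteq> separators X x y" for C
    using that T by blast
  then show le: "c \<le> card T" if "c \<in> ?S" for c
    using that \<open>finite T\<close> by (auto intro: card_mono)
  then show "finite ?S" by (meson finite_nat_set_iff_bounded_le)
  show "card T \<in> ?S"
    using assms by (intro CollectI exI[of _ T]) auto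
qed

lemma seg_count_\<gamma>:
  assumes "x \<in> carrier G" "y \<in> carrier G"
  shows "seg_count G act X (\<gamma> j) x y = card (fam.between j x y)"
proof (rule seg_count_eq_card)
  show "fam.between j x y = {\<sigma> \<in> translates G act (\<gamma> j). set \<sigma> \<subseteq> separators X x y}"
    using between_eq[OF assms(1)] by (simp add: translates_\<gamma>)
  show "finite (fam.between j x y)" using fam.finite_between_segments[OF assms] .
  show "pairwise (\<lambda>\<sigma> \<tau>. \<not> overlap X \<sigma> \<tau>) (fam.between j x y)"
    using not_overlap[OF assms(1)] by (auto simp: pairwise_def)
qed

lemma opp_opp: "H \<subseteq> carrier G \<Longrightarrow> opp_half X (opp_half X H) = H"
  by (auto simp: opp_half_def verts_eq)

lemma opp_half_spaces: "H \<in> half_spaces X \<Longrightarrow> opp_half X H \<in> half_spaces X"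
  by (erule half_spacesE) (simp add: half_opp half_in_half_spaces)

lemma opp_separators:
  assumes "x \<in> carrier G" "y \<in> carrier G" "H \<in> half_spaces X"
  shows "opp_half X H \<in> separators X x y \<longleftrightarrow> H \<in> separators X y x"
  using assms opp_half_spaces[OF assms(3)] by (auto simp: separators_iff opp_half_def verts_eq)

lemma opp_translate:
  assumes k: "k \<in> carrier G" and "H \<subseteq> carrier G"
  shows "act k ` opp_half X H = opp_half X (act k ` H)"
proof -
  have "inj_on (act k) (carrier G)" using k by (rule inj_on_cmult)
  moreover have "act k ` carrier G = carrier G"
  proof
    show "carrier G \<subseteq> act k ` carrier G"
    proof
      fix x assume "x \<in> carrier G"
      then show "x \<in> act k ` carrier G" using k by (intro image_eqI[of _ _ "act (inv\<^bsub>G\<^esub> k) x"]) simp_all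
    qed
  qed (use k in auto)
  ultimately show ?thesis
    using inj_on_image_set_diff[of "act k" "carrier G" "carrier G" H] assms by (simp add: opp_half_def verts_eq)
qed

lemma translates_inverse:
  "translates G act (inverse_segment X (\<gamma> j)) = inverse_segment X ` family j"
proof -
  have sub: "H \<subseteq> carrier G" if "H \<in> set (\<gamma> j)" for H
    using family_subsets[of "\<gamma> j" j] that by (auto simp: family_def \<gamma>_def)
  have "map ((`) (act g)) (inverse_segment X (\<gamma> j)) = inverse_segment X (map ((`) (act g)) (\<gamma> j))"
    if "g \<in> carrier G" for g
    using sub opp_translate[OF that] by (simp add: inverse_segment_def rev_map)
  then show ?thesis unfolding translates_\<gamma>[symmetric] translates_def by (force simp: image_image)
qed

lemma inverse_inverse:
  assumes "\<sigma> \<in> family j"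
  shows "inverse_segment X (inverse_segment X \<sigma>) = \<sigma>"
proof -
  have "map (opp_half X \<circ> opp_half X) \<sigma> = \<sigma>"
    using family_subsets[OF assms] opp_opp by (intro map_idI) simp
  then show ?thesis by (simp add: inverse_segment_def rev_map)
qed

lemma transverse_opp:
  assumes "H \<subseteq> carrier G" "K \<subseteq> carrier G"
  shows "transverse X (opp_half X H) (opp_half X K) \<longleftrightarrow> transverse X H K"
  using assms by (auto simp: transverse_def opp_opp)

text \<open>Taking complements and reversing the order exchanges the inverse chains from
  \<open>x\<close> to \<open>y\<close> with the original ones from \<open>y\<close> to
  \<open>x\<close>, and it preserves transversality and disjointness. This is what makes
  \<open>seg_omega\<close> antisymmetric in its end points.\<close>

lemma seg_count_inverse:
  assumes x: "x \<in> carrier G" and y: "y \<in> carrier G"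
  shows "seg_count G act X (inverse_segment X (\<gamma> j)) x y = card (fam.between j y x)"
proof -
  let ?T = "inverse_segment X ` fam.between j y x"
  have mem: "\<sigma> \<in> family j" if "\<sigma> \<in> fam.between j y x" for \<sigma> using that by (simp add: fam.between_def)
  have set_inv: "set (inverse_segment X \<sigma>) = opp_half X ` set \<sigma>" for \<sigma> by (simp add: inverse_segment_def)
  have "seg_count G act X (inverse_segment X (\<gamma> j)) x y = card ?T"
  proof (rule seg_count_eq_card)
    have "set (inverse_segment X \<sigma>) \<subseteq> separators X x y \<longleftrightarrow> set \<sigma> \<subseteq> separators X y x"
      if "\<sigma> \<in> family j" for \<sigma>
      using fam.members[OF that] opp_separators[OF x y] by (auto simp: set_inv)
    then show "?T = {\<sigma> \<in> translates G act (inverse_segment X (\<gamma> j)). set \<sigma> \<subseteq> separators X x y}"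
      unfolding translates_inverse between_eq[OF y] by blast
    show "finite ?T" using fam.finite_between_segments[OF y x] by simp
    have "\<not> overlap X (inverse_segment X \<sigma>) (inverse_segment X \<tau>)"
      if \<sigma>: "\<sigma> \<in> fam.between j y x" and \<tau>: "\<tau> \<in> fam.between j y x" and "\<sigma> \<noteq> \<tau>" for \<sigma> \<tau>
    proof -
      have sub: "H \<subseteq> carrier G" if "H \<in> set \<sigma> \<union> set \<tau>" for H
        using that family_subsets mem[OF \<sigma>] mem[OF \<tau>] by blast
      have "H = K" if "H \<in> set \<sigma>" "K \<in> set \<tau>" "opp_half X H = opp_half X K" for H K
      proof -
        have "opp_half X (opp_half X H) = opp_half X (opp_half X K)" using that(3) by simp
        then show ?thesis using opp_opp[OF sub, of H] opp_opp[OF sub, of K] that(1,2) by simp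
      qed
      then have "set (inverse_segment X \<sigma>) \<inter> set (inverse_segment X \<tau>) = {}"
        using fam.between_disjoint[OF y that] unfolding set_inv by blast
      moreover have "\<not> transverse X (opp_half X H) (opp_half X K)" if "H \<in> set \<sigma>" "K \<in> set \<tau>" for H K
        using family_not_transverse[OF mem[OF \<sigma>] mem[OF \<tau>] that] transverse_opp[of H K] sub that by simp
      ultimately show ?thesis by (auto simp: overlap_def set_inv)
    qed
    then show "pairwise (\<lambda>\<sigma> \<tau>. \<not> overlap X \<sigma> \<tau>) ?T" by (auto simp: pairwise_def)
  qed
  also have "card ?T = card (fam.between j y x)"
    using inverse_inverse mem by (intro card_image inj_on_inverseI[of _ "inverse_segment X"]) blast
  finally show ?thesis .
qed

lemma seg_omega_\<gamma>:
  "x \<in> carrier G \<Longrightarrow> y \<in> carrier G \<Longrightarrow> seg_omega G act X (\<gamma> j) x y = fam.omega j x y"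
  by (simp add: seg_omega_def seg_count_\<gamma> seg_count_inverse fam.omega_def)

text \<open>An inequality suffices: applied to \<open>k\<close> and to its inverse it gives the
  invariance of \<open>omega\<close>.\<close>

lemma card_between_translate_le:
  assumes k: "k \<in> carrier G" and x: "x \<in> carrier G" and y: "y \<in> carrier G"
  shows "card (fam.between j x y) \<le> card (fam.between j (act k x) (act k y))"
proof (rule card_inj_on_le)
  have mem: "H \<subseteq> carrier G" if "\<sigma> \<in> fam.between j x y" "H \<in> set \<sigma>" for \<sigma> H
    using that family_subsets by (auto simp: fam.between_def)
  have iff: "act k z \<in> act k ` H \<longleftrightarrow> z \<in> H" if "z \<in> carrier G" "H \<subseteq> carrier G" for z H
    using that k by (auto simp: subset_iff)
  show "map ((`) (act k)) ` fam.between j x y \<subseteq> fam.between j (act k x) (act k y)"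
  proof
    fix \<tau> assume "\<tau> \<in> map ((`) (act k)) ` fam.between j x y"
    then obtain \<sigma> where \<sigma>: "\<sigma> \<in> fam.between j x y" and \<tau>: "\<tau> = map ((`) (act k)) \<sigma>" by blast
    have "\<sigma> \<in> family j" using \<sigma> by (simp add: fam.between_def)
    then obtain g where g: "g \<in> carrier G" "\<sigma> = halves g (word j)" by (auto simp: family_def)
    have "\<tau> = halves (act k g) (word j)"
      using halves_translate[OF k g(1) ab_words[OF set_word]] by (simp add: \<tau> g(2))
    then have "\<tau> \<in> family j" using k g by (auto simp: family_def)
    moreover have "\<forall>H\<in>set \<tau>. act k x \<notin> H \<and> act k y \<in> H"
      using \<sigma> iff[OF x mem[OF \<sigma>]] iff[OF y mem[OF \<sigma>]] by (auto simp: \<tau> fam.between_def)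
    ultimately show "\<tau> \<in> fam.between j (act k x) (act k y)" by (simp add: fam.between_def)
  qed
  have "map ((`) (act (inv\<^bsub>G\<^esub> k))) (map ((`) (act k)) \<sigma>) = \<sigma>" if "\<sigma> \<in> fam.between j x y" for \<sigma>
  proof -
    have "act (inv\<^bsub>G\<^esub> k) ` act k ` H = H" if "H \<subseteq> carrier G" for H
      using that k by (force simp: image_image)
    then show ?thesis using mem[OF that] by (simp add: map_idI)
  qed
  then show "inj_on (map ((`) (act k))) (fam.between j x y)" by (rule inj_on_inverseI)
  show "finite (fam.between j (act k x) (act k y))" using fam.finite_between_segments k x y by simp
qed

lemma omega_translate:
  assumes k: "k \<in> carrier G" and x: "x \<in> carrier G" and y: "y \<in> carrier G"
  shows "fam.omega j (act k x) (act k y) = fam.omega j x y"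
proof -
  have "card (fam.between j (act k x) (act k y)) = card (fam.between j x y)"
    if "x \<in> carrier G" "y \<in> carrier G" for x y
    using card_between_translate_le[OF k that, of j]
      card_between_translate_le[of "inv\<^bsub>G\<^esub> k" "act k x" "act k y" j] k that by simp
  then show ?thesis using x y by (simp add: fam.omega_def)
qed

end

section \<open>Homogenization\<close>

lemma LIMSEQ_of_linear_error:
  fixes s :: "nat \<Rightarrow> real"
  assumes "\<And>n. \<bar>s n - real n * L\<bar> \<le> C"
  shows "(\<lambda>n. s n / real n) \<longlonglongrightarrow> L"
proof (rule LIM_zero_cancel, rule tendsto_rabs_zero_cancel,
    rule tendsto_sandwich[where f = "\<lambda>_. 0" and h = "\<lambda>n. C / real n"])
  show "\<forall>\<^sub>F n in sequentially. \<bar>s n / real n - L\<bar> \<le> C / real n"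
  proof (rule eventually_sequentiallyI[of 1])
    fix n :: nat assume n: "1 \<le> n"
    then have "s n / real n - L = (s n - real n * L) / real n" by (simp add: field_simps)
    then have "\<bar>s n / real n - L\<bar> = \<bar>s n - real n * L\<bar> / real n" by (simp add: abs_divide)
    then show "\<bar>s n / real n - L\<bar> \<le> C / real n"
      using assms[of n] by (simp add: divide_right_mono)
  qed
  show "(\<lambda>n. C / real n) \<longlonglongrightarrow> 0" by (rule lim_const_over_n)
qed simp_all

lemma zero_if_multiples_bounded:
  fixes c :: real
  assumes "\<And>m :: nat. \<bar>real m * c\<bar> \<le> C"
  shows "c = 0"
proof (rule ccontr)
  assume "c \<noteq> 0"
  then obtain m :: nat where "C < real m * \<bar>c\<bar>" using reals_Archimedean3[of "\<bar>c\<bar>"] by auto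
  then show False using assms[of m] by (simp add: abs_mult)
qed

text \<open>Comparing \<open>s (m * n)\<close> with both \<open>m * s n\<close> and
  \<open>n * s m\<close> bounds the distance of \<open>s m / m\<close> and \<open>s n / n\<close> by
  \<open>D / m + D / n\<close>. The quotients are therefore Cauchy, and \<open>L\<close> is their
  limit.\<close>

lemma quasi_additive_linear:
  fixes s :: "nat \<Rightarrow> real"
  assumes qa: "\<And>m n. \<bar>s (m + n) - s m - s n\<bar> \<le> D"
  shows "\<exists>L. \<forall>n. \<bar>s n - real n * L\<bar> \<le> D"
proof -
  have D: "0 \<le> D" using qa[of 0 0] by linarith
  have mult: "\<bar>s (Suc k * n) - real (Suc k) * s n\<bar> \<le> real (Suc k) * D" for k n
  proof (induction k)
    case (Suc k)
    have "\<bar>s (Suc (Suc k) * n) - s (Suc k * n) - s n\<bar> \<le> D"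
      using qa[of "Suc k * n" n] by (simp add: algebra_simps)
    then show ?case using Suc by (simp add: algebra_simps)
  qed (use D in simp)
  define r where "r n = s n / real n" for n
  have r: "\<bar>r m - r n\<bar> \<le> D / real m + D / real n" if "m > 0" "n > 0" for m n
  proof -
    have le: "\<bar>s (m * n) / real (m * n) - r n\<bar> \<le> D / real n" if "m > 0" "n > 0" for m n
    proof -
      have "\<bar>s (m * n) - real m * s n\<bar> \<le> real m * D" using mult[of "m - 1" n] that by simp
      then have "\<bar>s (m * n) - real m * s n\<bar> / real (m * n) \<le> real m * D / real (m * n)"
        by (intro divide_right_mono) auto
      moreover have "\<bar>s (m * n) - real m * s n\<bar> / real (m * n) = \<bar>s (m * n) / real (m * n) - r n\<bar>"
      proof -
        have "s (m * n) / real (m * n) - r n = (s (m * n) - real m * s n) / real (m * n)"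
          using that by (simp add: r_def field_simps)
        then show ?thesis by (simp add: abs_divide)
      qed
      ultimately show ?thesis using that by simp
    qed
    show ?thesis using le[OF that] le[OF that(2,1)] by (simp add: mult.commute)
  qed
  have "Cauchy r"
  proof (rule metric_CauchyI)
    fix e :: real assume e: "0 < e"
    obtain M :: nat where M: "2 * D < real M * e" using reals_Archimedean3[OF e] by blast
    then have "real M * e > 0" using D by linarith
    then have M0: "M > 0" using e by (simp add: zero_less_mult_iff)
    have "dist (r m) (r n) < e" if "m \<ge> M" "n \<ge> M" for m n
    proof -
      have "D / real m \<le> D / real M" "D / real n \<le> D / real M"
        using that D M0 by (auto intro!: divide_left_mono)
      then have "\<bar>r m - r n\<bar> \<le> 2 * D / real M" using r[of m n] that M0 by simp
      also have "\<dots> < e" using M M0 by (simp add: field_simps)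
      finally show ?thesis by (simp add: dist_real_def)
    qed
    then show "\<exists>M. \<forall>m\<ge>M. \<forall>n\<ge>M. dist (r m) (r n) < e" by blast
  qed
  then obtain L where L: "r \<longlonglongrightarrow> L" using real_Cauchy_convergent convergent_def by blast
  have "\<bar>s n - real n * L\<bar> \<le> D" for n
  proof (cases "n = 0")
    case True
    then show ?thesis using qa[of 0 0] by simp
  next
    case False
    \<comment> \<open>Letting \<open>m\<close> tend to infinity with \<open>n\<close> fixed leaves
      the error \<open>D / n\<close>, which becomes the constant \<open>D\<close> after
      multiplication by \<open>n\<close>.\<close>
    have "(\<lambda>m. \<bar>r m - r n\<bar>) \<longlonglongrightarrow> \<bar>L - r n\<bar>" by (intro tendsto_intros L)
    moreover have "(\<lambda>m. D / real m + D / real n) \<longlonglongrightarrow> 0 + D / real n"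
      by (intro tendsto_intros lim_const_over_n)
    moreover have "\<exists>N. \<forall>m\<ge>N. \<bar>r m - r n\<bar> \<le> D / real m + D / real n"
      using r False by (intro exI[of _ 1]) simp
    ultimately have "\<bar>L - r n\<bar> \<le> 0 + D / real n" by (rule LIMSEQ_le)
    then have "real n * \<bar>L - r n\<bar> \<le> D" using False by (simp add: field_simps)
    moreover have "real n * \<bar>L - r n\<bar> = \<bar>s n - real n * L\<bar>"
    proof -
      have "real n * \<bar>L - r n\<bar> = \<bar>real n * (L - r n)\<bar>" by (simp add: abs_mult)
      also have "real n * (L - r n) = real n * L - s n" using False by (simp add: r_def field_simps)
      finally show ?thesis by (simp add: abs_minus_commute)
    qed
    ultimately show ?thesis by simp
  qed
  then show ?thesis by blast
qed

context group
begin

lemma conj_pow: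
  assumes "x \<in> carrier G" "g \<in> carrier G"
  shows "(inv x \<otimes> g \<otimes> x) [^] (n :: nat) = inv x \<otimes> g [^] n \<otimes> x"
proof (induction n)
  case (Suc n)
  have "x \<otimes> (inv x \<otimes> (g \<otimes> x)) = g \<otimes> x" using assms by (simp flip: m_assoc)
  then show ?case using assms Suc by (simp add: m_assoc)
qed (use assms in simp)

text \<open>\<open>\<psi>' g\<close> is the only slope whose multiples stay at bounded distance from
  \<open>\<psi>\<close> on the powers of \<open>g\<close>. Compatibility with powers, inverses and
  conjugation thus reduces to exhibiting some bounded linear error.\<close>

lemma homogenize:
  assumes qm: "\<And>g h. g \<in> carrier G \<Longrightarrow> h \<in> carrier G \<Longrightarrow> \<bar>\<psi> (g \<otimes> h) - \<psi> g - \<psi> h\<bar> \<le> D"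
    and anti: "\<And>g. g \<in> carrier G \<Longrightarrow> \<psi> (inv g) = - \<psi> g"
  shows "\<exists>\<psi>'. \<psi>' \<in> hqm G \<and> (\<forall>g\<in>carrier G. \<bar>\<psi> g - \<psi>' g\<bar> \<le> D) \<and>
    (\<forall>x\<in>carrier G. \<forall>g\<in>carrier G. \<psi>' (inv x \<otimes> g \<otimes> x) = \<psi>' g)"
proof -
  have "\<exists>L. \<forall>n :: nat. \<bar>\<psi> (g [^] n) - real n * L\<bar> \<le> D" if g: "g \<in> carrier G" for g
    using quasi_additive_linear[of "\<lambda>n. \<psi> (g [^] n)" D] qm g by (simp flip: nat_pow_mult)
  then obtain \<psi>' where lin: "\<And>g n. g \<in> carrier G \<Longrightarrow> \<bar>\<psi> (g [^] (n :: nat)) - real n * \<psi>' g\<bar> \<le> D"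
    by metis
  have near: "\<bar>\<psi> g - \<psi>' g\<bar> \<le> D" if "g \<in> carrier G" for g using lin[OF that, of 1] that by simp
  have unique: "\<psi>' g = L" if g: "g \<in> carrier G" and L: "\<And>m :: nat. \<bar>\<psi> (g [^] m) - real m * L\<bar> \<le> C" for g L C
  proof -
    have "\<bar>real m * (\<psi>' g - L)\<bar> \<le> D + C" for m
      using lin[OF g, of m] L[of m] by (simp add: right_diff_distrib)
    then show ?thesis using zero_if_multiples_bounded by fastforce
  qed
  have pow: "\<psi>' (g [^] n) = real n * \<psi>' g" if g: "g \<in> carrier G" for g and n :: nat
  proof (rule unique)
    show "\<bar>\<psi> ((g [^] n) [^] m) - real m * (real n * \<psi>' g)\<bar> \<le> D" for m :: nat
      using lin[OF g, of "n * m"] g by (simp add: nat_pow_pow mult.commute mult.left_commute)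
  qed (use g in simp)
  have inv: "\<psi>' (inv g) = - \<psi>' g" if g: "g \<in> carrier G" for g
  proof (rule unique)
    show "\<bar>\<psi> ((inv g) [^] m) - real m * (- \<psi>' g)\<bar> \<le> D" for m :: nat
      using lin[OF g, of m] anti[of "g [^] m"] g by (simp add: nat_pow_inv abs_minus_commute)
  qed (use g in simp)
  have "homogeneous G \<psi>'"
    unfolding homogeneous_def
  proof (intro ballI allI)
    fix g and n :: int assume g: "g \<in> carrier G"
    show "\<psi>' (g [^] n) = of_int n * \<psi>' g"
    proof (cases n rule: int_cases2)
      case (nonneg k)
      then show ?thesis using pow[OF g, of k] by (simp add: int_pow_int)
    next
      case (nonpos k)
      then show ?thesis using pow[OF g, of k] inv[of "g [^] k"] g by (simp add: int_pow_neg int_pow_int)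
    qed
  qed
  moreover have "quasimorphism G \<psi>'"
  proof -
    \<comment> \<open>One \<open>D\<close> is the defect of \<open>\<psi>\<close>, the other three
      replace \<open>\<psi>\<close> by \<open>\<psi>'\<close> at the three arguments.\<close>
    have "\<bar>\<psi>' (g \<otimes> h) - \<psi>' g - \<psi>' h\<bar> \<le> 4 * D" if "g \<in> carrier G" "h \<in> carrier G" for g h
      using qm[OF that] near[OF that(1)] near[OF that(2)] near[of "g \<otimes> h"] that by simp
    then show ?thesis unfolding quasimorphism_def by blast
  qed
  moreover have "\<psi>' (inv x \<otimes> g \<otimes> x) = \<psi>' g" if x: "x \<in> carrier G" and g: "g \<in> carrier G" for x g
  proof (rule unique)
    \<comment> \<open>Splitting off the two conjugating factors costs \<open>2 * D\<close>, their
      values cancel by \<open>anti\<close>, and the linear estimate for \<open>g\<close> adds one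
      more \<open>D\<close>.\<close>
    show "\<bar>\<psi> ((inv x \<otimes> g \<otimes> x) [^] m) - real m * \<psi>' g\<bar> \<le> 3 * D" for m :: nat
      unfolding conj_pow[OF x g]
      using lin[OF g, of m] qm[of "inv x \<otimes> g [^] m" x] qm[of "inv x" "g [^] m"] anti[OF x] x g by simp
  qed (use x g in simp)
  ultimately show ?thesis using near by (auto simp: hqm_def)
qed

end

section \<open>The quasimorphisms and the choice of base vertices\<close>

context raag_pair
begin

text \<open>The cocycle bound for the triangle with vertices 1, \<open>g\<close> and their product
  with \<open>h\<close>: translation by \<open>g\<close> carries the side from 1 to \<open>h\<close>
  to its second side.\<close>

lemma omega_quasimorphism:
  assumes "g \<in> carrier G" "h \<in> carrier G"
  shows "\<bar>fam.omega j \<one>\<^bsub>G\<^esub> (g \<otimes>\<^bsub>G\<^esub> h) - fam.omega j \<one>\<^bsub>G\<^esub> g - fam.omega j \<one>\<^bsub>G\<^esub> h\<bar> \<le> 3 * real (j + 2)"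
  using fam.omega_cocycle[of "\<one>\<^bsub>G\<^esub>" g "g \<otimes>\<^bsub>G\<^esub> h" j] omega_translate[of g "\<one>\<^bsub>G\<^esub>" h j]
    fam.omega_swap[of j "\<one>\<^bsub>G\<^esub>" "g \<otimes>\<^bsub>G\<^esub> h"] assms by simp

lemma omega_inv:
  assumes "g \<in> carrier G"
  shows "fam.omega j \<one>\<^bsub>G\<^esub> (inv\<^bsub>G\<^esub> g) = - fam.omega j \<one>\<^bsub>G\<^esub> g"
  using omega_translate[of g "\<one>\<^bsub>G\<^esub>" "inv\<^bsub>G\<^esub> g" j] fam.omega_swap[of j "\<one>\<^bsub>G\<^esub>" g] assms by simp

lemma base_in_carrier:
  assumes "base_choice G act X base" "g \<in> carrier G"
  shows "base g \<in> carrier G"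
proof -
  have "comb_convex X (verts X)" by (simp add: comb_convex_def)
  then have "comb_hull X (min_set act X g) \<subseteq> verts X" by (auto simp: comb_hull_def min_set_def)
  then show ?thesis using assms by (auto simp: base_choice_def verts_eq)
qed

lemma seg_qm_\<gamma>:
  assumes base: "base_choice G act X base" and g: "g \<in> carrier G"
  shows "seg_qm G act X base (\<gamma> j) g = fam.omega j \<one>\<^bsub>G\<^esub> (inv\<^bsub>G\<^esub> (base g) \<otimes>\<^bsub>G\<^esub> g \<otimes>\<^bsub>G\<^esub> base g)"
  using omega_translate[of "inv\<^bsub>G\<^esub> (base g)" "base g" "g \<otimes>\<^bsub>G\<^esub> base g" j] base_in_carrier[OF base g] g
  by (simp add: seg_qm_def seg_omega_\<gamma> m_assoc)

text \<open>The base vertex, and with it the conjugator, may change with every power of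
  \<open>g\<close>. Since \<open>\<psi>\<close> is conjugation invariant and its distance from
  \<open>omega\<close> is bounded uniformly on the group, the error stays bounded in
  \<open>n\<close> and disappears in the quotient.\<close>

lemma homogenization_\<gamma>:
  obtains \<psi> where "\<psi> \<in> hqm G" "\<And>g. g \<in> carrier G \<Longrightarrow> \<bar>fam.omega j \<one>\<^bsub>G\<^esub> g - \<psi> g\<bar> \<le> 3 * real (j + 2)"
    "\<And>base g. base_choice G act X base \<Longrightarrow> g \<in> carrier G \<Longrightarrow>
      (\<lambda>n::nat. seg_qm G act X base (\<gamma> j) (g [^]\<^bsub>G\<^esub> n) / real n) \<longlonglongrightarrow> \<psi> g"
proof -
  obtain \<psi> where \<psi>: "\<psi> \<in> hqm G" and near: "\<And>g. g \<in> carrier G \<Longrightarrow> \<bar>fam.omega j \<one>\<^bsub>G\<^esub> g - \<psi> g\<bar> \<le> 3 * real (j + 2)"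
    and conj: "\<And>x g. x \<in> carrier G \<Longrightarrow> g \<in> carrier G \<Longrightarrow> \<psi> (inv\<^bsub>G\<^esub> x \<otimes>\<^bsub>G\<^esub> g \<otimes>\<^bsub>G\<^esub> x) = \<psi> g"
    using homogenize[of "fam.omega j \<one>\<^bsub>G\<^esub>" "3 * real (j + 2)"] omega_quasimorphism omega_inv by metis
  have pow: "\<psi> (g [^]\<^bsub>G\<^esub> n) = real n * \<psi> g" if "g \<in> carrier G" for g and n :: nat
  proof -
    have "\<psi> (g [^]\<^bsub>G\<^esub> int n) = of_int (int n) * \<psi> g" using \<psi> that unfolding hqm_def homogeneous_def by blast
    then show ?thesis by (simp add: int_pow_int)
  qed
  have "(\<lambda>n::nat. seg_qm G act X base (\<gamma> j) (g [^]\<^bsub>G\<^esub> n) / real n) \<longlonglongrightarrow> \<psi> g"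
    if base: "base_choice G act X base" and g: "g \<in> carrier G" for base g
  proof (rule LIMSEQ_of_linear_error)
    fix n :: nat
    let ?h = "g [^]\<^bsub>G\<^esub> n"
    have h: "?h \<in> carrier G" using g by simp
    have x: "base ?h \<in> carrier G" using base_in_carrier[OF base h] .
    show "\<bar>seg_qm G act X base (\<gamma> j) ?h - real n * \<psi> g\<bar> \<le> 3 * real (j + 2)"
      using near[of "inv\<^bsub>G\<^esub> (base ?h) \<otimes>\<^bsub>G\<^esub> ?h \<otimes>\<^bsub>G\<^esub> base ?h"] conj[OF x h] pow[OF g, of n] x h
      unfolding seg_qm_\<gamma>[OF base h] by simp
  qed
  then show ?thesis using \<psi> near that by blast
qed

section \<open>Values on powers of a^k b\<close>


definition occurrences :: "nat \<Rightarrow> ('v \<times> bool) list \<Rightarrow> nat set" where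
  "occurrences j w = {p. p + (j + 2) \<le> length w \<and> (\<forall>i<j + 2. w ! (p + i) = word j ! i)}"

lemma occurrences_nth: "p \<in> occurrences j w \<Longrightarrow> i < j + 2 \<Longrightarrow> w ! (p + i) = word j ! i"
  unfolding occurrences_def by blast

context
  fixes w :: "('v \<times> bool) list"
  assumes w: "set w \<subseteq> ab_letters"
begin

lemma halves_antimono:
  assumes "i < k" "k < length w"
  shows "halves \<one>\<^bsub>G\<^esub> w ! k \<subset> halves \<one>\<^bsub>G\<^esub> w ! i"
  using assms
proof (induction k)
  case (Suc k)
  then show ?case using halves_nested(1)[OF one_closed w, of k] by (cases "i = k") auto
qed simp

text \<open>Along a positive word the half-spaces decrease strictly. The start lies outside the
  largest and the end inside the smallest, so the path never leaves a half-space it has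
  entered.\<close>

lemma halves_separate:
  assumes "i < length w"
  shows "\<one>\<^bsub>G\<^esub> \<notin> halves \<one>\<^bsub>G\<^esub> w ! i" "cls w \<in> halves \<one>\<^bsub>G\<^esub> w ! i"
proof -
  have ends: "cls (take k w) \<notin> halves \<one>\<^bsub>G\<^esub> w ! k" "cls (take (Suc k) w) \<in> halves \<one>\<^bsub>G\<^esub> w ! k"
    if "k < length w" for k
  proof -
    have x: "cls (take k w) \<in> carrier G" using mult_take_closed[OF one_closed w, of k] ab_words[of "take k w"] w set_take_subset[of k w] by simp
    have wk: "take k w \<in> raag_words V" "take (Suc k) w \<in> raag_words V"
      using ab_words w set_take_subset by (meson order_trans)+
    show "cls (take k w) \<notin> halves \<one>\<^bsub>G\<^esub> w ! k" "cls (take (Suc k) w) \<in> halves \<one>\<^bsub>G\<^esub> w ! k"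
      using half_ends[OF x nth_halves_ab(3)[OF one_closed w that]] nth_halves_ab(1)[OF one_closed w that]
        mult_take_Suc[OF one_closed ab_words[OF w] that] wk x by simp_all
  qed
  show "\<one>\<^bsub>G\<^esub> \<notin> halves \<one>\<^bsub>G\<^esub> w ! i"
  proof (cases "i = 0")
    case True
    then show ?thesis using ends(1)[of 0] assms by (simp add: raag_one)
  next
    case False
    moreover have "0 < length w" using assms by linarith
    ultimately show ?thesis using ends(1)[of 0] halves_antimono[of 0 i] assms by (auto simp: raag_one)
  qed
  show "cls w \<in> halves \<one>\<^bsub>G\<^esub> w ! i"
  proof (cases "Suc i = length w")
    case True
    then show ?thesis using ends(2)[of i] by simp
  next
    case False
    then have "i < length w - 1" "length w - 1 < length w" using assms by linarith+
    then show ?thesis using ends(2)[of "length w - 1"] halves_antimono[of i "length w - 1"] by auto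
  qed
qed

lemma separators_positive: "separators X \<one>\<^bsub>G\<^esub> (cls w) = set (halves \<one>\<^bsub>G\<^esub> w)"
proof
  show "separators X \<one>\<^bsub>G\<^esub> (cls w) \<subseteq> set (halves \<one>\<^bsub>G\<^esub> w)"
    using separators_subset_halves[OF one_closed ab_words[OF w]] ab_words[OF w] by simp
  show "set (halves \<one>\<^bsub>G\<^esub> w) \<subseteq> separators X \<one>\<^bsub>G\<^esub> (cls w)"
  proof
    fix H assume H: "H \<in> set (halves \<one>\<^bsub>G\<^esub> w)"
    then obtain i where "i < length w" "H = halves \<one>\<^bsub>G\<^esub> w ! i" by (auto simp: in_set_conv_nth)
    moreover obtain x l where "x \<in> carrier G" "l \<in> ab_letters" "l \<in> letters" "H = half x l"
      using set_halves_ab[OF one_closed w H] .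
    ultimately show "H \<in> separators X \<one>\<^bsub>G\<^esub> (cls w)"
      using halves_separate[of i] half_in_half_spaces[of x l] by (simp add: separators_iff)
  qed
qed

text \<open>The complement of the first entry of such a chain would separate the identity from
  \<open>cls w\<close> and carry a negative label, whereas all half-spaces along \<open>w\<close>
  have positive labels.\<close>

lemma no_negative_segment: "fam.between j (cls w) \<one>\<^bsub>G\<^esub> = {}"
proof (rule ccontr)
  assume "fam.between j (cls w) \<one>\<^bsub>G\<^esub> \<noteq> {}"
  then obtain \<sigma> where \<sigma>: "\<sigma> \<in> fam.between j (cls w) \<one>\<^bsub>G\<^esub>" by blast
  have cw: "cls w \<in> carrier G" using ab_words[OF w] by simp
  have pos: "0 < j + 2" by simp
  note D = fam.betweenD[OF \<sigma> pos]
  obtain g where g: "g \<in> carrier G" "\<sigma> = halves g (word j)" using D(1) by (auto simp: family_def)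
  obtain x l where x: "x \<in> carrier G" "l \<in> ab_letters" "l \<in> letters" "\<sigma> ! 0 = half x l"
    using set_halves_ab[OF g(1) set_word] D(2) unfolding g(2) .
  have "opp_half X (\<sigma> ! 0) \<in> separators X \<one>\<^bsub>G\<^esub> (cls w)"
    using D cw opp_separators[OF one_closed cw D(3)] by (simp add: separators_iff)
  then have mem: "opp_half X (\<sigma> ! 0) \<in> set (halves \<one>\<^bsub>G\<^esub> w)" by (simp only: separators_positive)
  obtain y m where y: "y \<in> carrier G" "m \<in> ab_letters" "m \<in> letters" "opp_half X (\<sigma> ! 0) = half y m"
    using set_halves_ab[OF one_closed w mem] .
  have "half (x \<cdot> l) (inv_letter l) = half y m" using half_opp[OF x(1,3)] x(4) y(4) by simp
  then have "inv_letter l = m" by (rule half_label[rotated 4]) (use x y in simp_all)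
  then show False using x(2) y(2) by auto
qed

lemma halves_sub:
  assumes p: "p \<in> occurrences j w" and i: "i < j + 2"
  shows "halves (cls (take p w)) (word j) ! i = halves \<one>\<^bsub>G\<^esub> w ! (p + i)"
proof -
  have len: "p + (j + 2) \<le> length w" using p by (simp add: occurrences_def)
  have "take (j + 2) (drop p w) = word j"
    using p by (intro nth_equalityI) (auto simp: occurrences_def)
  then have split: "w = take p w @ word j @ drop (j + 2) (drop p w)" by (metis append_take_drop_id)
  have sub: "take p w \<in> raag_words V" "word j \<in> raag_words V"
    using ab_words w set_word set_take_subset by (meson order_trans)+
  then have "halves \<one>\<^bsub>G\<^esub> w = halves \<one>\<^bsub>G\<^esub> (take p w) @ halves (cls (take p w)) (word j) @
      halves (cls (take p w) \<otimes>\<^bsub>G\<^esub> cls (word j)) (drop (j + 2) (drop p w))"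
    by (subst split) (simp add: halves_append)
  then show ?thesis using len i by (simp add: nth_append)
qed

text \<open>All entries lie in the linearly ordered list of half-spaces along \<open>w\<close>.
  Nesting makes their positions increase, tightness forbids gaps, and the labels then spell out the
  word.\<close>

lemma segment_occurrence:
  assumes \<sigma>: "\<sigma> \<in> fam.between j \<one>\<^bsub>G\<^esub> (cls w)"
  obtains p where "p \<in> occurrences j w" "\<sigma> = halves (cls (take p w)) (word j)"
proof -
  let ?h = "halves \<one>\<^bsub>G\<^esub> w"
  have "set \<sigma> \<subseteq> set ?h" using \<sigma> between_eq[of "\<one>\<^bsub>G\<^esub>"] separators_positive by simp
  then have idx: "\<exists>q<length w. \<sigma> ! i = ?h ! q" if "i < j + 2" for i
    using fam.betweenD(2)[OF \<sigma> that] by (metis in_set_conv_nth length_halves subsetD)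
  have "\<sigma> \<in> family j" using \<sigma> by (simp add: fam.between_def)
  then obtain g where g: "g \<in> carrier G" "\<sigma> = halves g (word j)" by (auto simp: family_def)
  obtain p where p: "p < length w" "\<sigma> ! 0 = ?h ! p" using idx[of 0] by auto
  have pi: "p + i < length w \<and> \<sigma> ! i = ?h ! (p + i)" if "i < j + 2" for i
    using that
  proof (induction i)
    case (Suc i)
    then have IH: "p + i < length w" "\<sigma> ! i = ?h ! (p + i)" by auto
    obtain q where q: "q < length w" "\<sigma> ! Suc i = ?h ! q" using idx[OF Suc.prems] by blast
    have less: "?h ! q \<subset> ?h ! (p + i)" using fam.nested[OF \<open>\<sigma> \<in> family j\<close> Suc.prems] IH q by simp
    have "q > p + i"
    proof (rule ccontr)
      assume "\<not> p + i < q"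
      then have "?h ! (p + i) \<subseteq> ?h ! q" using halves_antimono[of q "p + i"] IH by (cases "q = p + i") auto
      then show False using less by blast
    qed
    moreover have "\<not> q > Suc (p + i)"
    proof
      assume *: "Suc (p + i) < q"
      have "?h ! Suc (p + i) \<in> half_spaces X"
        using separators_positive * q(1) separators_iff[OF one_closed] by (metis length_halves nth_mem order_less_trans)
      then show False
        using fam.tight[OF \<open>\<sigma> \<in> family j\<close> Suc.prems, of "?h ! Suc (p + i)"] IH q *
          halves_antimono[of "Suc (p + i)" q] halves_antimono[of "p + i" "Suc (p + i)"] by simp
    qed
    ultimately have "q = p + Suc i" by simp
    then show ?case using q by simp
  qed (use p in simp)
  have occ: "p \<in> occurrences j w"
  proof -
    have "w ! (p + i) = word j ! i" if i: "i < j + 2" for i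
    proof -
      have k: "p + i < length w" "i < length (word j)" using pi[OF i] i by simp_all
      note f = mult_take_closed[OF one_closed w, of "p + i"] mult_take_closed[OF g(1) set_word, of i j]
        nth_halves_ab[OF one_closed w k(1)] nth_halves_ab[OF g(1) set_word k(2)]
      have "half (\<one>\<^bsub>G\<^esub> \<otimes>\<^bsub>G\<^esub> cls (take (p + i) w)) (w ! (p + i)) = half (g \<otimes>\<^bsub>G\<^esub> cls (take i (word j))) (word j ! i)"
        using pi[OF i] unfolding g(2) f(3,6) by simp
      then show ?thesis by (rule half_label[OF f(1,5,2,8)])
    qed
    then show ?thesis using pi[of "j + 1"] by (simp add: occurrences_def)
  qed
  moreover have "\<sigma> = halves (cls (take p w)) (word j)"
    using pi halves_sub[OF occ] g(2) by (intro nth_equalityI) simp_all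
  ultimately show ?thesis by (rule that)
qed

lemma card_between_positive: "card (fam.between j \<one>\<^bsub>G\<^esub> (cls w)) = card (occurrences j w)"
proof -
  let ?f = "\<lambda>p. halves (cls (take p w)) (word j)"
  have "inj_on ?f (occurrences j w)"
  proof (rule inj_onI, rule ccontr)
    fix p q assume pq: "p \<in> occurrences j w" "q \<in> occurrences j w" "?f p = ?f q" "p \<noteq> q"
    then have "halves \<one>\<^bsub>G\<^esub> w ! p = halves \<one>\<^bsub>G\<^esub> w ! q" using halves_sub[of p j 0] halves_sub[of q j 0] by simp
    moreover have "p < length w" "q < length w" using pq by (auto simp: occurrences_def)
    ultimately show False using halves_antimono[of p q] halves_antimono[of q p] \<open>p \<noteq> q\<close> by (cases "p < q") auto
  qed
  moreover have "?f ` occurrences j w = fam.between j \<one>\<^bsub>G\<^esub> (cls w)"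
  proof
    show "?f ` occurrences j w \<subseteq> fam.between j \<one>\<^bsub>G\<^esub> (cls w)"
    proof
      fix \<sigma> assume "\<sigma> \<in> ?f ` occurrences j w"
      then obtain p where p: "p \<in> occurrences j w" "\<sigma> = ?f p" by blast
      have "take p w \<in> raag_words V" using ab_words w set_take_subset by (meson order_trans)
      then have "\<sigma> \<in> family j" unfolding family_def p(2) by (intro CollectI exI[of _ "cls (take p w)"]) simp
      moreover have "\<one>\<^bsub>G\<^esub> \<notin> H \<and> cls w \<in> H" if "H \<in> set \<sigma>" for H
      proof -
        obtain i where "i < j + 2" "H = \<sigma> ! i" using \<open>H \<in> set \<sigma>\<close> by (auto simp: in_set_conv_nth p(2))
        moreover have "p + (j + 2) \<le> length w" using p by (simp add: occurrences_def)
        ultimately show ?thesis using halves_sub[OF p(1), of i] halves_separate[of "p + i"] by (simp add: p(2))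
      qed
      ultimately show "\<sigma> \<in> fam.between j \<one>\<^bsub>G\<^esub> (cls w)" by (simp add: fam.between_def)
    qed
    show "fam.between j \<one>\<^bsub>G\<^esub> (cls w) \<subseteq> ?f ` occurrences j w"
    proof
      fix \<sigma> assume "\<sigma> \<in> fam.between j \<one>\<^bsub>G\<^esub> (cls w)"
      then obtain p where "p \<in> occurrences j w" "\<sigma> = ?f p" by (rule segment_occurrence)
      then show "\<sigma> \<in> ?f ` occurrences j w" by blast
    qed
  qed
  ultimately show ?thesis using card_image by metis
qed

lemma omega_positive: "fam.omega j \<one>\<^bsub>G\<^esub> (cls w) = real (card (occurrences j w))"
  by (simp add: fam.omega_def card_between_positive no_negative_segment)

end

text \<open>The \<open>n\<close>-th power of the test word, given position by position so that
  finding subwords becomes arithmetic modulo \<open>Suc k\<close>.\<close>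

definition periodic :: "nat \<Rightarrow> nat \<Rightarrow> ('v \<times> bool) list" where
  "periodic k n = map (\<lambda>i. if i mod Suc k = k then (b, True) else (a, True)) [0..<n * Suc k]"

lemma length_periodic [simp]: "length (periodic k n) = n * Suc k"
  by (simp add: periodic_def)

lemma set_periodic: "set (periodic k n) \<subseteq> ab_letters"
  by (auto simp: periodic_def)

lemma nth_periodic: "i < n * Suc k \<Longrightarrow> periodic k n ! i = (if i mod Suc k = k then (b, True) else (a, True))"
  by (simp add: periodic_def del: mult_Suc_right)

lemma periodic_Suc: "periodic k (Suc n) = periodic k n @ replicate k (a, True) @ [(b, True)]"
proof (rule nth_equalityI)
  fix i assume "i < length (periodic k (Suc n))"
  then have i: "i < Suc n * Suc k" by simp
  show "periodic k (Suc n) ! i = (periodic k n @ replicate k (a, True) @ [(b, True)]) ! i"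
  proof (cases "i < n * Suc k")
    case True
    then show ?thesis using i by (simp add: nth_append nth_periodic del: mult_Suc_right)
  next
    case False
    then obtain r where r: "i = n * Suc k + r" by (metis le_Suc_ex not_less)
    then have "r < Suc k" using i by simp
    then show ?thesis using i unfolding r
      by (auto simp: nth_append nth_periodic less_Suc_eq simp del: mult_Suc_right)
  qed
qed simp

lemma cls_periodic: "cls (periodic k n) = cls (replicate k (a, True) @ [(b, True)]) [^]\<^bsub>G\<^esub> n"
proof (induction n)
  case 0
  then show ?case by (simp add: periodic_def raag_one)
next
  case (Suc n)
  have "replicate k (a, True) @ [(b, True)] \<in> raag_words V" by (rule ab_words) auto
  then show ?case using Suc ab_words[OF set_periodic] by (simp add: periodic_Suc flip: raag_mult)
qed

text \<open>The last letter of the pattern must fall on the \<open>b\<close> closing a period. The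
  \<open>Suc j\<close> letters before it are all \<open>a\<close> exactly when they fit into that
  period, that is when \<open>j < k\<close>; then each period contributes one occurrence.\<close>

lemma card_occurrences: "card (occurrences j (periodic k n)) = (if j < k then n else 0)"
proof (cases "j < k")
  case True
  \<comment> \<open>The closing \<open>b\<close> of period \<open>q\<close> is at position
    \<open>q * Suc k + k\<close>, and the pattern starts \<open>Suc j\<close> places
    earlier.\<close>
  let ?f = "\<lambda>q. q * Suc k + (k - Suc j)"
  have "occurrences j (periodic k n) = ?f ` {..<n}"
  proof (intro equalityI subsetI)
    fix p assume p: "p \<in> occurrences j (periodic k n)"
    then have len: "p + (j + 2) \<le> n * Suc k" by (simp add: occurrences_def)
    have "periodic k n ! (p + Suc j) = word j ! Suc j" using p by (rule occurrences_nth) simp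
    then have "(p + Suc j) mod Suc k = k"
      using len ab by (simp add: nth_periodic nth_word del: mult_Suc_right split: if_splits)
    then have eq: "p + Suc j = (p + Suc j) div Suc k * Suc k + k" by (metis div_mult_mod_eq)
    define q where "q = (p + Suc j) div Suc k"
    have "p = ?f q" using eq True unfolding q_def[symmetric] by simp
    moreover have "q < n"
    proof (rule ccontr)
      assume "\<not> q < n"
      then have "n * Suc k \<le> q * Suc k" by (intro mult_le_mono1) simp
      then show False using eq len True unfolding q_def[symmetric] by linarith
    qed
    ultimately show "p \<in> ?f ` {..<n}" by blast
  next
    fix p assume "p \<in> ?f ` {..<n}"
    then obtain q where q: "q < n" "p = ?f q" by blast
    have "Suc q * Suc k \<le> n * Suc k" using q by (intro mult_le_mono1) simp
    then have len: "p + (j + 2) \<le> n * Suc k" using q True by simp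
    have "periodic k n ! (p + i) = word j ! i" if i: "i < j + 2" for i
    proof -
      have r: "p + i = q * Suc k + (k - Suc j + i)" "k - Suc j + i < Suc k" using q i True by auto
      then have "(p + i) mod Suc k = k - Suc j + i"
        unfolding r(1) by (simp del: mult_Suc_right)
      moreover have "k - Suc j + i = k \<longleftrightarrow> i = Suc j" using True by auto
      ultimately show ?thesis using len i by (simp add: nth_periodic nth_word del: mult_Suc_right)
    qed
    then show "p \<in> occurrences j (periodic k n)" using len by (simp add: occurrences_def)
  qed
  moreover have "inj_on ?f {..<n}" by (rule inj_onI) (simp del: mult_Suc_right)
  ultimately show ?thesis using True card_image by fastforce
next
  case False
  have "p \<notin> occurrences j (periodic k n)" for p
  proof
    assume p: "p \<in> occurrences j (periodic k n)"
    then have len: "p + (j + 2) \<le> n * Suc k" by (simp add: occurrences_def)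
    have "periodic k n ! (p + Suc j) = word j ! Suc j" using p by (rule occurrences_nth) simp
    then have m: "(p + Suc j) mod Suc k = k"
      using len ab by (simp add: nth_periodic nth_word del: mult_Suc_right split: if_splits)
    \<comment> \<open>One full period before the matched \<open>b\<close> there is another
      \<open>b\<close>; as \<open>k \<le> j\<close>, it still falls inside the pattern, where an
      \<open>a\<close> is required.\<close>
    have "p + Suc j = (p + (j - k)) + Suc k" using False by simp
    then have "(p + (j - k)) mod Suc k = k" using m by (metis mod_add_self2)
    then have "periodic k n ! (p + (j - k)) = (b, True)"
      using len by (simp add: nth_periodic del: mult_Suc_right)
    moreover have "periodic k n ! (p + (j - k)) = word j ! (j - k)" using p by (rule occurrences_nth) simp
    ultimately show False using ab by (auto simp: nth_word split: if_splits)
  qed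
  then have "occurrences j (periodic k n) = {}" by blast
  then show ?thesis using False by simp
qed

definition test :: "nat \<Rightarrow> ('v \<times> bool) list set" where
  "test k = cls (replicate k (a, True) @ [(b, True)])"

lemma test_closed: "test k \<in> carrier G"
  unfolding test_def by (intro cls_closed ab_words) auto

lemma test_Suc: "test (Suc k) = cls [(a, True)] \<otimes>\<^bsub>G\<^esub> test k"
proof -
  have "replicate k (a, True) @ [(b, True)] \<in> raag_words V" by (rule ab_words) auto
  then show ?thesis using raag_mult[of "[(a, True)]" V _ E] a by (simp add: test_def)
qed

lemma omega_test_pow: "fam.omega j \<one>\<^bsub>G\<^esub> (test k [^]\<^bsub>G\<^esub> (n :: nat)) = (if j < k then real n else 0)"
  using omega_positive[OF set_periodic, of j k n] card_occurrences[of j k n]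
  by (simp add: cls_periodic test_def)

end

section \<open>Linear independence modulo homomorphisms\<close>

lemma QH_tilde_sum:
  assumes "finite J" "\<And>j. j \<in> J \<Longrightarrow> \<psi> j \<in> hqm G"
  shows "(\<lambda>g. \<Sum>j\<in>J. c j * \<psi> j g) \<in> hqm G"
    and "(\<Oplus>\<^bsub>QH_tilde G\<^esub>j\<in>J. c j \<odot>\<^bsub>QH_tilde G\<^esub> hqm_class G (\<psi> j)) = hqm_class G (\<lambda>g. \<Sum>j\<in>J. c j * \<psi> j g)"
proof -
  interpret M: module real_ring "QH_tilde G" by (rule module_QH_tilde)
  have "(\<lambda>g. \<Sum>j\<in>J. c j * \<psi> j g) \<in> hqm G \<and>
    (\<Oplus>\<^bsub>QH_tilde G\<^esub>j\<in>J. c j \<odot>\<^bsub>QH_tilde G\<^esub> hqm_class G (\<psi> j)) = hqm_class G (\<lambda>g. \<Sum>j\<in>J. c j * \<psi> j g)"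
    using assms
  proof (induction J rule: finite_induct)
    case empty
    then show ?case using M.finsum_empty by (simp add: hqm_zero QH_tilde_zero)
  next
    case (insert i J)
    then have IH: "(\<lambda>g. \<Sum>j\<in>J. c j * \<psi> j g) \<in> hqm G"
      "(\<Oplus>\<^bsub>QH_tilde G\<^esub>j\<in>J. c j \<odot>\<^bsub>QH_tilde G\<^esub> hqm_class G (\<psi> j)) = hqm_class G (\<lambda>g. \<Sum>j\<in>J. c j * \<psi> j g)"
      by auto
    have summand: "c j \<odot>\<^bsub>QH_tilde G\<^esub> hqm_class G (\<psi> j) \<in> carrier (QH_tilde G)" if "j \<in> insert i J" for j
      using insert.prems[OF that] by (simp add: QH_tilde_smult QH_tilde_carrier hqm_scale)
    have i: "\<psi> i \<in> hqm G" using insert.prems by simp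
    have "(\<Oplus>\<^bsub>QH_tilde G\<^esub>j\<in>insert i J. c j \<odot>\<^bsub>QH_tilde G\<^esub> hqm_class G (\<psi> j)) =
        c i \<odot>\<^bsub>QH_tilde G\<^esub> hqm_class G (\<psi> i) \<oplus>\<^bsub>QH_tilde G\<^esub> hqm_class G (\<lambda>g. \<Sum>j\<in>J. c j * \<psi> j g)"
      unfolding IH(2)[symmetric] using insert.hyps summand by (intro M.finsum_insert) auto
    also have "\<dots> = hqm_class G (\<lambda>g. \<Sum>j\<in>insert i J. c j * \<psi> j g)"
      using insert.hyps i IH(1) by (simp add: QH_tilde_smult QH_tilde_add hqm_scale)
    finally show ?case using insert.hyps i IH(1) by (simp add: hqm_scale hqm_add)
  qed
  then show "(\<lambda>g. \<Sum>j\<in>J. c j * \<psi> j g) \<in> hqm G"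
    and "(\<Oplus>\<^bsub>QH_tilde G\<^esub>j\<in>J. c j \<odot>\<^bsub>QH_tilde G\<^esub> hqm_class G (\<psi> j)) = hqm_class G (\<lambda>g. \<Sum>j\<in>J. c j * \<psi> j g)"
    by auto
qed

text \<open>The limits are identified only on the carrier, so \<open>homogenization\<close> may
  differ from the constructed quasimorphism elsewhere.\<close>

lemma hqm_cong:
  assumes "group G" "\<phi> \<in> hqm G" "\<And>g. g \<in> carrier G \<Longrightarrow> \<psi> g = \<phi> g"
  shows "\<psi> \<in> hqm G"
proof -
  interpret group G by fact
  show ?thesis using assms(2,3) by (simp add: hqm_def quasimorphism_def homogeneous_def)
qed

context raag_pair
begin

lemma independent:
  assumes hqm: "\<And>j. \<psi> j \<in> hqm G"
    and vals: "\<And>j k. \<psi> j (test k) = (if j < k then 1 else 0)"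
  shows "linearly_independent (QH_tilde G) (\<lambda>j :: nat. hqm_class G (\<psi> j))"
  unfolding linearly_independent_def
proof (intro conjI allI impI ballI)
  show "range (\<lambda>j. hqm_class G (\<psi> j)) \<subseteq> carrier (QH_tilde G)"
    using hqm by (auto simp: QH_tilde_carrier)
  fix J :: "nat set" and c i
  assume J: "finite J" and zero: "(\<Oplus>\<^bsub>QH_tilde G\<^esub>j\<in>J. c j \<odot>\<^bsub>QH_tilde G\<^esub> hqm_class G (\<psi> j)) = \<zero>\<^bsub>QH_tilde G\<^esub>"
    and i: "i \<in> J"
  define f where "f g = (\<Sum>j\<in>J. c j * \<psi> j g)" for g
  have "f \<in> hqm G" "hqm_class G f = hqm_class G (\<lambda>g. 0)"
    using QH_tilde_sum[OF J hqm, where c = c] zero unfolding f_def by (simp_all add: QH_tilde_zero)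
  then have "f \<in> real_homs G" using hqm_class_eq_iff[OF _ hqm_zero, of f G] by simp
  moreover have "cls [(a, True)] \<in> carrier G" using a by simp
  ultimately have hom: "f (test (Suc k)) - f (test k) = f (cls [(a, True)])" for k
    using test_closed by (simp add: test_Suc real_homs_iff)
  \<comment> \<open>Passing from \<open>k\<close> to \<open>Suc k\<close> changes the value of the
    \<open>k\<close>-th function alone, from 0 to 1, so the difference isolates one
    coefficient.\<close>
  have diff: "f (test (Suc k)) - f (test k) = (if k \<in> J then c k else 0)" for k
  proof -
    have "f (test (Suc k)) - f (test k) = (\<Sum>j\<in>J. if j = k then c j else 0)"
      unfolding f_def sum_subtractf[symmetric] vals by (intro sum.cong) auto
    then show ?thesis using J by simp
  qed
  obtain k where "k \<notin> J" using J infinite_UNIV_nat by (metis ex_new_if_finite)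
  then have "f (cls [(a, True)]) = 0" using hom[of k] diff[of k] by simp
  then show "c i = 0" using hom[of i] diff[of i] i by simp
qed

lemma independent_segments:
  "\<exists>\<gamma> :: nat \<Rightarrow> ('v \<times> bool) list set set list.
    (\<forall>i. segment X (\<gamma> i)) \<and>
    (\<forall>base. base_choice G act X base \<longrightarrow>
      (\<forall>i. \<forall>g\<in>carrier G. convergent (\<lambda>n::nat. seg_qm G act X base (\<gamma> i) (g [^]\<^bsub>G\<^esub> n) / real n)) \<and>
      (\<forall>i. homogenization G (seg_qm G act X base (\<gamma> i)) \<in> hqm G) \<and>
      linearly_independent (QH_tilde G)
        (\<lambda>i. hqm_class G (homogenization G (seg_qm G act X base (\<gamma> i)))))"
proof (intro exI[of _ \<gamma>] conjI allI impI segment_\<gamma>)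
  fix base assume base: "base_choice G act X base"
  have ex: "\<exists>\<psi>. \<psi> \<in> hqm G \<and> (\<forall>g\<in>carrier G. \<bar>fam.omega j \<one>\<^bsub>G\<^esub> g - \<psi> g\<bar> \<le> 3 * real (j + 2)) \<and>
    (\<forall>g\<in>carrier G. (\<lambda>n::nat. seg_qm G act X base (\<gamma> j) (g [^]\<^bsub>G\<^esub> n) / real n) \<longlonglongrightarrow> \<psi> g)" for j
    by (rule homogenization_\<gamma>[of j]) (use base in blast)
  let ?hom = "\<lambda>j. homogenization G (seg_qm G act X base (\<gamma> j))"
  have hom: "?hom j g = \<psi> g"
    if "(\<lambda>n::nat. seg_qm G act X base (\<gamma> j) (g [^]\<^bsub>G\<^esub> n) / real n) \<longlonglongrightarrow> \<psi> g" for j g and \<psi> :: "_ \<Rightarrow> real"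
    unfolding homogenization_def using that by (rule limI)
  show "\<forall>g\<in>carrier G. convergent (\<lambda>n::nat. seg_qm G act X base (\<gamma> j) (g [^]\<^bsub>G\<^esub> n) / real n)" for j
    using ex[of j] by (auto simp: convergent_def)
  have props: "?hom j \<in> hqm G" "\<And>g. g \<in> carrier G \<Longrightarrow> \<bar>fam.omega j \<one>\<^bsub>G\<^esub> g - ?hom j g\<bar> \<le> 3 * real (j + 2)" for j
  proof -
    obtain \<psi> where \<psi>: "\<psi> \<in> hqm G" "\<forall>g\<in>carrier G. \<bar>fam.omega j \<one>\<^bsub>G\<^esub> g - \<psi> g\<bar> \<le> 3 * real (j + 2)"
      "\<forall>g\<in>carrier G. (\<lambda>n::nat. seg_qm G act X base (\<gamma> j) (g [^]\<^bsub>G\<^esub> n) / real n) \<longlonglongrightarrow> \<psi> g"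
      using ex[of j] by blast
    have eq: "?hom j g = \<psi> g" if "g \<in> carrier G" for g using \<psi>(3) that by (intro hom) blast
    show "?hom j \<in> hqm G" using group_axioms \<psi>(1) eq by (rule hqm_cong)
    show "\<bar>fam.omega j \<one>\<^bsub>G\<^esub> g - ?hom j g\<bar> \<le> 3 * real (j + 2)" if "g \<in> carrier G" for g
      using \<psi>(2) that by (simp add: eq)
  qed
  show "?hom j \<in> hqm G" for j by (rule props(1))
  show "linearly_independent (QH_tilde G) (\<lambda>j. hqm_class G (?hom j))"
  proof (rule independent)
    show "?hom j (test k) = (if j < k then 1 else 0)" for j k
    proof -
      have pow: "?hom j (test k [^]\<^bsub>G\<^esub> n) = real n * ?hom j (test k)" for n :: nat
      proof -
        have "?hom j (test k [^]\<^bsub>G\<^esub> int n) = of_int (int n) * ?hom j (test k)"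
          using props(1)[of j] test_closed unfolding hqm_def homogeneous_def by blast
        then show ?thesis by (simp add: int_pow_int)
      qed
      \<comment> \<open>On the \<open>n\<close>-th power \<open>omega\<close> is exactly
        \<open>n\<close> or 0, and it differs from the homogenization by a bound independent of
        \<open>n\<close>. The slopes must therefore agree exactly.\<close>
      have "\<bar>real n * ((if j < k then 1 else 0) - ?hom j (test k))\<bar> \<le> 3 * real (j + 2)" for n :: nat
        using props(2)[of "test k [^]\<^bsub>G\<^esub> n" j] test_closed[of k] omega_test_pow[of j k n] pow[of n]
        by (cases "j < k") (simp_all add: right_diff_distrib)
      then have "(if j < k then 1 else 0) - ?hom j (test k) = 0" by (rule zero_if_multiples_bounded)
      then show ?thesis by simp
    qed
  qed (rule props(1))
qed

end

text \<open>The contrapositive supplies the non-adjacent generators. Commuting letters make each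
  letter commute with every element, and then all elements commute, by two inductions along
  words.\<close>

lemma (in raag_graph) comm_group_if_complete:
  assumes complete: "\<And>v w. v \<in> V \<Longrightarrow> w \<in> V \<Longrightarrow> v \<noteq> w \<Longrightarrow> {v, w} \<in> E"
  shows "comm_group G"
proof (rule group_comm_groupI)
  have swap: "g \<cdot> l \<cdot> m = g \<cdot> m \<cdot> l" if g: "g \<in> carrier G" and l: "l \<in> letters" "m \<in> letters" for g l m
  proof (cases "fst l = fst m")
    case True
    then consider "m = l" | "m = inv_letter l" by (cases l; cases m) auto
    then show ?thesis
    proof cases
      case 2
      then show ?thesis using step_inv[OF g l(1)] step_inv[OF g, of "inv_letter l"] l by simp
    qed simp
  next
    case False
    then show ?thesis using step_commute[OF g complete, of "fst l" "fst m" "snd l" "snd m"] l by auto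
  qed
  have letter: "(\<one>\<^bsub>G\<^esub> \<cdot> l) \<otimes>\<^bsub>G\<^esub> h = h \<cdot> l" if l: "l \<in> letters" and "h \<in> carrier G" for l h
    using that(2)
  proof (induction rule: carrier_induct)
    case (step h m)
    then show ?case using l by (simp add: mult_step swap)
  qed (use l in simp)
  fix x y assume x: "x \<in> carrier G" and "y \<in> carrier G"
  from this(2) show "x \<otimes>\<^bsub>G\<^esub> y = y \<otimes>\<^bsub>G\<^esub> x"
  proof (induction rule: carrier_induct)
    case (step y l)
    have "(y \<cdot> l) \<otimes>\<^bsub>G\<^esub> x = y \<otimes>\<^bsub>G\<^esub> ((\<one>\<^bsub>G\<^esub> \<cdot> l) \<otimes>\<^bsub>G\<^esub> x)"
      using step x by (simp add: mult_step flip: m_assoc)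
    then show ?case using step x by (simp add: letter mult_step)
  qed (use x in simp)
qed

theorem proposition4p7:
  fixes V :: "'v set" and E :: "'v set set"
  defines "G \<equiv> raag V E"
    and "X \<equiv> raag_complex V E"
    and "act \<equiv> (\<lambda>g x. g \<otimes>\<^bsub>raag V E\<^esub> x)"
  assumes "simplicial_graph V E"
    and "\<not> comm_group G"
  shows "\<exists>\<gamma> :: nat \<Rightarrow> ('v \<times> bool) list set set list.
    (\<forall>i. segment X (\<gamma> i)) \<and>
    (\<forall>base. base_choice G act X base \<longrightarrow>
      (\<forall>i. \<forall>g\<in>carrier G. convergent (\<lambda>n::nat. seg_qm G act X base (\<gamma> i) (g [^]\<^bsub>G\<^esub> n) / real n)) \<and>
      (\<forall>i. homogenization G (seg_qm G act X base (\<gamma> i)) \<in> hqm G) \<and>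
      linearly_independent (QH_tilde G)
        (\<lambda>i. hqm_class G (homogenization G (seg_qm G act X base (\<gamma> i)))))"
proof -
  interpret raag_graph V E using assms by unfold_locales
  obtain a b where "a \<in> V" "b \<in> V" "a \<noteq> b" "{a, b} \<notin> E"
    using comm_group_if_complete assms by blast
  then interpret raag_pair V E a b by unfold_locales
  show ?thesis unfolding G_def X_def act_def by (rule independent_segments)
qed

end
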